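(* Let $M^{n+1}(c)$ be a complete simply connected $(n+1)$-dimensional Riemannian manifold of constant sectional curvature $c$, and let $\Omega\subset M^{n+1}(c)$ be a closed compact domain whose boundary $\partial\Omega$ is a $C^2$-smooth hypersurface. Let $O$ be a point inside $\Omega$, let $h=\mathrm{dist}(O,\partial\Omega)$, and for $P\in\partial\Omega$ let $\varphi=\varphi(P)$ be the angle at $P$ between the radial direction from $O$ to $P$ and the outer normal to $\partial\Omega$ at $P$. Then the following estimates hold at every point $P\in\partial\Omega$. 1. If $c=0$ (so $M^{n+1}(c)=\mathbb{E}^{n+1}$ is Euclidean space) and all normal curvatures of $\partial\Omega$ at every point and in every direction satisfy $k_n\geqslant k_0>0$, then $$\cos\varphi\geqslant\sqrt{2hk_0-h^2k_0^2}\geqslant hk_0 .$$ 2. If $c=-k_1^2$ with $k_1>0$ (so $M^{n+1}(c)=\mathbb{H}^{n+1}(-k_1^2)$ is Lobachevsky space) and all normal curvatures of $\partial\Omega$ satisfy $k_n\geqslant k_0>k_1$, then $$\cos\varphi\geqslant\sqrt{1-\frac{\sinh^2 k_1(R-h)}{\sinh^2 k_1R}}\geqslant\frac{\sinh k_1h}{\sinh k_1R},$$ where $R=\frac1{k_1}\operatorname{arcoth}\frac{k_0}{k_1}$ is the radius of a circle of curvature $k_0$ on the two-dimensional Lobachevsky plane of Gaussian curvature $-k_1^2$. 3. If $c=k_1^2$ with $k_1>0$ (so $M^{n+1}(c)=S^{n+1}(k_1^2)$ is the sphere) and all normal curvatures of $\partial\Omega$ satisfy $k_n\geqslant k_0\geqslant0$,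 then $$\cos\varphi\geqslant\sqrt{1-\frac{\sin^2 k_1(R-h)}{\sin^2 k_1R}}\geqslant\frac{\sin k_1h}{\sin k_1R},$$ where $R=\frac1{k_1}\operatorname{arccot}\frac{k_0}{k_1}$ is the radius of a circle of curvature $k_0$ on the two-dimensional sphere of Gaussian curvature $k_1^2$.
   Context: $k_n=k_n(P,Y)$ denotes the normal curvature of $\partial\Omega$ at $P\in\partial\Omega$ in the direction $Y\in T_P\partial\Omega$, with the sign convention that the boundary of a small round ball has positive normal curvatures. The radial direction from $O$ to $P$ is the direction at $P$ (pointing away from $O$) of the geodesic line from $O$ to $P$, i.e. the coordinate vector $\partial_t$ of geodesic polar coordinates centred at $O$, where $t$ is the distance from $O$. The value of $\operatorname{arccot}$ on $[0,\infty)$ is taken in $(0,\pi/2]$. *)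

theory Defs
  imports "HOL-Analysis.Analysis"
begin

section \<open>Hypersurfaces in an ambient space with a constant bilinear form\<close>

text \<open>
  Throughout, \<open>M\<close> is a smooth submanifold of a Euclidean space and \<open>g\<close> a constant symmetric
  bilinear form on that space which is positive definite on the tangent spaces of \<open>M\<close>; the
  Riemannian metric of \<open>M\<close> is the restriction of \<open>g\<close>. The Levi-Civita derivative along a curve in
  \<open>M\<close> is then the \<open>g\<close>-orthogonal projection onto the tangent spaces of \<open>M\<close> of the ordinary
  derivative.
\<close>

definition C2_on :: "'a::real_normed_vector set \<Rightarrow> ('a \<Rightarrow> 'b::real_normed_vector) \<Rightarrow> bool" where
  "C2_on U f \<longleftrightarrow> (\<exists>f' f''. (\<forall>x\<in>U. (f has_derivative blinfun_apply (f' x)) (at x) \<and>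
      (f' has_derivative blinfun_apply (f'' x)) (at x)) \<and> continuous_on U f'')"

abbreviation velocity :: "(real \<Rightarrow> 'e::real_normed_vector) \<Rightarrow> real \<Rightarrow> 'e" where
  "velocity \<gamma> t \<equiv> vector_derivative \<gamma> (at t)"

abbreviation acceleration :: "(real \<Rightarrow> 'e::real_normed_vector) \<Rightarrow> real \<Rightarrow> 'e" where
  "acceleration \<gamma> t \<equiv> vector_derivative (velocity \<gamma>) (at t)"

definition tangent_space :: "'e::real_normed_vector set \<Rightarrow> 'e \<Rightarrow> 'e set" where
  "tangent_space S P = {v. \<exists>\<gamma>. \<gamma> 0 = P \<and> (\<forall>\<^sub>F t in nhds (0::real). \<gamma> t \<in> S) \<and>
      (\<gamma> has_vector_derivative v) (at 0)}"

text \<open>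
  Only paths that are \<open>C\<^sup>1\<close> up to the endpoints are admitted: for \<^const>\<open>valid_path\<close> the speed may
  fail to be integrable, and \<^const>\<open>integral\<close> would then assign the length \<open>0\<close>.
\<close>

definition riem_dist ::
  "'e::real_normed_vector set \<Rightarrow> ('e \<Rightarrow> 'e \<Rightarrow> real) \<Rightarrow> 'e \<Rightarrow> 'e \<Rightarrow> real" where
  "riem_dist M g x y = Inf {integral {0..1} (\<lambda>t. sqrt (g (velocity \<gamma> t) (velocity \<gamma> t))) |\<gamma>.
      \<gamma> C1_differentiable_on {0..1} \<and> \<gamma> ` {0..1} \<subseteq> M \<and> \<gamma> 0 = x \<and> \<gamma> 1 = y}"

text \<open>Unit-speed geodesics, parametrised on the whole line: the acceleration is normal to \<open>M\<close>.\<close>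

definition geodesic_line ::
  "'e::real_normed_vector set \<Rightarrow> ('e \<Rightarrow> 'e \<Rightarrow> real) \<Rightarrow> (real \<Rightarrow> 'e) \<Rightarrow> bool" where
  "geodesic_line M g \<gamma> \<longleftrightarrow> C2_on UNIV \<gamma> \<and> range \<gamma> \<subseteq> M \<and>
      (\<forall>t. g (velocity \<gamma> t) (velocity \<gamma> t) = 1 \<and>
           (\<forall>w\<in>tangent_space M (\<gamma> t). g (acceleration \<gamma> t) w = 0))"

definition radial_direction ::
  "'e::real_normed_vector set \<Rightarrow> ('e \<Rightarrow> 'e \<Rightarrow> real) \<Rightarrow> 'e \<Rightarrow> 'e \<Rightarrow> 'e" where
  "radial_direction M g Q P = (THE v. \<exists>\<gamma>. geodesic_line M g \<gamma> \<and> \<gamma> 0 = Q \<and>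
      \<gamma> (riem_dist M g Q P) = P \<and> v = velocity \<gamma> (riem_dist M g Q P))"

definition angle :: "('e \<Rightarrow> 'e \<Rightarrow> real) \<Rightarrow> 'e \<Rightarrow> 'e \<Rightarrow> real" where
  "angle g v w = arccos (g v w / (sqrt (g v v) * sqrt (g w w)))"

abbreviation boundary_in :: "'e::topological_space set \<Rightarrow> 'e set \<Rightarrow> 'e set" where
  "boundary_in M \<Omega> \<equiv> top_of_set M frontier_of \<Omega>"

definition C2_hypersurface :: "'e::real_normed_vector set \<Rightarrow> 'e set \<Rightarrow> bool" where
  "C2_hypersurface M S \<longleftrightarrow> S \<subseteq> M \<and> (\<forall>P\<in>S. \<exists>U (f :: 'e \<Rightarrow> real). open U \<and> P \<in> U \<and> C2_on U f \<and>
      S \<inter> U = {x \<in> M \<inter> U. f x = 0} \<and>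
      (\<exists>v\<in>tangent_space M P. frechet_derivative f (at P) v \<noteq> 0))"

text \<open>A closed domain is the closure of a domain, i.e. of a nonempty connected open set.\<close>

definition closed_domain :: "'e::topological_space set \<Rightarrow> 'e set \<Rightarrow> bool" where
  "closed_domain M \<Omega> \<longleftrightarrow> (\<exists>D. openin (top_of_set M) D \<and> connected D \<and> D \<noteq> {} \<and>
      \<Omega> = top_of_set M closure_of D)"

definition compact_C2_domain :: "'e::real_normed_vector set \<Rightarrow> 'e set \<Rightarrow> bool" where
  "compact_C2_domain M \<Omega> \<longleftrightarrow>
      closed_domain M \<Omega> \<and> compact \<Omega> \<and> C2_hypersurface M (boundary_in M \<Omega>)"

definition outer_normal ::
  "'e::real_normed_vector set \<Rightarrow> ('e \<Rightarrow> 'e \<Rightarrow> real) \<Rightarrow> 'e set \<Rightarrow> 'e \<Rightarrow> 'e" where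
  "outer_normal M g \<Omega> P = (THE \<nu>. \<nu> \<in> tangent_space M P \<and> g \<nu> \<nu> = 1 \<and>
      (\<forall>Y\<in>tangent_space (boundary_in M \<Omega>) P. g \<nu> Y = 0) \<and>
      (\<exists>\<gamma>. \<gamma> 0 = P \<and> (\<gamma> has_vector_derivative \<nu>) (at 0) \<and>
           (\<forall>\<^sub>F t in at_right (0::real). \<gamma> t \<in> M - \<Omega>)))"

text \<open>
  The second fundamental form with respect to the inner normal, evaluated on \<open>Y\<close> through a curve
  in the boundary with velocity \<open>Y\<close> and divided by \<open>g Y Y\<close>. As the normal is tangent to \<open>M\<close>, the
  ambient acceleration may replace the covariant one. Round balls have positive normal curvature.
\<close>

definition normal_curvature ::
  "'e::real_normed_vector set \<Rightarrow> ('e \<Rightarrow> 'e \<Rightarrow> real) \<Rightarrow> 'e set \<Rightarrow> 'e \<Rightarrow> 'e \<Rightarrow> real" where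
  "normal_curvature M g \<Omega> P Y = (THE k. \<exists>\<alpha> \<epsilon>. \<epsilon> > 0 \<and> C2_on {-\<epsilon><..<\<epsilon>} \<alpha> \<and>
      \<alpha> ` {-\<epsilon><..<\<epsilon>} \<subseteq> boundary_in M \<Omega> \<and> \<alpha> 0 = P \<and> velocity \<alpha> 0 = Y \<and>
      k = - g (acceleration \<alpha> 0) (outer_normal M g \<Omega> P) / g Y Y)"

definition normal_curvatures_ge ::
  "'e::real_normed_vector set \<Rightarrow> ('e \<Rightarrow> 'e \<Rightarrow> real) \<Rightarrow> 'e set \<Rightarrow> real \<Rightarrow> bool" where
  "normal_curvatures_ge M g \<Omega> k0 \<longleftrightarrow> (\<forall>P\<in>boundary_in M \<Omega>.
      \<forall>Y\<in>tangent_space (boundary_in M \<Omega>) P - {0}. normal_curvature M g \<Omega> P Y \<ge> k0)"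

definition dist_to_boundary ::
  "'e::real_normed_vector set \<Rightarrow> ('e \<Rightarrow> 'e \<Rightarrow> real) \<Rightarrow> 'e set \<Rightarrow> 'e \<Rightarrow> real" where
  "dist_to_boundary M g \<Omega> Q = Inf (riem_dist M g Q ` boundary_in M \<Omega>)"

definition boundary_angle ::
  "'e::real_normed_vector set \<Rightarrow> ('e \<Rightarrow> 'e \<Rightarrow> real) \<Rightarrow> 'e set \<Rightarrow> 'e \<Rightarrow> 'e \<Rightarrow> real" where
  "boundary_angle M g \<Omega> Q P = angle g (radial_direction M g Q P) (outer_normal M g \<Omega> P)"

section \<open>Space forms\<close>

text \<open>
  The complete simply connected spaces of constant curvature and dimension \<open>DIM('a) \<ge> 2\<close>: the
  Euclidean space \<open>'a\<close> itself (\<open>M = UNIV\<close>, \<open>g = inner\<close>); for curvature \<open>- k\<^sup>2\<close> the upper sheet of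
  the hyperboloid in the Minkowski space \<open>'a \<times> real\<close>; for curvature \<open>k\<^sup>2\<close> the sphere of radius
  \<open>1 / k\<close> in the Euclidean space \<open>'a \<times> real\<close> with \<open>g = inner\<close>.
\<close>

definition minkowski :: "'a::euclidean_space \<times> real \<Rightarrow> 'a \<times> real \<Rightarrow> real" where
  "minkowski x y = inner (fst x) (fst y) - snd x * snd y"

definition hyperbolic_space :: "real \<Rightarrow> ('a::euclidean_space \<times> real) set" where
  "hyperbolic_space k = {x. minkowski x x = - (1 / k\<^sup>2) \<and> snd x > 0}"

definition sphere_space :: "real \<Rightarrow> ('a::euclidean_space \<times> real) set" where
  "sphere_space k = sphere 0 (1 / k)"

section \<open>Inverse cotangents\<close>

definition arccot :: "real \<Rightarrow> real" where
  "arccot x = pi / 2 - arctan x"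

lemma cot_arccot: "cot (arccot x) = x"
  using tan_arctan[of x] unfolding arccot_def tan_def cot_def
  by (simp add: cos_diff sin_diff)

lemma arccot_bounds: "0 \<le> x \<Longrightarrow> arccot x \<in> {0<..pi / 2}"
  using arctan_ubound[of x] by (simp add: arccot_def)

definition arcoth :: "real \<Rightarrow> real" where
  "arcoth x = artanh (1 / x)"

lemma coth_arcoth:
  assumes "x > 1"
  shows "cosh (arcoth x) / sinh (arcoth x) = x"
proof -
  define y where "y = arcoth x"
  have pos: "(1 + 1 / x) / (1 - 1 / x) > 0"
    using assms by (intro divide_pos_pos add_pos_pos) (auto simp: field_simps)
  have "exp (- 2 * y) = (1 - 1 / x) / (1 + 1 / x)"
    using pos by (simp add: y_def arcoth_def artanh_def exp_minus)
  also have "\<dots> = (x - 1) / (x + 1)"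
    using assms by (simp add: divide_simps)
  finally have "tanh y = (1 - (x - 1) / (x + 1)) / (1 + (x - 1) / (x + 1))"
    by (simp only: tanh_real_altdef)
  also have "1 - (x - 1) / (x + 1) = 2 / (x + 1)"
    using assms by (simp add: divide_simps)
  also have "1 + (x - 1) / (x + 1) = 2 * x / (x + 1)"
    using assms by (simp add: divide_simps)
  also have "2 / (x + 1) / (2 * x / (x + 1)) = 1 / x"
    using assms by (simp add: divide_simps)
  finally have "tanh y = 1 / x" .
  then have "sinh (arcoth x) / cosh (arcoth x) = 1 / x"
    by (simp add: y_def tanh_def)
  then show ?thesis
    by (metis inverse_divide inverse_inverse_eq inverse_eq_divide)
qed

end

theory Submission
  imports Defs
begin

text \<open>
  All three geometries are treated at once as quadrics \<open>c g(z, z) = 1\<close> for a bilinear form \<open>g\<close>.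
  Extending the local defining functions of the domain homogeneously to the cone over the quadric
  turns geodesic convexity into convexity along straight segments. Nonnegative normal curvatures
  keep the tangent lines of the boundary locally outside the domain, so that the set of points
  visible from a given interior point is both open and closed; hence the domain is convex.

  Convexity is then sharpened to Blaschke's theorem: the domain lies in the ball of curvature \<open>k0\<close>
  that touches it from outside at a given boundary point \<open>P\<close>. If an interior point \<open>Q\<close> were outside that
  ball, rotate the geodesic arc from \<open>P\<close> to \<open>Q\<close> through circular arcs of curvature less than \<open>k0\<close>
  until it becomes tangent to the boundary at \<open>P\<close>. None of these arcs can first touch the
  boundary from inside, yet the final one leaves the domain at \<open>P\<close>.

  Since every point at distance less than \<open>h\<close> from \<open>O\<close> belongs to the domain, \<open>O\<close> is at distance at most
  \<open>R - h\<close> from the centre of the touching ball of radius \<open>R\<close>. In the triangle with vertices \<open>O\<close>, \<open>P\<close> and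
  that centre the angle at \<open>P\<close> is \<open>\<phi>\<close>, and the estimates follow from the law of cosines.
\<close>

section \<open>Functions of class \<open>C\<^sup>2\<close> and implicit curves\<close>

text \<open>Inversion at P is stereographic projection of the quadric onto the tangent space at P,
  so all three geometries share one flat picture. With \<xi> the image of Q and \<open>q0\<close>
  minus its normal component, Q lies outside the ball of curvature \<open>k0\<close> exactly when 2
  q0 < k0. All lines used through \<xi> pass the origin at distance at most \<open>q0\<close>, so
  the arcs have curvature below \<open>k0\<close>. Each arc ends at P, which is not interior. For s
  > 0 it arrives transversally, which secures openness at that end; in the limit s = 0 it is tangent
  and the second derivative decides.

  Two obstacles shape the rest. On the sphere k0 = 0 is allowed, so a second-derivative test at a
  single boundary point decides nothing, and the curvature bound is used along a whole curve of
  neighbouring boundary points. Moreover, on the sphere a straight segment may pass through 0.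
  Opposite points must therefore be treated separately in the visibility argument, and excluded by
  strict support before a chord or a radial direction is used.\<close>

definition C2_derivs ::
  "'a::real_normed_vector set \<Rightarrow> ('a \<Rightarrow> 'b::real_normed_vector) \<Rightarrow> ('a \<Rightarrow> 'a \<Rightarrow>\<^sub>L 'b) \<Rightarrow>
    ('a \<Rightarrow> 'a \<Rightarrow>\<^sub>L 'a \<Rightarrow>\<^sub>L 'b) \<Rightarrow> bool" where
  "C2_derivs U f f' f'' \<longleftrightarrow> open U \<and>
     (\<forall>x\<in>U. (f has_derivative blinfun_apply (f' x)) (at x) \<and>
       (f' has_derivative blinfun_apply (f'' x)) (at x)) \<and> continuous_on U f''"

lemma C2_derivsD:
  assumes "C2_derivs U f f' f''"
  shows "open U" "x \<in> U \<Longrightarrow> (f has_derivative blinfun_apply (f' x)) (at x)"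
    "x \<in> U \<Longrightarrow> (f' has_derivative blinfun_apply (f'' x)) (at x)" "continuous_on U f''"
    "continuous_on U f'" "continuous_on U f"
proof -
  show *: "open U" "x \<in> U \<Longrightarrow> (f has_derivative blinfun_apply (f' x)) (at x)"
    "x \<in> U \<Longrightarrow> (f' has_derivative blinfun_apply (f'' x)) (at x)" "continuous_on U f''" for x
    using assms unfolding C2_derivs_def by simp_all
  show "continuous_on U f'" "continuous_on U f"
    using *(2,3) by (meson continuous_at_imp_continuous_on has_derivative_continuous)+
qed

lemma C2_derivs_subset: "C2_derivs U f f' f'' \<Longrightarrow> open V \<Longrightarrow> V \<subseteq> U \<Longrightarrow> C2_derivs V f f' f''"
  unfolding C2_derivs_def by (auto intro: continuous_on_subset)

lemma C2_on_imp_derivs: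
  assumes "C2_on U f" "open U"
  obtains f' f'' where "C2_derivs U f f' f''"
proof -
  from assms(1) obtain f' f'' where "(\<forall>x\<in>U. (f has_derivative blinfun_apply (f' x)) (at x) \<and>
      (f' has_derivative blinfun_apply (f'' x)) (at x)) \<and> continuous_on U f''"
    unfolding C2_on_def by (elim exE)
  with assms(2) show thesis using that[of f' f''] unfolding C2_derivs_def by simp
qed

lemma C2_on_subset: "C2_on U f \<Longrightarrow> V \<subseteq> U \<Longrightarrow> C2_on V f"
  unfolding C2_on_def by (elim ex_forward) (auto intro: continuous_on_subset)

lemma C2_on_compose:
  fixes p :: "'d::euclidean_space \<Rightarrow> 'e::real_normed_vector" and f :: "'e \<Rightarrow> 'b::real_normed_vector"
  assumes "C2_on U f" "C2_on W p" "p ` W \<subseteq> U"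
  shows "C2_on W (\<lambda>x. f (p x))"
proof -
  obtain f' f'' where f: "\<And>x. x \<in> U \<Longrightarrow> (f has_derivative blinfun_apply (f' x)) (at x)"
    "\<And>x. x \<in> U \<Longrightarrow> (f' has_derivative blinfun_apply (f'' x)) (at x)" "continuous_on U f''"
    using assms(1) unfolding C2_on_def by blast
  obtain p' p'' where p: "\<And>x. x \<in> W \<Longrightarrow> (p has_derivative blinfun_apply (p' x)) (at x)"
    "\<And>x. x \<in> W \<Longrightarrow> (p' has_derivative blinfun_apply (p'' x)) (at x)" "continuous_on W p''"
    using assms(2) unfolding C2_on_def by blast
  define D where "D x = f' (p x) o\<^sub>L p' x" for x
  define E where "E x = (\<lambda>h. (f' (p x) o\<^sub>L p'' x h) + (f'' (p x) (p' x h) o\<^sub>L p' x))" for x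
  have 1: "((\<lambda>x. f (p x)) has_derivative blinfun_apply (D x)) (at x)" if "x \<in> W" for x
  proof -
    have "blinfun_apply (D x) = (\<lambda>h. f' (p x) (p' x h))" by (simp add: D_def fun_eq_iff)
    then show ?thesis
      using has_derivative_compose[OF p(1)[OF that] f(1)] assms(3) that
      by (simp add: image_subset_iff)
  qed
  have 2: "(D has_derivative E x) (at x)" if "x \<in> W" for x
  proof -
    have "((\<lambda>x. f' (p x)) has_derivative (\<lambda>h. f'' (p x) (p' x h))) (at x)"
      using has_derivative_compose[OF p(1)[OF that] f(2)] assms(3) that by (simp add: image_subset_iff)
    from bounded_bilinear.FDERIV[OF bounded_bilinear_blinfun_compose this p(2)[OF that]]
    show ?thesis unfolding D_def[abs_def] E_def .
  qed
  have bl: "bounded_linear (E x)" if "x \<in> W" for x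
    using 2[OF that] by (rule has_derivative_bounded_linear)
  have cp: "continuous_on W p" "continuous_on W p'"
    using p(1,2) by (meson continuous_at_imp_continuous_on has_derivative_continuous)+
  have cf: "continuous_on U f'"
    using f(2) by (meson continuous_at_imp_continuous_on has_derivative_continuous)+
  have c1: "continuous_on W (\<lambda>x. f' (p x))" "continuous_on W (\<lambda>x. f'' (p x))"
    using continuous_on_compose2[OF cf cp(1) assms(3)] continuous_on_compose2[OF f(3) cp(1) assms(3)] by auto
  \<comment> \<open>In finite dimension continuity in operator norm may be tested on basis vectors,
    where \<open>E\<close> is an explicit continuous expression.\<close>
  have "continuous_on W (\<lambda>x. Blinfun (E x))"
  proof (rule continuous_on_blinfun_componentwise)
    fix i :: 'd
    have "continuous_on W (\<lambda>x. E x i)"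
      unfolding E_def
      by (intro continuous_on_add bounded_bilinear.continuous_on[OF bounded_bilinear_blinfun_compose]
          c1 cp p(3) blinfun.continuous_on continuous_intros)
    then show "continuous_on W (\<lambda>x. Blinfun (E x) i)"
      by (rule continuous_on_eq) (simp add: bounded_linear_Blinfun_apply bl)
  qed
  with 1 2 bl show ?thesis
    unfolding C2_on_def
    by (intro exI[of _ D] exI[of _ "\<lambda>x. Blinfun (E x)"]) (auto simp: bounded_linear_Blinfun_apply)
qed

text \<open>The bounded linear maps demanded by \<open>C2_on\<close> are, for a real curve,
  multiplication by the derivative vectors.\<close>

lemma C2_on_curveI:
  fixes \<gamma> :: "real \<Rightarrow> 'e::real_normed_vector"
  assumes "\<And>t. t \<in> S \<Longrightarrow> (\<gamma> has_vector_derivative d1 t) (at t)"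
    "\<And>t. t \<in> S \<Longrightarrow> (d1 has_vector_derivative d2 t) (at t)" "continuous_on S d2"
  shows "C2_on S \<gamma>"
proof -
  have "((\<lambda>t. blinfun_scaleR_left (d1 t)) has_derivative
     (\<lambda>h. blinfun_scaleR_left (h *\<^sub>R d2 t))) (at t)" if "t \<in> S" for t
    using bounded_linear.has_derivative[OF bounded_linear_blinfun_scaleR_left
        assms(2)[OF that, unfolded has_vector_derivative_def]] .
  moreover have "(\<lambda>h. blinfun_scaleR_left (h *\<^sub>R d2 t)) =
      blinfun_apply (blinfun_scaleR_left (blinfun_scaleR_left (d2 t)))" for t
    by (auto intro!: blinfun_eqI simp: fun_eq_iff blinfun.bilinear_simps)
  ultimately have 2: "((\<lambda>t. blinfun_scaleR_left (d1 t)) has_derivative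
     blinfun_scaleR_left (blinfun_scaleR_left (d2 t))) (at t)" if "t \<in> S" for t
    using that by simp
  show ?thesis
    unfolding C2_on_def
    using assms(1,3) 2
    by (intro exI[of _ "\<lambda>t. blinfun_scaleR_left (d1 t)"]
        exI[of _ "\<lambda>t. blinfun_scaleR_left (blinfun_scaleR_left (d2 t))"])
      (auto simp: has_vector_derivative_def intro!: bounded_linear.continuous_on[OF bounded_linear_blinfun_scaleR_left])
qed

lemma C2_on_curveD:
  fixes \<gamma> :: "real \<Rightarrow> 'e::real_normed_vector"
  assumes "C2_on S \<gamma>" "open S" "t \<in> S"
  shows "(\<gamma> has_vector_derivative velocity \<gamma> t) (at t)"
    "(velocity \<gamma> has_vector_derivative acceleration \<gamma> t) (at t)"
proof -
  obtain f' f'' where f: "\<And>x. x \<in> S \<Longrightarrow> (\<gamma> has_derivative blinfun_apply (f' x)) (at x)"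
    "\<And>x. x \<in> S \<Longrightarrow> (f' has_derivative blinfun_apply (f'' x)) (at x)"
    using assms(1) unfolding C2_on_def by blast
  have *: "(\<gamma> has_vector_derivative f' x 1) (at x)" if "x \<in> S" for x
    unfolding has_vector_derivative_def
    using f(1)[OF that] by (rule has_derivative_eq_rhs) (simp add: fun_eq_iff flip: blinfun.scaleR_right)
  then have v: "velocity \<gamma> x = f' x 1" if "x \<in> S" for x
    using vector_derivative_at that by blast
  show "(\<gamma> has_vector_derivative velocity \<gamma> t) (at t)"
    using *[OF assms(3)] v[OF assms(3)] by simp
  have eq: "(\<lambda>h. f'' t h 1) = (\<lambda>h. h *\<^sub>R f'' t 1 1)"
  proof
    fix h show "f'' t h 1 = h *\<^sub>R f'' t 1 1"
      using blinfun.scaleR_right[of "f'' t" h 1] by (simp add: blinfun.scaleR_left)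
  qed
  have "((\<lambda>x. f' x 1) has_derivative (\<lambda>h. f'' t h 1)) (at t)"
    using blinfun.FDERIV[OF f(2)[OF assms(3)] has_derivative_const[of 1]] by simp
  then have "((\<lambda>x. f' x 1) has_vector_derivative f'' t 1 1) (at t)"
    unfolding has_vector_derivative_def eq .
  then have "(velocity \<gamma> has_vector_derivative f'' t 1 1) (at t)"
    by (rule has_vector_derivative_transform_within_open[OF _ assms(2,3)]) (use v in auto)
  then show "(velocity \<gamma> has_vector_derivative acceleration \<gamma> t) (at t)"
    using vector_derivative_at by fastforce
qed

lemma C2_derivs_along:
  fixes \<gamma> :: "real \<Rightarrow> 'e::real_normed_vector" and f :: "'e \<Rightarrow> real"
  assumes "C2_derivs U f f' f''" "\<gamma> t \<in> U" "(\<gamma> has_vector_derivative d1 t) (at t within S)"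
  shows "((\<lambda>t. f (\<gamma> t)) has_real_derivative f' (\<gamma> t) (d1 t)) (at t within S)"
    and "(d1 has_vector_derivative d2) (at t within S) \<Longrightarrow>
      ((\<lambda>t. f' (\<gamma> t) (d1 t)) has_real_derivative f'' (\<gamma> t) (d1 t) (d1 t) + f' (\<gamma> t) d2) (at t within S)"
proof -
  note g = assms(3)[unfolded has_vector_derivative_def]
  have "((\<lambda>t. f (\<gamma> t)) has_derivative (\<lambda>h. f' (\<gamma> t) (h *\<^sub>R d1 t))) (at t within S)"
    using has_derivative_compose[OF g C2_derivsD(2)[OF assms(1,2)]] .
  then show "((\<lambda>t. f (\<gamma> t)) has_real_derivative f' (\<gamma> t) (d1 t)) (at t within S)"
    unfolding has_field_derivative_def
    by (rule has_derivative_eq_rhs) (simp add: fun_eq_iff blinfun.scaleR_right)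
  assume d: "(d1 has_vector_derivative d2) (at t within S)"
  have "((\<lambda>t. f' (\<gamma> t)) has_derivative (\<lambda>h. f'' (\<gamma> t) (h *\<^sub>R d1 t))) (at t within S)"
    using has_derivative_compose[OF g C2_derivsD(3)[OF assms(1,2)]] .
  from blinfun.FDERIV[OF this d[unfolded has_vector_derivative_def]]
  show "((\<lambda>t. f' (\<gamma> t) (d1 t)) has_real_derivative f'' (\<gamma> t) (d1 t) (d1 t) + f' (\<gamma> t) d2) (at t within S)"
    unfolding has_field_derivative_def
    by (rule has_derivative_eq_rhs) (simp add: fun_eq_iff blinfun.bilinear_simps algebra_simps)
qed

text \<open>The implicit function theorem in the plane through y spanned by Y and w. Since f
  increases strictly along w, the map (t, x) \<mapsto> (t, f) is injective, and invariance of domain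
  makes its image open. The last clause covers the whole w-segment between the line y + t Y and the
  curve, so that values of f on the two can be compared.\<close>

lemma implicit_curve:
  fixes f :: "'e::real_normed_vector \<Rightarrow> real"
  assumes C2: "C2_derivs U f f' f''" and y: "y \<in> U" "f y = 0" and Y: "f' y Y = 0" and w: "f' y w > 0"
  obtains \<epsilon> s s1 s2 where "\<epsilon> > 0" "s 0 = 0" "s1 0 = 0"
    "\<And>t. t \<in> {-\<epsilon><..<\<epsilon>} \<Longrightarrow> (s has_real_derivative s1 t) (at t)"
    "\<And>t. t \<in> {-\<epsilon><..<\<epsilon>} \<Longrightarrow> (s1 has_real_derivative s2 t) (at t)"
    "continuous_on {-\<epsilon><..<\<epsilon>} s2"
    "\<And>t. t \<in> {-\<epsilon><..<\<epsilon>} \<Longrightarrow> f (y + t *\<^sub>R Y + s t *\<^sub>R w) = 0"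
    "\<And>t \<sigma>. t \<in> {-\<epsilon><..<\<epsilon>} \<Longrightarrow> \<bar>\<sigma>\<bar> \<le> \<bar>s t\<bar> \<Longrightarrow>
       y + t *\<^sub>R Y + \<sigma> *\<^sub>R w \<in> U \<and> f' (y + t *\<^sub>R Y + \<sigma> *\<^sub>R w) w > 0"
proof -
  note C = C2_derivsD[OF C2]
  define \<Phi> where "\<Phi> p = y + fst p *\<^sub>R Y + snd p *\<^sub>R w" for p :: "real \<times> real"
  have c\<Phi>: "continuous_on A \<Phi>" for A
    unfolding \<Phi>_def by (intro continuous_intros)
  define V where "V = {z \<in> U. f' z w > 0}"
  have "open V"
  proof -
    have "continuous_on U (\<lambda>z. f' z w)" by (intro blinfun.continuous_on C(5) continuous_intros)
    then have "open (U \<inter> (\<lambda>z. f' z w) -` {0<..})"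
      using C(1) by (intro continuous_open_preimage) auto
    then show ?thesis by (auto simp: V_def vimage_def Int_def)
  qed
  then have "open (\<Phi> -` V)"
    using continuous_on_open_vimage[of UNIV \<Phi>] c\<Phi> by auto
  moreover have "(0,0) \<in> \<Phi> -` V" using y w by (auto simp: V_def \<Phi>_def)
  ultimately obtain A B where AB: "open A" "open B" "(0,0) \<in> A \<times> B" "A \<times> B \<subseteq> \<Phi> -` V"
    using open_prod_elim[of "\<Phi> -` V" "(0, 0)"] by metis
  obtain a b where a: "a > 0" "ball 0 a \<subseteq> A" and b: "b > 0" "ball 0 b \<subseteq> B"
    using AB(1-3) open_contains_ball_eq[of A 0] open_contains_ball_eq[of B 0] by auto
  define S where "S = {-a<..<a} \<times> {-b<..<b}"
  have SV: "\<Phi> p \<in> U" "f' (\<Phi> p) w > 0" if "p \<in> S" for p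
  proof -
    have "p \<in> A \<times> B" using that a b by (auto simp: S_def subset_iff dist_real_def abs_less_iff)
    then show "\<Phi> p \<in> U" "f' (\<Phi> p) w > 0" using AB(4) by (auto simp: V_def)
  qed
  have "open S" by (auto simp: S_def intro: open_Times)
  define G where "G p = (fst p, f (\<Phi> p))" for p
  have d\<Phi>: "(\<Phi> has_derivative (\<lambda>h. fst h *\<^sub>R Y + snd h *\<^sub>R w)) (at p)" for p
    unfolding \<Phi>_def by (auto intro!: derivative_eq_intros)
  have dG: "(G has_derivative (\<lambda>h. (fst h, f' (\<Phi> p) (fst h *\<^sub>R Y + snd h *\<^sub>R w)))) (at p)" if "p \<in> S" for p
    unfolding G_def
    by (intro has_derivative_Pair has_derivative_fst has_derivative_ident
        has_derivative_compose[OF d\<Phi> C(2)] SV that)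
  have cG: "continuous_on S G"
    using dG by (meson continuous_at_imp_continuous_on has_derivative_continuous)+
  have mono: "f (\<Phi> (t, x)) < f (\<Phi> (t, z))" if "(t, x) \<in> S" "(t, z) \<in> S" "x < z" for t x z
  proof (rule DERIV_pos_imp_increasing[OF that(3)])
    fix u assume u: "x \<le> u" "u \<le> z"
    then have uS: "(t, u) \<in> S" using that by (auto simp: S_def)
    have "((\<lambda>u. \<Phi> (t, u)) has_vector_derivative w) (at u)"
      unfolding \<Phi>_def by (auto intro!: derivative_eq_intros)
    from C2_derivs_along(1)[OF C2 SV(1)[OF uS] this]
    show "\<exists>d. ((\<lambda>u. f (\<Phi> (t, u))) has_real_derivative d) (at u) \<and> d > 0"
      using SV(2)[OF uS] by blast
  qed
  have inj: "inj_on G S"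
  proof (rule inj_onI)
    fix p q assume pq: "p \<in> S" "q \<in> S" "G p = G q"
    then obtain t x z where [simp]: "p = (t, x)" "q = (t, z)"
      by (cases p; cases q) (auto simp: G_def)
    show "p = q"
      using mono[of t x z] mono[of t z x] pq
      by (cases x z rule: linorder_cases) (auto simp: G_def)
  qed
  define g where "g = inv_into S G"
  have gG: "g (G p) = p" if "p \<in> S" for p using inj that by (simp add: g_def)
  have oI: "open (G ` S)" by (rule invariance_of_domain[OF cG \<open>open S\<close> inj])
  have 00: "(0,0) \<in> S" using a b by (simp add: S_def)
  have G00: "G (0,0) = (0,0)" using y by (simp add: G_def \<Phi>_def)
  have "open ((\<lambda>t. (t, 0::real)) -` (G ` S))"
    using continuous_on_open_vimage[of UNIV "\<lambda>t::real. (t, 0::real)"] oI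
    by (auto intro!: continuous_intros)
  moreover have "0 \<in> (\<lambda>t. (t, 0::real)) -` (G ` S)" using 00 G00 by force
  ultimately obtain \<epsilon> where \<epsilon>: "\<epsilon> > 0" "ball 0 \<epsilon> \<subseteq> (\<lambda>t. (t, 0::real)) -` (G ` S)"
    using open_contains_ball_eq by metis
  have im: "(t, 0) \<in> G ` S" if "t \<in> {-\<epsilon><..<\<epsilon>}" for t
    using \<epsilon>(2) that by (auto simp: subset_iff dist_real_def abs_less_iff)
  define s where "s t = snd (g (t, 0))" for t
  have gt: "g (t, 0) = (t, s t)" "(t, s t) \<in> S" "f (\<Phi> (t, s t)) = 0" if t: "t \<in> {-\<epsilon><..<\<epsilon>}" for t
  proof -
    obtain p where p: "p \<in> S" "G p = (t, 0)" using im[OF t] by force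
    then have "g (t, 0) = p" using gG by metis
    moreover have "p = (t, snd p)" "f (\<Phi> p) = 0" using p by (auto simp: G_def prod_eq_iff)
    ultimately show "g (t, 0) = (t, s t)" "(t, s t) \<in> S" "f (\<Phi> (t, s t)) = 0"
      using p(1) by (metis s_def)+
  qed
  define \<beta> where "\<beta> t = \<Phi> (t, s t)" for t
  \<comment> \<open>Forced by differentiating f(\<beta> t) = 0, which gives f' Y + s1 f' w =
    0.\<close>
  define s1 where "s1 t = - f' (\<beta> t) Y / f' (\<beta> t) w" for t
  have bU: "\<beta> t \<in> U" "f' (\<beta> t) w > 0" if "t \<in> {-\<epsilon><..<\<epsilon>}" for t
    using SV gt(2)[OF that] by (auto simp: \<beta>_def)
  have ds: "(s has_real_derivative s1 t) (at t)" if t: "t \<in> {-\<epsilon><..<\<epsilon>}" for t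
  proof -
    let ?p = "(t, s t)"
    have "(g has_derivative (\<lambda>h. (fst h, (snd h - fst h * f' (\<beta> t) Y) / f' (\<beta> t) w))) (at (G ?p))"
    proof (rule has_derivative_inverse_strong[OF \<open>open S\<close> gt(2)[OF t] cG gG dG[OF gt(2)[OF t]]])
      show "(\<lambda>h. (fst h, blinfun_apply (f' (\<Phi> (t, s t))) (fst h *\<^sub>R Y + snd h *\<^sub>R w))) \<circ>
        (\<lambda>h. (fst h, (snd h - fst h * f' (\<beta> t) Y) / f' (\<beta> t) w)) = id"
        using bU(2)[OF t] by (auto simp: fun_eq_iff \<beta>_def blinfun.bilinear_simps)
    qed
    moreover have "G ?p = (t, 0)" using gt(3)[OF t] by (simp add: G_def)
    ultimately have 1: "(g has_derivative (\<lambda>h. (fst h, (snd h - fst h * f' (\<beta> t) Y) / f' (\<beta> t) w))) (at (t, 0))"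
      by simp
    have 2: "((\<lambda>t. (t, 0::real)) has_derivative (\<lambda>h. (h, 0))) (at t)"
      by (auto intro!: derivative_eq_intros)
    have "((\<lambda>t. snd (g (t, 0))) has_derivative (\<lambda>h. (0 - h * f' (\<beta> t) Y) / f' (\<beta> t) w)) (at t)"
      using has_derivative_snd[OF has_derivative_compose[OF 2 1]] by simp
    then show ?thesis
      unfolding s_def[abs_def] has_field_derivative_def
      by (rule has_derivative_eq_rhs) (simp add: s1_def fun_eq_iff)
  qed
  have db: "(\<beta> has_vector_derivative Y + s1 t *\<^sub>R w) (at t)" if t: "t \<in> {-\<epsilon><..<\<epsilon>}" for t
    unfolding \<beta>_def \<Phi>_def
    using ds[OF t] by (auto intro!: derivative_eq_intros simp: has_real_derivative_iff_has_vector_derivative)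
  define s2 where "s2 t = - ((f'' (\<beta> t) (Y + s1 t *\<^sub>R w) Y * f' (\<beta> t) w -
       f' (\<beta> t) Y * f'' (\<beta> t) (Y + s1 t *\<^sub>R w) w) / (f' (\<beta> t) w * f' (\<beta> t) w))" for t
  have df: "((\<lambda>t. f' (\<beta> t) v) has_real_derivative f'' (\<beta> t) (Y + s1 t *\<^sub>R w) v) (at t)"
    if t: "t \<in> {-\<epsilon><..<\<epsilon>}" for t v
  proof -
    have "((\<lambda>t. f' (\<beta> t)) has_derivative (\<lambda>h. f'' (\<beta> t) (h *\<^sub>R (Y + s1 t *\<^sub>R w)))) (at t)"
      using has_derivative_compose[OF db[OF t, unfolded has_vector_derivative_def] C(3)[OF bU(1)[OF t]]] .
    from blinfun.FDERIV[OF this has_derivative_const[of v]]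
    show ?thesis
      unfolding has_field_derivative_def
      by (rule has_derivative_eq_rhs) (simp add: fun_eq_iff blinfun.bilinear_simps algebra_simps)
  qed
  have ds1: "(s1 has_real_derivative s2 t) (at t)" if t: "t \<in> {-\<epsilon><..<\<epsilon>}" for t
  proof -
    have "((\<lambda>t. - (f' (\<beta> t) Y / f' (\<beta> t) w)) has_real_derivative s2 t) (at t)"
      unfolding s2_def
      by (rule DERIV_minus, rule DERIV_divide[OF df[OF t] df[OF t]]) (use bU(2)[OF t] in auto)
    then show ?thesis by (simp add: s1_def[abs_def])
  qed
  have cb: "continuous_on {-\<epsilon><..<\<epsilon>} \<beta>"
    using db by (meson continuous_at_imp_continuous_on has_vector_derivative_continuous)
  have c1: "continuous_on {-\<epsilon><..<\<epsilon>} s1"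
    using ds1 by (meson continuous_at_imp_continuous_on DERIV_isCont)
  have bsub: "\<beta> ` {-\<epsilon><..<\<epsilon>} \<subseteq> U" using bU by auto
  have c2: "continuous_on {-\<epsilon><..<\<epsilon>} s2"
    unfolding s2_def
    using bU(2)
    by (intro continuous_intros blinfun.continuous_on c1 continuous_on_compose2[OF C(5) cb bsub]
       continuous_on_compose2[OF C(4) cb bsub]) (fastforce)+
  have s0: "s 0 = 0"
    using gG[OF 00] G00 by (simp add: s_def)
  have "s1 0 = 0" using s0 Y by (simp add: s1_def \<beta>_def \<Phi>_def)
  show ?thesis
  proof (rule that[OF \<epsilon>(1) s0 \<open>s1 0 = 0\<close> ds ds1 c2])
    fix t assume t: "t \<in> {-\<epsilon><..<\<epsilon>}"
    show "f (y + t *\<^sub>R Y + s t *\<^sub>R w) = 0" using gt(3)[OF t] by (simp add: \<Phi>_def)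
    fix \<sigma> assume "\<bar>\<sigma>\<bar> \<le> \<bar>s t\<bar>"
    then have "(t, \<sigma>) \<in> S" using gt(2)[OF t] by (auto simp: S_def)
    from SV[OF this] show "y + t *\<^sub>R Y + \<sigma> *\<^sub>R w \<in> U \<and> f' (y + t *\<^sub>R Y + \<sigma> *\<^sub>R w) w > 0"
      by (simp add: \<Phi>_def)
  qed
qed

text \<open>The derivative of \<phi> is asked for only from a to the right, which suits an arc
  starting at a boundary point. There \<phi>1 becomes positive and the mean value theorem
  applies.\<close>

lemma second_derivative_pos_right:
  fixes \<phi> :: "real \<Rightarrow> real"
  assumes "\<delta> > 0" and 1: "\<And>t. a \<le> t \<Longrightarrow> t < a + \<delta> \<Longrightarrow> (\<phi> has_real_derivative \<phi>1 t) (at t)"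
    and 0: "\<phi>1 a = 0" and 2: "(\<phi>1 has_real_derivative D) (at a)" "D > 0"
  obtains d where "d > 0" "\<And>t. a < t \<Longrightarrow> t < a + d \<Longrightarrow> \<phi> a < \<phi> t"
proof -
  obtain e where e: "e > 0" "\<And>h. h > 0 \<Longrightarrow> h < e \<Longrightarrow> \<phi>1 a < \<phi>1 (a + h)"
    using DERIV_pos_inc_right[OF 2] by blast
  show thesis
  proof (rule that)
    show "min e \<delta> > 0" using e assms(1) by simp
    fix t assume t: "a < t" "t < a + min e \<delta>"
    have "\<exists>z. a < z \<and> z < t \<and> \<phi> t - \<phi> a = (t - a) * \<phi>1 z"
      by (rule MVT2[OF t(1)]) (use 1 t in auto)
    then obtain z where z: "a < z" "z < t" "\<phi> t - \<phi> a = (t - a) * \<phi>1 z" by blast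
    have "\<phi>1 z > 0" using e(2)[of "z - a"] z t 0 by simp
    then have "(t - a) * \<phi>1 z > 0" using t by simp
    then show "\<phi> a < \<phi> t" using z by simp
  qed
qed

lemma second_derivative_at_max:
  fixes \<phi> :: "real \<Rightarrow> real"
  assumes "\<delta> > 0" and 1: "\<And>t. \<bar>t - a\<bar> < \<delta> \<Longrightarrow> (\<phi> has_real_derivative \<phi>1 t) (at t)"
    and max: "\<And>t. \<bar>t - a\<bar> < \<delta> \<Longrightarrow> \<phi> t \<le> \<phi> a" and 2: "(\<phi>1 has_real_derivative D) (at a)"
  shows "\<phi>1 a = 0" "D \<le> 0"
proof -
  have "(\<phi> has_real_derivative \<phi>1 a) (at a)" using 1[of a] assms(1) by simp
  then show 0: "\<phi>1 a = 0"
    by (rule DERIV_local_max[OF _ assms(1)]) (use max in \<open>auto simp: abs_minus_commute\<close>)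
  show "D \<le> 0"
  proof (rule ccontr)
    assume "\<not> D \<le> 0"
    then obtain d where d: "d > 0" "\<And>t. a < t \<Longrightarrow> t < a + d \<Longrightarrow> \<phi> a < \<phi> t"
      using second_derivative_pos_right[of \<delta> a \<phi> \<phi>1 D] assms(1) 1 0 2 by auto
    have "\<phi> a < \<phi> (a + min d \<delta> / 2)" using d(1) assms(1) by (intro d(2)) auto
    moreover have "\<phi> (a + min d \<delta> / 2) \<le> \<phi> a" using d(1) assms(1) by (intro max) auto
    ultimately show False by simp
  qed
qed

text \<open>The derivative 2 g(x, .) depends linearly on x, so the second derivative is
  constant.\<close>

lemma C2_on_quadratic_form:
  fixes g :: "'e::real_normed_vector \<Rightarrow> 'e \<Rightarrow> real"
  assumes "bounded_bilinear g" and sym: "\<And>x y. g x y = g y x"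
  shows "C2_on S (\<lambda>z. g z z)"
proof -
  interpret g: bounded_bilinear g by fact
  have bl: "bounded_linear (g v)" for v by (rule g.bounded_linear_right)
  define L where "L v = Blinfun (g v)" for v
  have La: "blinfun_apply (L v) = g v" for v by (simp add: L_def bounded_linear_Blinfun_apply bl)
  obtain K where K: "\<And>a b. norm (g a b) \<le> norm a * norm b * K" "K \<ge> 0" using g.nonneg_bounded by blast
  have "bounded_linear L"
  proof (rule bounded_linear_intro)
    show "L (x + y) = L x + L y" "L (r *\<^sub>R x) = r *\<^sub>R L x" for x y r
      by (auto intro!: blinfun_eqI simp: La g.add_left g.scaleR_left blinfun.bilinear_simps)
    show "norm (L x) \<le> norm x * K" for x
    proof (rule norm_blinfun_bound)
      show "0 \<le> norm x * K" using K(2) by simp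
      show "norm (L x y) \<le> norm x * K * norm y" for y
        using K(1)[of x y] by (simp add: La mult_ac)
    qed
  qed
  then have bl2: "bounded_linear (\<lambda>v. 2 *\<^sub>R L v)" by (rule bounded_linear_const_scaleR)
  show ?thesis
    unfolding C2_on_def
  proof (intro exI conjI ballI)
    show "((\<lambda>z. g z z) has_derivative blinfun_apply (2 *\<^sub>R L x)) (at x)" for x
      using g.FDERIV[OF has_derivative_ident has_derivative_ident, of x UNIV]
      by (rule has_derivative_eq_rhs) (auto simp: blinfun.bilinear_simps La fun_eq_iff sym)
    show "((\<lambda>v. 2 *\<^sub>R L v) has_derivative blinfun_apply (Blinfun (\<lambda>v. 2 *\<^sub>R L v))) (at x)" for x
      using bl2 by (simp add: bounded_linear_Blinfun_apply bounded_linear_imp_has_derivative)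
    show "continuous_on S (\<lambda>x. Blinfun (\<lambda>v. 2 *\<^sub>R L v))" by simp
  qed
qed

lemma C2_on_scaleR_ident:
  fixes h :: "'e::euclidean_space \<Rightarrow> real"
  assumes "C2_on S h"
  shows "C2_on S (\<lambda>z. h z *\<^sub>R z)"
proof -
  obtain h' h'' where h: "\<And>x. x \<in> S \<Longrightarrow> (h has_derivative blinfun_apply (h' x)) (at x)"
    "\<And>x. x \<in> S \<Longrightarrow> (h' has_derivative blinfun_apply (h'' x)) (at x)" "continuous_on S h''"
    using assms unfolding C2_on_def by blast
  define D where "D z = h z *\<^sub>R id_blinfun + (blinfun_scaleR_left z o\<^sub>L h' z)" for z
  define E where "E z = (\<lambda>v. h' z v *\<^sub>R id_blinfun +
     ((blinfun_scaleR_left z o\<^sub>L h'' z v) + (blinfun_scaleR_left v o\<^sub>L h' z)))" for z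
  have 1: "((\<lambda>z. h z *\<^sub>R z) has_derivative blinfun_apply (D z)) (at z)" if "z \<in> S" for z
    using has_derivative_scaleR[OF h(1)[OF that] has_derivative_ident]
    by (rule has_derivative_eq_rhs) (simp add: D_def fun_eq_iff blinfun.bilinear_simps)
  have 2: "(D has_derivative E z) (at z)" if "z \<in> S" for z
  proof -
    have "((\<lambda>z. blinfun_scaleR_left z o\<^sub>L h' z) has_derivative
       (\<lambda>v. (blinfun_scaleR_left z o\<^sub>L h'' z v) + (blinfun_scaleR_left v o\<^sub>L h' z))) (at z)"
      by (rule bounded_bilinear.FDERIV[OF bounded_bilinear_blinfun_compose _ h(2)[OF that]])
        (rule bounded_linear_imp_has_derivative[OF bounded_linear_blinfun_scaleR_left])
    moreover have "((\<lambda>z. h z *\<^sub>R id_blinfun) has_derivative (\<lambda>v. h' z v *\<^sub>R (id_blinfun :: 'e \<Rightarrow>\<^sub>L 'e))) (at z)"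
      using has_derivative_scaleR_left[OF h(1)[OF that]] .
    ultimately show ?thesis
      unfolding D_def[abs_def] E_def by (intro has_derivative_add)
  qed
  have bl: "bounded_linear (E x)" if "x \<in> S" for x
    using 2[OF that] by (rule has_derivative_bounded_linear)
  have c: "continuous_on S h'"
    using h(2) by (meson continuous_at_imp_continuous_on has_derivative_continuous)
  have "continuous_on S (\<lambda>x. Blinfun (E x))"
  proof (rule continuous_on_blinfun_componentwise)
    fix i :: 'e
    have "continuous_on S (\<lambda>x. E x i)"
      unfolding E_def
      by (intro continuous_on_add bounded_bilinear.continuous_on[OF bounded_bilinear_blinfun_compose]
          c h(3) blinfun.continuous_on continuous_intros
          bounded_linear.continuous_on[OF bounded_linear_blinfun_scaleR_left])
    then show "continuous_on S (\<lambda>x. Blinfun (E x) i)"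
      by (rule continuous_on_eq) (simp add: bounded_linear_Blinfun_apply bl)
  qed
  with 1 2 bl show ?thesis
    unfolding C2_on_def
    by (intro exI[of _ D] exI[of _ "\<lambda>x. Blinfun (E x)"]) (auto simp: bounded_linear_Blinfun_apply)
qed

lemma C2_on_ident: "C2_on S (\<lambda>x. x)"
  unfolding C2_on_def
  by (rule exI[of _ "\<lambda>_. id_blinfun"], rule exI[of _ "\<lambda>_. 0"]) (auto simp: zero_blinfun.rep_eq)

lemma C2_derivs_minus:
  assumes "C2_derivs U f f' f''"
  shows "C2_derivs U (\<lambda>x. - f x) (\<lambda>x. - f' x) (\<lambda>x. - f'' x)"
proof -
  have *: "((\<lambda>x. - F x) has_derivative blinfun_apply (- F' x)) (at x)"
    if "(F has_derivative blinfun_apply (F' x)) (at x)"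
    for F :: "'a \<Rightarrow> 'c::real_normed_vector" and F' :: "'a \<Rightarrow> 'a \<Rightarrow>\<^sub>L 'c" and x
    using has_derivative_minus[OF that]
    by (rule has_derivative_eq_rhs) (simp add: fun_eq_iff blinfun.bilinear_simps)
  show ?thesis
    using assms *[of f f'] *[of f' f''] unfolding C2_derivs_def
    by (auto intro!: continuous_on_minus)
qed

text \<open>All points of {f < 0} near P can be pushed along - w into one small ball on the negative
  side while f only decreases. This later decides which side of the boundary belongs to the
  domain.\<close>

lemma negative_side_connected:
  fixes f :: "'e::real_normed_vector \<Rightarrow> real"
  assumes C2: "C2_derivs U f f' f''" and P: "P \<in> U" "f P = 0" and w: "f' P w > 0"
  obtains r K where "r > 0" "ball P r \<subseteq> U" "\<And>z. z \<in> ball P r \<Longrightarrow> f' z w > 0"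
    "connected K" "K \<subseteq> {z\<in>U. f z < 0}" "ball P r \<inter> {z. f z < 0} \<subseteq> K"
proof -
  note C = C2_derivsD[OF C2]
  have "open {z \<in> U. f' z w > 0}"
  proof -
    have "continuous_on U (\<lambda>z. f' z w)" by (intro blinfun.continuous_on C(5) continuous_intros)
    then have "open (U \<inter> (\<lambda>z. f' z w) -` {0<..})"
      using C(1) by (intro continuous_open_preimage) auto
    then show ?thesis by (auto simp: vimage_def Int_def)
  qed
  then obtain \<rho> where \<rho>: "\<rho> > 0" "ball P \<rho> \<subseteq> {z \<in> U. f' z w > 0}"
    using P w open_contains_ball_eq by blast
  have dec: "f (z - b *\<^sub>R w) < f (z - a *\<^sub>R w)"
    if "a < b" and sub: "\<And>u. a \<le> u \<Longrightarrow> u \<le> b \<Longrightarrow> z - u *\<^sub>R w \<in> ball P \<rho>" for z a b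
  proof (rule DERIV_neg_imp_decreasing[OF that(1)])
    fix u assume "a \<le> u" "u \<le> b"
    then have "z - u *\<^sub>R w \<in> ball P \<rho>" by (rule sub)
    then have u: "z - u *\<^sub>R w \<in> U" "f' (z - u *\<^sub>R w) w > 0" using \<rho>(2) by blast+
    have "((\<lambda>u. z - u *\<^sub>R w) has_vector_derivative - w) (at u)"
      by (auto intro!: derivative_eq_intros)
    from C2_derivs_along(1)[OF C2 u(1) this] u(2)
    show "\<exists>y. ((\<lambda>u. f (z - u *\<^sub>R w)) has_real_derivative y) (at u) \<and> y < 0"
      by (intro exI conjI) (auto simp: blinfun.bilinear_simps)
  qed
  have "w \<noteq> 0" using w by (auto simp: blinfun.bilinear_simps)
  \<comment> \<open>A shift by at most s w has length at most \<rho> / 2, so it keeps the ball of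
    radius \<rho> / 2 inside the ball of radius \<rho>, where f grows along w.\<close>
  define s where "s = \<rho> / (2 * norm w)"
  have s: "s > 0" "norm (s *\<^sub>R w) = \<rho> / 2" using \<rho> \<open>w \<noteq> 0\<close> by (auto simp: s_def)
  have inb: "z - u *\<^sub>R w \<in> ball P \<rho>" if "z \<in> ball P (\<rho>/2)" "0 \<le> u" "u \<le> s" for z u
  proof -
    have "norm (u *\<^sub>R w) \<le> \<rho> / 2"
      using that(2,3) s by (metis abs_of_nonneg mult_right_mono norm_ge_zero norm_scaleR order_trans)
    moreover have "norm (P - z) < \<rho> / 2" using that(1) by (simp add: dist_norm)
    moreover have "norm (P - (z - u *\<^sub>R w)) \<le> norm (P - z) + norm (u *\<^sub>R w)"
      using norm_triangle_ineq[of "P - z" "u *\<^sub>R w"] by (simp add: algebra_simps)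
    ultimately have "norm (P - (z - u *\<^sub>R w)) < \<rho>" by linarith
    then show ?thesis by (simp add: dist_norm)
  qed
  have neg: "f (P - s *\<^sub>R w) < 0" using dec[of 0 s P] inb[of P] s \<rho> P by simp
  have "P - s *\<^sub>R w \<in> ball P \<rho>" by (rule inb) (use \<rho>(1) s(1) in auto)
  then have "P - s *\<^sub>R w \<in> U" using \<rho>(2) by blast
  have "open {z \<in> U. f z < 0}"
  proof -
    have "open (U \<inter> f -` {..<0})" using C by (intro continuous_open_preimage) auto
    then show ?thesis by (auto simp: vimage_def Int_def)
  qed
  then obtain r0 where r0: "r0 > 0" "ball (P - s *\<^sub>R w) r0 \<subseteq> {z \<in> U. f z < 0}"
    using neg \<open>P - s *\<^sub>R w \<in> U\<close> open_contains_ball_eq by blast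
  define r where "r = min r0 (\<rho>/2)"
  define N where "N = ball P r \<inter> {z. f z < 0}"
  \<comment> \<open>Every member of the family contains the ball around P - s w, which makes the
    union connected.\<close>
  define K where "K = \<Union> (insert (ball (P - s *\<^sub>R w) r)
     ((\<lambda>z. ball (P - s *\<^sub>R w) r \<union> closed_segment z (z - s *\<^sub>R w)) ` N))"
  have r: "r > 0" using r0 \<rho> by (simp add: r_def)
  have seg: "f z' < 0 \<and> z' \<in> U" if z: "z \<in> N" and z': "z' \<in> closed_segment z (z - s *\<^sub>R w)" for z z'
  proof -
    obtain u where u: "0 \<le> u" "u \<le> 1" "z' = (1 - u) *\<^sub>R z + u *\<^sub>R (z - s *\<^sub>R w)"
      using z' by (auto simp: closed_segment_def)
    then have z'_eq: "z' = z - (u * s) *\<^sub>R w" by (simp add: algebra_simps)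
    have zb: "z \<in> ball P (\<rho>/2)" using z by (auto simp: N_def r_def)
    have us: "0 \<le> u * s" "u * s \<le> s" using u s by (auto simp: mult_left_le_one_le)
    have "z' \<in> ball P \<rho>" using inb[OF zb us] z'_eq by simp
    moreover have "f z' < 0"
    proof (cases "u * s = 0")
      case False
      then have "0 < u * s" using us(1) by linarith
      then have "f (z - (u * s) *\<^sub>R w) < f (z - 0 *\<^sub>R w)"
        using us(2) by (intro dec inb[OF zb]) auto
      then show ?thesis using z z'_eq by (auto simp: N_def)
    qed (use z z'_eq in \<open>auto simp: N_def\<close>)
    ultimately show ?thesis using \<rho>(2) by blast
  qed
  show thesis
  proof (rule that)
    show "r > 0" by fact
    show "ball P r \<subseteq> U" "\<And>z. z \<in> ball P r \<Longrightarrow> f' z w > 0"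
      using \<rho> by (auto simp: r_def subset_iff)
    have cen: "P - s *\<^sub>R w \<in> ball (P - s *\<^sub>R w) r" using r by simp
    show "connected K"
      unfolding K_def
    proof (rule connected_Union)
      show "connected S" if "S \<in> insert (ball (P - s *\<^sub>R w) r)
         ((\<lambda>z. ball (P - s *\<^sub>R w) r \<union> closed_segment z (z - s *\<^sub>R w)) ` N)" for S
      proof -
        have "connected (ball (P - s *\<^sub>R w) r \<union> closed_segment z (z - s *\<^sub>R w))" if "z \<in> N" for z
        proof (rule connected_Un)
          have "z - s *\<^sub>R w \<in> ball (P - s *\<^sub>R w) r" using that by (simp add: N_def dist_norm)
          then show "ball (P - s *\<^sub>R w) r \<inter> closed_segment z (z - s *\<^sub>R w) \<noteq> {}" by auto
        qed auto
        then show ?thesis using that by auto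
      qed
      show "\<Inter> (insert (ball (P - s *\<^sub>R w) r)
         ((\<lambda>z. ball (P - s *\<^sub>R w) r \<union> closed_segment z (z - s *\<^sub>R w)) ` N)) \<noteq> {}"
        using cen by blast
    qed
    have "ball (P - s *\<^sub>R w) r \<subseteq> ball (P - s *\<^sub>R w) r0" by (simp add: r_def subset_ball)
    then have "ball (P - s *\<^sub>R w) r \<subseteq> {z \<in> U. f z < 0}" using r0 by blast
    then show "K \<subseteq> {z \<in> U. f z < 0}" using seg unfolding K_def by blast
    show "ball P r \<inter> {z. f z < 0} \<subseteq> K" unfolding K_def N_def by auto
  qed
qed

section \<open>Space forms as quadrics\<close>

text \<open>For \<open>c = 0\<close> the manifold \<open>M\<close> below is the whole space; otherwise it is the part of the
  quadric \<open>c g(z, z) = 1\<close> in the cone \<open>W\<close>. The factor \<open>c\<close> in the tangency condition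
  \<open>c g(x, v) = 0\<close> makes it vacuous in the flat case.\<close>

locale space_form = g: bounded_bilinear g
  for g :: "'e::euclidean_space \<Rightarrow> 'e \<Rightarrow> real" +
  fixes c :: real and W :: "'e set"
  assumes sym: "g x y = g y x"
    and riesz: "bounded_linear \<phi> \<Longrightarrow> \<exists>n. \<forall>w. \<phi> w = g n w"
    and open_W: "open W"
    and scale_W: "z \<in> W \<Longrightarrow> r > 0 \<Longrightarrow> c \<noteq> 0 \<Longrightarrow> r *\<^sub>R z \<in> W"
    and flat_W: "c = 0 \<Longrightarrow> W = UNIV"
    and norm_pos: "z \<in> W \<Longrightarrow> c \<noteq> 0 \<Longrightarrow> c * g z z > 0"
    and pos_def: "z \<in> W \<Longrightarrow> c * g z v = 0 \<Longrightarrow> v \<noteq> 0 \<Longrightarrow> g v v > 0"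
    and sheet: "x \<in> W \<Longrightarrow> c \<noteq> 0 \<Longrightarrow> c * g z z > 0 \<Longrightarrow> c * g z x > 0 \<Longrightarrow> z \<in> W"
    and segments_W: "convex W \<and> c \<le> 0 \<or> c > 0 \<and> W = - {0}"
    and dim: "DIM('e) \<ge> (if c = 0 then 2 else 3)"
begin

definition M :: "'e set" where
  "M = {z \<in> W. c \<noteq> 0 \<longrightarrow> c * g z z = 1}"

definition prj :: "'e \<Rightarrow> 'e" where
  "prj z = (if c = 0 then z else inverse (sqrt (c * g z z)) *\<^sub>R z)"

definition cone :: "'e set \<Rightarrow> 'e set" where
  "cone A = {z \<in> W. prj z \<in> A}"

lemmas g_simps = g.add_left g.add_right g.diff_left g.diff_right g.minus_left g.minus_right
  g.scaleR_left g.scaleR_right g.zero_left g.zero_right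

lemma M_subset_W: "M \<subseteq> W"
  by (auto simp: M_def)

lemma M_flat: "c = 0 \<Longrightarrow> M = UNIV"
  by (unfold M_def) (simp add: flat_W)

text \<open>Multiplied by c once more, the equation of the quadric also holds for c = 0, where g(x,
  x) is arbitrary. Computations can then treat all curvatures at once.\<close>

lemma M_norm: "x \<in> M \<Longrightarrow> c * (c * g x x) = c"
  by (auto simp: M_def)

lemma M_norm': "x \<in> M \<Longrightarrow> c \<noteq> 0 \<Longrightarrow> g x x = 1 / c"
  by (simp add: M_def nonzero_eq_divide_eq mult.commute)

lemma prj_M: "x \<in> M \<Longrightarrow> prj x = x"
  by (auto simp: M_def prj_def)

lemma prj_in_M: "z \<in> W \<Longrightarrow> prj z \<in> M"
proof (cases "c = 0")
  case False
  assume z: "z \<in> W"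
  define q where "q = c * g z z"
  have q: "q > 0" "g z z = q / c" using norm_pos[OF z False] False by (auto simp: q_def)
  have "c * g (prj z) (prj z) = 1"
    using False q(1) by (simp add: prj_def g_simps q(2) divide_simps)
  moreover have "prj z \<in> W"
    using norm_pos[OF z False] scale_W[OF z _ False] by (simp add: prj_def False)
  ultimately show ?thesis by (simp add: M_def)
next
  case True
  then have "M = UNIV" by (rule M_flat)
  then show ?thesis by blast
qed

lemma prj_flat: "c = 0 \<Longrightarrow> prj = (\<lambda>z. z)"
  by (rule ext, unfold prj_def) simp

lemma prj_scaleR:
  assumes "r > 0" "c \<noteq> 0"
  shows "prj (r *\<^sub>R z) = prj z"
proof -
  have "c * g (r *\<^sub>R z) (r *\<^sub>R z) = r\<^sup>2 * (c * g z z)"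
    by (simp add: g_simps power2_eq_square)
  then have "sqrt (c * g (r *\<^sub>R z) (r *\<^sub>R z)) = r * sqrt (c * g z z)"
    using assms by (simp add: real_sqrt_mult)
  then show ?thesis using assms by (simp add: prj_def)
qed

lemma prj_cases:
  assumes "z \<in> W"
  obtains r where "r > 0" "z = r *\<^sub>R prj z" "c = 0 \<Longrightarrow> r = 1"
proof (cases "c = 0")
  case True
  then show ?thesis using that[of 1] prj_flat[OF True] by simp
next
  case False
  define q where "q = sqrt (c * g z z)"
  have q: "q > 0" unfolding q_def using norm_pos[OF assms False] by (simp only: real_sqrt_gt_zero)
  then have "z = q *\<^sub>R prj z" using False by (simp add: prj_def flip: q_def)
  with q show ?thesis using that False by blast
qed

lemma C2_prj: "C2_on W prj"
proof (cases "c = 0")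
  case True
  then show ?thesis using C2_on_ident prj_flat[OF True] by simp
next
  case False
  have "C2_on {0<..} (\<lambda>s::real. inverse (sqrt s))"
  proof (rule C2_on_curveI)
    fix t :: real assume "t \<in> {0<..}"
    then have t: "t > 0" by simp
    have ps: "s powr a = s powr a" for s a :: real ..
    have 1: "((\<lambda>s. s powr (-1/2)) has_real_derivative (-1/2) * s powr (-3/2)) (at s)" if "s > 0" for s :: real
      using that by (auto intro!: derivative_eq_intros)
    have 2: "((\<lambda>s. (-1/2) * s powr (-3/2)) has_real_derivative (3/4) * s powr (-5/2)) (at s)" if "s > 0" for s :: real
      using that by (auto intro!: derivative_eq_intros)
    have eq: "inverse (sqrt s) = s powr (-1/2)" if "s > 0" for s :: real
      using that by (simp add: powr_minus powr_half_sqrt[symmetric])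
    have "((\<lambda>s. inverse (sqrt s)) has_vector_derivative (-1/2) * t powr (-3/2)) (at t)"
      using 1[OF t] unfolding has_real_derivative_iff_has_vector_derivative
      by (rule has_vector_derivative_transform_within_open[of _ _ _ "{0<..}"]) (use t eq in auto)
    then show "((\<lambda>s. inverse (sqrt s)) has_vector_derivative (-1/2) * t powr (-3/2)) (at t)" .
    show "((\<lambda>t. (-1/2) * t powr (-3/2)) has_vector_derivative (3/4) * t powr (-5/2)) (at t)"
      using 2[OF t] unfolding has_real_derivative_iff_has_vector_derivative .
  next
    show "continuous_on {0<..} (\<lambda>t::real. (3/4) * t powr (-5/2))"
      by (intro continuous_intros) auto
  qed
  moreover have "C2_on W (\<lambda>z. c * g z z)"
    using C2_on_quadratic_form[of "\<lambda>x. g (c *\<^sub>R x)" W]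
      g.comp1[OF bounded_linear_scaleR_right[of c]] by (simp add: g_simps sym)
  ultimately have "C2_on W (\<lambda>z. inverse (sqrt (c * g z z)))"
    by (rule C2_on_compose) (use norm_pos False in auto)
  then show ?thesis
    using C2_on_scaleR_ident False by (simp add: prj_def[abs_def])
qed

lemma continuous_on_prj: "continuous_on W prj"
proof -
  obtain f' f'' where "C2_derivs W prj f' f''" using C2_on_imp_derivs[OF C2_prj open_W] .
  then show ?thesis by (rule C2_derivsD(6))
qed

text \<open>The normalising factor has derivative 0 in directions tangent to M. Hence curves may be
  built in the ambient space and pushed back to M without changing their velocity.\<close>

lemma prj_curve:
  assumes x: "x \<in> M" "c * g x v = 0" and \<beta>: "(\<beta> has_vector_derivative v) (at t)" "\<beta> t = x"
  shows "((\<lambda>t. prj (\<beta> t)) has_vector_derivative v) (at t)"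
proof (cases "c = 0")
  case True
  then show ?thesis using \<beta> prj_flat[OF True] by simp
next
  case False
  have one: "c * g x x = 1" using x False by (simp add: M_def)
  have "((\<lambda>t. g (\<beta> t) (\<beta> t)) has_vector_derivative g (\<beta> t) v + g v (\<beta> t)) (at t)"
    using g.has_vector_derivative[OF \<beta>(1) \<beta>(1)] .
  then have "((\<lambda>t. g (\<beta> t) (\<beta> t)) has_real_derivative 0) (at t)"
    using x(2) False \<beta>(2) by (simp add: has_real_derivative_iff_has_vector_derivative sym)
  from DERIV_cmult[OF this, of c]
  have N: "((\<lambda>t. c * g (\<beta> t) (\<beta> t)) has_real_derivative 0) (at t)" by simp
  have "((\<lambda>s. inverse (sqrt s)) has_real_derivative - (1/2)) (at 1)"
    by (auto intro!: derivative_eq_intros)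
  then have "((\<lambda>s. inverse (sqrt s)) has_real_derivative - (1/2)) (at (c * g (\<beta> t) (\<beta> t)))"
    using one \<beta>(2) by simp
  from DERIV_chain2[OF this N]
  have "((\<lambda>t. inverse (sqrt (c * g (\<beta> t) (\<beta> t)))) has_real_derivative 0) (at t)" by simp
  from has_vector_derivative_scaleR[OF this \<beta>(1)]
  show ?thesis using False one \<beta>(2) by (simp add: prj_def)
qed

lemma tangent_space_M:
  assumes x: "x \<in> M"
  shows "tangent_space M x = {v. c * g x v = 0}"
proof (intro equalityI subsetI CollectI)
  fix v assume "v \<in> tangent_space M x"
  then obtain \<gamma> where \<gamma>: "\<gamma> 0 = x" "\<forall>\<^sub>F t in nhds (0::real). \<gamma> t \<in> M"
    "(\<gamma> has_vector_derivative v) (at 0)" by (auto simp: tangent_space_def)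
  show "c * g x v = 0"
  proof (cases "c = 0")
    case False
    have "((\<lambda>t. g (\<gamma> t) (\<gamma> t)) has_vector_derivative g (\<gamma> 0) v + g v (\<gamma> 0)) (at 0)"
      using g.has_vector_derivative[OF \<gamma>(3) \<gamma>(3)] .
    then have 1: "((\<lambda>t. g (\<gamma> t) (\<gamma> t)) has_real_derivative 2 * g x v) (at 0)"
      using \<gamma>(1) by (simp add: has_real_derivative_iff_has_vector_derivative sym)
    have "\<forall>\<^sub>F t in nhds (0::real). g (\<gamma> t) (\<gamma> t) = 1 / c"
      using \<gamma>(2) by eventually_elim (use False in \<open>simp add: M_norm'\<close>)
    then have "((\<lambda>t. g (\<gamma> t) (\<gamma> t)) has_real_derivative 2 * g x v) (at 0) \<longleftrightarrow>
       ((\<lambda>t. 1 / c) has_real_derivative 2 * g x v) (at (0::real))"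
      by (intro DERIV_cong_ev) auto
    with 1 have "((\<lambda>t. 1 / c) has_real_derivative 2 * g x v) (at (0::real))" by simp
    from DERIV_unique[OF this DERIV_const] show ?thesis by simp
  qed simp
next
  fix v assume "v \<in> {v. c * g x v = 0}"
  then have v: "c * g x v = 0" by simp
  have d: "((\<lambda>t. x + t *\<^sub>R v) has_vector_derivative v) (at 0)"
    by (auto intro!: derivative_eq_intros)
  have "((\<lambda>t. x + t *\<^sub>R v) \<longlongrightarrow> x) (nhds 0)"
    by (auto intro!: tendsto_eq_intros filterlim_ident)
  then have "\<forall>\<^sub>F t in nhds 0. x + t *\<^sub>R v \<in> W"
    by (rule topological_tendstoD) (use x M_subset_W open_W in auto)
  then have "\<forall>\<^sub>F t in nhds 0. prj (x + t *\<^sub>R v) \<in> M"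
    by eventually_elim (rule prj_in_M)
  then show "v \<in> tangent_space M x"
    using prj_curve[OF x v d] prj_M[OF x] unfolding tangent_space_def
    by (intro CollectI exI[of _ "\<lambda>t. prj (x + t *\<^sub>R v)"]) auto
qed

lemma open_cone:
  assumes "openin (top_of_set M) A"
  shows "open (cone A)"
proof -
  obtain T where T: "open T" "A = M \<inter> T" using assms by (auto simp: openin_open)
  have "cone A = W \<inter> prj -` T" using prj_in_M T by (auto simp: cone_def)
  then show ?thesis using continuous_open_preimage[OF continuous_on_prj open_W T(1)] by simp
qed

lemma cone_scale: "c \<noteq> 0 \<Longrightarrow> r > 0 \<Longrightarrow> z \<in> cone A \<Longrightarrow> r *\<^sub>R z \<in> cone A"
  by (auto simp: cone_def prj_scaleR scale_W)

lemma cone_M_iff: "x \<in> M \<Longrightarrow> x \<in> cone A \<longleftrightarrow> x \<in> A"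
  using M_subset_W by (auto simp: cone_def prj_M)

lemma cone_subset_W: "cone A \<subseteq> W"
  by (auto simp: cone_def)

lemma connected_cone:
  assumes "connected A" "A \<subseteq> M"
  shows "connected (cone A)"
proof (cases "c = 0")
  case True
  have "cone A = A" unfolding cone_def using prj_flat[OF True] flat_W[OF True] by simp
  then show ?thesis using assms by simp
next
  case False
  have "cone A = (\<lambda>p. fst p *\<^sub>R snd p) ` ({0::real<..} \<times> A)"
  proof (intro equalityI subsetI)
    fix z assume z: "z \<in> cone A"
    then obtain r where "r > 0" "z = r *\<^sub>R prj z" using prj_cases cone_subset_W by blast
    then show "z \<in> (\<lambda>p. fst p *\<^sub>R snd p) ` ({0::real<..} \<times> A)"
      using z by (auto simp: cone_def intro!: image_eqI[of _ _ "(r, prj z)"])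
  next
    fix z assume "z \<in> (\<lambda>p. fst p *\<^sub>R snd p) ` ({0::real<..} \<times> A)"
    then show "z \<in> cone A"
      using assms(2) cone_scale[OF False] by (auto simp: cone_M_iff subset_iff)
  qed
  moreover have "connected ({0::real<..} \<times> A)" using assms(1) by (intro connected_Times) auto
  ultimately show ?thesis
    by (auto intro!: connected_continuous_image continuous_intros)
qed

text \<open>\<open>g\<close> may be indefinite, but c \<phi>(x) = 0 makes the representing vector
  tangent to M at x, where \<open>g\<close> is positive definite; so it can be normalised.\<close>

lemma gradient:
  assumes "x \<in> M" and lin: "bounded_linear \<phi>" and "c * \<phi> x = 0" and "\<phi> w \<noteq> 0"
  obtains \<nu> l where "l > 0" "c * g x \<nu> = 0" "g \<nu> \<nu> = 1" "\<And>w. \<phi> w = l * g \<nu> w"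
proof -
  obtain n where n: "\<And>w. \<phi> w = g n w" using riesz[OF lin] by blast
  have xn: "c * g x n = 0" using assms(3) n by (simp add: sym)
  have "n \<noteq> 0" using n assms(4) by (auto simp: g_simps)
  then have pos: "g n n > 0" using pos_def xn assms(1) M_subset_W by blast
  define l where "l = sqrt (g n n)"
  have l: "l > 0" "l * l = g n n" using pos by (auto simp: l_def)
  show thesis
  proof (rule that[of l "inverse l *\<^sub>R n"])
    show "l > 0" by fact
    show "c * g x (inverse l *\<^sub>R n) = 0" using xn by (auto simp: g_simps)
    show "g (inverse l *\<^sub>R n) (inverse l *\<^sub>R n) = 1"
      using l by (simp add: g_simps field_simps flip: l(2))
    show "\<phi> w = l * g (inverse l *\<^sub>R n) w" for w
      using l by (simp add: n g_simps)
  qed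
qed

end

section \<open>The domain, its interior and boundary, and the cones over them\<close>

locale domain_in_space_form = space_form +
  fixes \<Omega> :: "'a set"
  assumes closed_domain: "closed_domain M \<Omega>"
    and hypersurface: "C2_hypersurface M (boundary_in M \<Omega>)"
begin

abbreviation "bd \<equiv> boundary_in M \<Omega>"
abbreviation "inn \<equiv> top_of_set M interior_of \<Omega>"

text \<open>\<open>Omega_closure\<close> comes from \<Omega> being the closure of an open set; it
  excludes boundary pieces with no interior points nearby.\<close>

lemma
  shows Omega_M: "\<Omega> \<subseteq> M" and closedin_Omega: "closedin (top_of_set M) \<Omega>"
    and openin_inn: "openin (top_of_set M) inn" and inn_sub: "inn \<subseteq> \<Omega>"
    and bd_eq: "bd = \<Omega> - inn" and Omega_closure: "\<Omega> \<subseteq> closure inn"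
    and connected_inn: "connected inn"
proof -
  obtain D where D: "openin (top_of_set M) D" "connected D" "D \<noteq> {}" "\<Omega> = top_of_set M closure_of D"
    using closed_domain by (auto simp: closed_domain_def)
  show cl: "closedin (top_of_set M) \<Omega>" using D by simp
  then show "\<Omega> \<subseteq> M" using closedin_subset by fastforce
  show op: "openin (top_of_set M) inn" by simp
  show inn_sub: "inn \<subseteq> \<Omega>" by (rule interior_of_subset)
  show "bd = \<Omega> - inn" using cl by (simp add: frontier_of_def closure_of_closedin)
  have DM: "D \<subseteq> M" using D(1) openin_subset by fastforce
  have Dsub: "D \<subseteq> inn"
    using D(1,4) DM closure_of_subset[of D "top_of_set M"] by (intro interior_of_maximal) auto
  have Oc: "\<Omega> \<subseteq> closure D" using D(4) DM by (auto simp: closure_of_subtopology Int_absorb1)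
  then show "\<Omega> \<subseteq> closure inn" using Dsub closure_mono by blast
  show "connected inn"
    using connected_intermediate_closure[OF D(2) Dsub] Oc inn_sub by blast
qed

lemma bd_M: "bd \<subseteq> M" and inn_M: "inn \<subseteq> M" and bd_inn: "bd \<inter> inn = {}"
  using Omega_M inn_sub bd_eq by auto

lemma open_cone_inn: "open (cone inn)"
  by (rule open_cone[OF openin_inn])

lemma open_cone_compl: "open (W - cone \<Omega>)"
proof -
  have "W - cone \<Omega> = cone (M - \<Omega>)" using prj_in_M by (auto simp: cone_def)
  moreover have "openin (top_of_set M) (M - \<Omega>)" using closedin_Omega by (auto simp: closedin_def)
  ultimately show ?thesis using open_cone by simp
qed

lemma cone_Omega: "cone \<Omega> = cone inn \<union> cone bd" "cone inn \<inter> cone bd = {}"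
  using bd_eq inn_sub by (auto simp: cone_def)

lemma closure_inn: "z \<in> W \<Longrightarrow> z \<in> closure (cone inn) \<Longrightarrow> z \<in> cone \<Omega>"
proof (rule ccontr)
  assume z: "z \<in> W" "z \<in> closure (cone inn)" "z \<notin> cone \<Omega>"
  then have "(W - cone \<Omega>) \<inter> closure (cone inn) \<noteq> {}" by blast
  then have "(W - cone \<Omega>) \<inter> cone inn \<noteq> {}"
    by (simp add: open_Int_closure_eq_empty[OF open_cone_compl])
  then show False using cone_Omega(1) by blast
qed

lemma connected_cone_inn: "connected (cone inn)"
  using connected_cone[OF connected_inn inn_M] .

text \<open>Off the cone over the boundary, W is the disjoint union of the open sets
  \<open>cone inn\<close> and \<open>W - cone \<Omega>\<close>.\<close>

lemma connected_off_bd: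
  assumes "connected K" "K \<subseteq> W" "K \<inter> cone bd = {}" "K \<inter> cone \<Omega> \<noteq> {}"
  shows "K \<subseteq> cone inn"
proof -
  have "cone inn \<inter> K = {} \<or> (W - cone \<Omega>) \<inter> K = {}"
    by (rule connectedD[OF assms(1) open_cone_inn open_cone_compl])
      (use assms(2,3) cone_Omega in auto)
  then show ?thesis using assms(2-4) cone_Omega(1) by blast
qed

end

text \<open>The first derivatives agree on a neighbourhood of 0, so their derivatives at 0 agree.
  This compares two parametrisations, or exploits an identity f(\<alpha> t) = 0, to second
  order.\<close>

lemma second_derivative_unique:
  fixes \<phi> \<psi> :: "real \<Rightarrow> real"
  assumes "\<delta> > 0" and eq: "\<And>t. \<bar>t\<bar> < \<delta> \<Longrightarrow> \<phi> t = \<psi> t"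
    and 1: "\<And>t. \<bar>t\<bar> < \<delta> \<Longrightarrow> (\<phi> has_real_derivative \<phi>1 t) (at t)"
      "\<And>t. \<bar>t\<bar> < \<delta> \<Longrightarrow> (\<psi> has_real_derivative \<psi>1 t) (at t)"
    and 2: "(\<phi>1 has_real_derivative D) (at 0)" "(\<psi>1 has_real_derivative E) (at 0)"
  shows "\<phi>1 0 = \<psi>1 0" "D = E"
proof -
  have eq1: "\<phi>1 t = \<psi>1 t" if t: "t \<in> {-\<delta><..<\<delta>}" for t
  proof -
    have "(\<phi> has_real_derivative \<psi>1 t) (at t)"
      by (rule has_field_derivative_transform_within_open[OF 1(2)[of t] open_greaterThanLessThan t])
        (use t eq in auto)
    then show ?thesis using DERIV_unique[OF 1(1)[of t]] t by auto
  qed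
  then show "\<phi>1 0 = \<psi>1 0" using assms(1) by auto
  have "(\<phi>1 has_real_derivative E) (at 0)"
    by (rule has_field_derivative_transform_within_open[OF 2(2) open_greaterThanLessThan, of "-\<delta>" \<delta>])
      (use eq1 assms(1) in auto)
  then show "D = E" using DERIV_unique[OF 2(1)] by simp
qed

lemma curve_stays_in_open:
  fixes \<gamma> :: "real \<Rightarrow> 'e::real_normed_vector"
  assumes "isCont \<gamma> 0" "open U" "\<gamma> 0 \<in> U"
  obtains \<delta> where "\<delta> > 0" "\<And>t. \<bar>t\<bar> < \<delta> \<Longrightarrow> \<gamma> t \<in> U"
proof -
  have "\<forall>\<^sub>F t in at 0. \<gamma> t \<in> U"
    using assms by (auto simp: isCont_def dest: topological_tendstoD)
  then obtain \<delta> where "\<delta> > 0" "\<And>t. t \<noteq> 0 \<Longrightarrow> dist t 0 < \<delta> \<Longrightarrow> \<gamma> t \<in> U"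
    by (auto simp: eventually_at)
  then show thesis using assms(3) that[of \<delta>] by (metis dist_norm diff_zero real_norm_def)
qed

section \<open>Functions homogeneous of degree 0 on the cone\<close>

context space_form
begin

lemma prj_prj: "z \<in> W \<Longrightarrow> prj (prj z) = prj z"
  by (simp add: prj_M prj_in_M)

lemma prj_in_W: "z \<in> W \<Longrightarrow> prj z \<in> W"
  using prj_in_M M_subset_W by auto

text \<open>Vacuous for c = 0, where the cone over a subset of M is that subset itself.\<close>

definition homogeneous :: "('e \<Rightarrow> real) \<Rightarrow> 'e set \<Rightarrow> bool" where
  "homogeneous f U \<longleftrightarrow> (\<forall>z\<in>U. \<forall>r>0. c \<noteq> 0 \<longrightarrow> r *\<^sub>R z \<in> U \<and> f (r *\<^sub>R z) = f z)"

lemma homogeneousD: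
  "homogeneous f U \<Longrightarrow> z \<in> U \<Longrightarrow> r > 0 \<Longrightarrow> c \<noteq> 0 \<Longrightarrow> r *\<^sub>R z \<in> U"
  "homogeneous f U \<Longrightarrow> z \<in> U \<Longrightarrow> r > 0 \<Longrightarrow> c \<noteq> 0 \<Longrightarrow> f (r *\<^sub>R z) = f z"
  by (auto simp: homogeneous_def)

text \<open>Euler's identity in degree 0.\<close>

lemma homogeneous_radial:
  assumes C2: "C2_derivs U f f' f''" and hom: "homogeneous f U" and z: "z \<in> U"
  shows "c * f' z z = 0"
proof (cases "c = 0")
  case False
  have "((\<lambda>t. (1 + t) *\<^sub>R z) has_vector_derivative z) (at 0)"
    by (auto intro!: derivative_eq_intros)
  from C2_derivs_along(1)[OF C2 _ this] z
  have 1: "((\<lambda>t. f ((1 + t) *\<^sub>R z)) has_real_derivative f' z z) (at 0)" by simp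
  have "((\<lambda>t. f ((1 + t) *\<^sub>R z)) has_real_derivative 0) (at 0)"
    by (rule has_field_derivative_transform_within_open[OF DERIV_const[of "f z"]
        open_greaterThanLessThan, of 0 "-1" 1])
      (use homogeneousD(2)[OF hom z _ False] in auto)
  with 1 show ?thesis using DERIV_unique by fastforce
qed simp

lemma homogeneous_derivative:
  assumes C2: "C2_derivs U f f' f''" and hom: "homogeneous f U" and z: "z \<in> U" and r: "r > 0" "c \<noteq> 0"
  shows "f' (r *\<^sub>R z) (r *\<^sub>R v) = f' z v"
proof -
  have d: "((\<lambda>t. z + t *\<^sub>R v) has_vector_derivative v) (at 0)"
    by (auto intro!: derivative_eq_intros)
  have d': "((\<lambda>t. r *\<^sub>R (z + t *\<^sub>R v)) has_vector_derivative r *\<^sub>R v) (at 0)"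
    by (auto intro!: derivative_eq_intros)
  obtain \<delta> where \<delta>: "\<delta> > 0" "\<And>t. \<bar>t\<bar> < \<delta> \<Longrightarrow> z + t *\<^sub>R v \<in> U"
    using curve_stays_in_open[of "\<lambda>t. z + t *\<^sub>R v" U] z C2_derivsD(1)[OF C2] by auto
  have 1: "((\<lambda>t. f (z + t *\<^sub>R v)) has_real_derivative f' z v) (at 0)"
    using C2_derivs_along(1)[OF C2 _ d] z by simp
  have 2: "((\<lambda>t. f (r *\<^sub>R (z + t *\<^sub>R v))) has_real_derivative f' (r *\<^sub>R z) (r *\<^sub>R v)) (at 0)"
    using C2_derivs_along(1)[OF C2 _ d'] homogeneousD(1)[OF hom z r] by simp
  have "((\<lambda>t. f (r *\<^sub>R (z + t *\<^sub>R v))) has_real_derivative f' z v) (at 0)"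
    by (rule has_field_derivative_transform_within_open[OF 1 open_greaterThanLessThan, of "-\<delta>" \<delta>])
      (use \<delta> homogeneousD(2)[OF hom _ r] in auto)
  with 2 show ?thesis using DERIV_unique by blast
qed

text \<open>The line through \<open>r x\<close> with direction \<open>Y + a x\<close> is radially equivalent to a
  reparametrised line through \<open>x\<close> with direction \<open>Y\<close>.\<close>

lemma homogeneous_hessian:
  assumes C2: "C2_derivs U f f' f''" and hom: "homogeneous f U" and x: "x \<in> U" and r: "r > 0" "c \<noteq> 0"
    and Y: "f' x Y = 0"
  shows "f'' (r *\<^sub>R x) (Y + a *\<^sub>R x) (Y + a *\<^sub>R x) = f'' x Y Y / r\<^sup>2"
proof -
  define V where "V = Y + a *\<^sub>R x"
  \<comment> \<open>Chosen so that r x + t (Y + a x) = (r + a t) (x + h(t) Y).\<close>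
  define h where "h t = t / (r + a * t)" for t
  have rx: "r *\<^sub>R x \<in> U" using homogeneousD(1)[OF hom x r] .
  obtain \<delta>1 where \<delta>1: "\<delta>1 > 0" "\<And>t. \<bar>t\<bar> < \<delta>1 \<Longrightarrow> r + a * t \<in> {0<..}"
    using curve_stays_in_open[of "\<lambda>t. r + a * t" "{0<..}"] r by auto
  have dh: "(h has_real_derivative r / (r + a * t)\<^sup>2) (at t)" if "\<bar>t\<bar> < \<delta>1" for t
    using \<delta>1(2)[OF that] unfolding h_def
    by (auto intro!: derivative_eq_intros simp: power2_eq_square field_simps)
  have h0: "h 0 = 0" by (simp add: h_def)
  have "isCont h 0" using dh[of 0] \<delta>1 by (auto intro: DERIV_isCont)
  then obtain \<delta>2 where \<delta>2: "\<delta>2 > 0" "\<And>t. \<bar>t\<bar> < \<delta>2 \<Longrightarrow> x + h t *\<^sub>R Y \<in> U"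
    using curve_stays_in_open[of "\<lambda>t. x + h t *\<^sub>R Y" U] x C2_derivsD(1)[OF C2] h0 by auto
  define \<delta> where "\<delta> = min \<delta>1 \<delta>2"
  have \<delta>: "\<delta> > 0" using \<delta>1 \<delta>2 by (simp add: \<delta>_def)
  have eq: "r *\<^sub>R x + t *\<^sub>R V = (r + a * t) *\<^sub>R (x + h t *\<^sub>R Y)" if "\<bar>t\<bar> < \<delta>" for t
  proof -
    have ht: "(r + a * t) * h t = t" using \<delta>1(2)[of t] that by (simp add: h_def \<delta>_def)
    show ?thesis
      unfolding V_def scaleR_add_right scaleR_scaleR ht by (simp add: algebra_simps)
  qed
  have inU: "r *\<^sub>R x + t *\<^sub>R V \<in> U" and feq: "f (r *\<^sub>R x + t *\<^sub>R V) = f (x + h t *\<^sub>R Y)"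
    if "\<bar>t\<bar> < \<delta>" for t
    using homogeneousD[OF hom \<delta>2(2) _ r(2), of t "r + a * t"] \<delta>1(2)[of t] that eq[OF that]
    by (auto simp: \<delta>_def)
  have L: "((\<lambda>t. r *\<^sub>R x + t *\<^sub>R V) has_vector_derivative V) (at t)" for t
    by (auto intro!: derivative_eq_intros)
  have R: "((\<lambda>t. x + h t *\<^sub>R Y) has_vector_derivative (r / (r + a * t)\<^sup>2) *\<^sub>R Y) (at t)" if "\<bar>t\<bar> < \<delta>" for t
    using dh[of t] that
    by (auto intro!: derivative_eq_intros simp: \<delta>_def has_real_derivative_iff_has_vector_derivative)
  \<comment> \<open>The second derivative of h is multiplied by f' x Y = 0, so only the square of
    h'(0) = 1 / r survives.\<close>
  have "((\<lambda>t. r / (r + a * t)\<^sup>2) has_real_derivative - 2 * a / r\<^sup>2) (at 0)"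
    using r by (auto intro!: derivative_eq_intros simp: power2_eq_square field_simps)
  from has_vector_derivative_scaleR[OF this has_vector_derivative_const[of Y]]
  have R2: "((\<lambda>t. (r / (r + a * t)\<^sup>2) *\<^sub>R Y) has_vector_derivative (- 2 * a / r\<^sup>2) *\<^sub>R Y) (at 0)"
    by simp
  have c0: "((\<lambda>t. V) has_vector_derivative 0) (at (0::real))" by simp
  have "f'' (r *\<^sub>R x + 0 *\<^sub>R V) V V + f' (r *\<^sub>R x + 0 *\<^sub>R V) 0 =
    f'' (x + h 0 *\<^sub>R Y) ((r / (r + a * 0)\<^sup>2) *\<^sub>R Y) ((r / (r + a * 0)\<^sup>2) *\<^sub>R Y) +
    f' (x + h 0 *\<^sub>R Y) ((- 2 * a / r\<^sup>2) *\<^sub>R Y)"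
  proof (rule second_derivative_unique(2)[OF \<delta>])
    show "((\<lambda>t. f (r *\<^sub>R x + t *\<^sub>R V)) has_real_derivative f' (r *\<^sub>R x + t *\<^sub>R V) V) (at t)"
      if "\<bar>t\<bar> < \<delta>" for t using C2_derivs_along(1)[OF C2 inU[OF that] L] .
    show "((\<lambda>t. f (x + h t *\<^sub>R Y)) has_real_derivative
       f' (x + h t *\<^sub>R Y) ((r / (r + a * t)\<^sup>2) *\<^sub>R Y)) (at t)" if "\<bar>t\<bar> < \<delta>" for t
      using C2_derivs_along(1)[where \<gamma>="\<lambda>t. x + h t *\<^sub>R Y" and ?d1.0="\<lambda>t. (r / (r + a * t)\<^sup>2) *\<^sub>R Y" and t=t, OF C2 _ R[OF that]] \<delta>2(2) that by (auto simp: \<delta>_def)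
    show "((\<lambda>t. f' (r *\<^sub>R x + t *\<^sub>R V) V) has_real_derivative
       f'' (r *\<^sub>R x + 0 *\<^sub>R V) V V + f' (r *\<^sub>R x + 0 *\<^sub>R V) 0) (at 0)"
      using C2_derivs_along(2)[OF C2 _ L c0] rx by simp
    show "((\<lambda>t. f' (x + h t *\<^sub>R Y) ((r / (r + a * t)\<^sup>2) *\<^sub>R Y)) has_real_derivative
      f'' (x + h 0 *\<^sub>R Y) ((r / (r + a * 0)\<^sup>2) *\<^sub>R Y) ((r / (r + a * 0)\<^sup>2) *\<^sub>R Y) +
      f' (x + h 0 *\<^sub>R Y) ((- 2 * a / r\<^sup>2) *\<^sub>R Y)) (at 0)"
      using C2_derivs_along(2)[where \<gamma>="\<lambda>t. x + h t *\<^sub>R Y" and ?d1.0="\<lambda>t. (r / (r + a * t)\<^sup>2) *\<^sub>R Y" and t=0, OF C2 _ R R2] x \<delta> by (simp add: h0)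
  qed (use feq in auto)
  then show ?thesis
    using Y r by (simp add: h_def V_def[symmetric] blinfun.bilinear_simps field_simps power2_eq_square)
qed

end

section \<open>Local defining functions, the outer normal and normal curvature\<close>

context domain_in_space_form
begin

text \<open>A local defining function of the cone over the domain, homogeneous of degree \<open>0\<close>
  if \<open>c\<close> is nonzero.\<close>

definition local_fn where
  "local_fn f f' f'' U \<longleftrightarrow> C2_derivs U f f' f'' \<and> U \<subseteq> W \<and> homogeneous f U \<and>
     (\<forall>z\<in>U. \<exists>w. f' z w \<noteq> 0) \<and>
     (\<forall>z\<in>U. (f z < 0 \<longleftrightarrow> z \<in> cone inn) \<and> (f z = 0 \<longleftrightarrow> z \<in> cone bd))"

text \<open>The given equation f0 = 0 says nothing about sides. Both sides near P lie in connected
  sets missing the boundary, so each is wholly inside or wholly outside. They are not both outside,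
  as P is a limit of interior points, and not both inside, as P would then be interior. Hence one
  choice of sign makes the function negative exactly inside.\<close>

lemma local_fn_exists:
  assumes P: "P \<in> bd"
  obtains f f' f'' U where "local_fn f f' f'' U" "P \<in> U"
proof -
  have PM: "P \<in> M" using P bd_M by auto
  obtain U0 f0 v where U0: "open U0" "P \<in> U0" "C2_on U0 f0" "bd \<inter> U0 = {x \<in> M \<inter> U0. f0 x = 0}"
    "v \<in> tangent_space M P" "frechet_derivative f0 (at P) v \<noteq> (0::real)"
    using hypersurface P unfolding C2_hypersurface_def by blast
  obtain f0' f0'' where f0: "C2_derivs U0 f0 f0' f0''" using C2_on_imp_derivs[OF U0(3,1)] .
  define U1 where "U1 = W \<inter> prj -` U0"
  define f1 where "f1 z = f0 (prj z)" for z
  have oU1: "open U1"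
    unfolding U1_def by (rule continuous_open_preimage[OF continuous_on_prj open_W U0(1)])
  have "C2_on U1 f1"
    unfolding f1_def
    by (rule C2_on_compose[OF U0(3) C2_on_subset[OF C2_prj]]) (auto simp: U1_def)
  then obtain f1' f1'' where f1: "C2_derivs U1 f1 f1' f1''" using C2_on_imp_derivs oU1 by blast
  have PU1: "P \<in> U1" using PM M_subset_W U0(2) by (auto simp: U1_def prj_M)
  have f1P: "f1 P = 0" using U0(2,4) P PM by (auto simp: f1_def prj_M)
  \<comment> \<open>Along a curve in M the projection is the identity, so f1 and f0 have the same
    derivative in directions tangent to M.\<close>
  have f1v: "f1' P v \<noteq> 0"
  proof -
    obtain \<gamma> where \<gamma>: "\<gamma> 0 = P" "\<forall>\<^sub>F t in nhds (0::real). \<gamma> t \<in> M" "(\<gamma> has_vector_derivative v) (at 0)"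
      using U0(5) by (auto simp: tangent_space_def)
    have 1: "((\<lambda>t. f1 (\<gamma> t)) has_real_derivative f1' P v) (at 0)"
      using C2_derivs_along(1)[OF f1 _ \<gamma>(3)] \<gamma>(1) PU1 by simp
    have 0: "((\<lambda>t. f0 (\<gamma> t)) has_real_derivative f0' P v) (at 0)"
      using C2_derivs_along(1)[OF f0 _ \<gamma>(3)] \<gamma>(1) U0(2) by simp
    have "\<forall>\<^sub>F t in nhds 0. f1 (\<gamma> t) = f0 (\<gamma> t)"
      using \<gamma>(2) by eventually_elim (simp add: f1_def prj_M)
    then have "((\<lambda>t. f1 (\<gamma> t)) has_real_derivative f0' P v) (at 0)"
      using 0 DERIV_cong_ev[OF refl, of "\<lambda>t. f1 (\<gamma> t)" "\<lambda>t. f0 (\<gamma> t)" 0] by blast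
    then have "f1' P v = f0' P v" using 1 DERIV_unique by blast
    moreover have "frechet_derivative f0 (at P) = blinfun_apply (f0' P)"
      using frechet_derivative_at[OF C2_derivsD(2)[OF f0 U0(2)]] by simp
    ultimately show ?thesis using U0(6) by simp
  qed
  define w where "w = (if f1' P v > 0 then v else - v)"
  have w: "f1' P w > 0" using f1v by (auto simp: w_def blinfun.bilinear_simps)
  obtain r1 K1 where 1: "r1 > 0" "ball P r1 \<subseteq> U1" "\<And>z. z \<in> ball P r1 \<Longrightarrow> f1' z w > 0"
    "connected K1" "K1 \<subseteq> {z\<in>U1. f1 z < 0}" "ball P r1 \<inter> {z. f1 z < 0} \<subseteq> K1"
    by (rule negative_side_connected[OF f1 PU1 f1P w]) blast
  have w2: "(- f1' P) (- w) > 0" using w by (simp add: blinfun.bilinear_simps)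
  obtain r2 K2 where 2: "r2 > 0" "connected K2" "K2 \<subseteq> {z\<in>U1. - f1 z < 0}" "ball P r2 \<inter> {z. - f1 z < 0} \<subseteq> K2"
    by (rule negative_side_connected[OF C2_derivs_minus[OF f1] PU1 _ w2]) (use f1P in auto)
  define r where "r = min r1 r2"
  have r: "r > 0" using 1 2 by (simp add: r_def)
  have U1bd: "f1 z = 0 \<longleftrightarrow> z \<in> cone bd" if "z \<in> U1" for z
    using that U0(4) prj_in_M by (auto simp: U1_def f1_def cone_def)
  have U1W: "U1 \<subseteq> W" by (auto simp: U1_def)
  have K1: "K1 \<subseteq> cone inn \<or> K1 \<inter> cone \<Omega> = {}"
  proof -
    have "K1 \<subseteq> W" using 1(5) U1W by auto
    moreover have "K1 \<inter> cone bd = {}" using 1(5) U1bd by fastforce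
    ultimately show ?thesis using connected_off_bd[OF 1(4)] by metis
  qed
  have K2: "K2 \<subseteq> cone inn \<or> K2 \<inter> cone \<Omega> = {}"
  proof -
    have "K2 \<subseteq> W" using 2(3) U1W by auto
    moreover have "K2 \<inter> cone bd = {}" using 2(3) U1bd by fastforce
    ultimately show ?thesis using connected_off_bd[OF 2(2)] by metis
  qed
  have ball: "z \<in> U1 \<and> (f1 z < 0 \<longrightarrow> z \<in> K1) \<and> (f1 z > 0 \<longrightarrow> z \<in> K2)" if "z \<in> ball P r" for z
    using that 1(2,6) 2(4) by (auto simp: r_def)
  have notout: "\<not> (K1 \<inter> cone \<Omega> = {} \<and> K2 \<inter> cone \<Omega> = {})"
  proof
    assume a: "K1 \<inter> cone \<Omega> = {} \<and> K2 \<inter> cone \<Omega> = {}"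
    have "P \<in> closure inn" using P bd_eq Omega_closure by auto
    then obtain z where z: "z \<in> inn" "z \<in> ball P r"
      using r by (metis closure_approachable dist_commute mem_ball)
    then have zc: "z \<in> cone inn" using inn_M cone_M_iff by auto
    then have "f1 z \<noteq> 0" using U1bd ball z(2) cone_Omega by blast
    then have "z \<in> K1 \<union> K2" using ball[OF z(2)] by (auto simp: neq_iff)
    then show False using a zc cone_Omega by blast
  qed
  have notin: "\<not> (K1 \<subseteq> cone inn \<and> K2 \<subseteq> cone inn)"
  proof
    assume a: "K1 \<subseteq> cone inn \<and> K2 \<subseteq> cone inn"
    have "z \<in> \<Omega>" if "z \<in> M \<inter> ball P r" for z
    proof -
      have "z \<in> cone \<Omega>"
        using ball[of z] that a U1bd[of z] cone_Omega by (cases "f1 z" "0::real" rule: linorder_cases) auto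
      then show ?thesis using that cone_M_iff by blast
    qed
    then have "M \<inter> ball P r \<subseteq> inn"
      by (intro interior_of_maximal) (auto simp: openin_open)
    then show False using P PM r bd_inn by auto
  qed
  define \<sigma> :: real where "\<sigma> = (if K1 \<subseteq> cone inn then 1 else -1)"
  define F where "F z = \<sigma> * f1 z" for z
  have sides: "(F z < 0 \<longleftrightarrow> z \<in> cone inn) \<and> (F z = 0 \<longleftrightarrow> z \<in> cone bd)" if "z \<in> ball P r" for z
    using ball[OF that] U1bd[of z] K1 K2 notin notout cone_Omega
    by (cases "f1 z" "0::real" rule: linorder_cases) (auto simp: F_def \<sigma>_def)
  \<comment> \<open>A full preimage under \<open>prj\<close>, hence invariant under positive scaling
    when c is nonzero.\<close>
  define U where "U = W \<inter> prj -` ball P r"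
  have UU1: "U \<subseteq> U1"
    using ball[of "prj _"] prj_prj by (fastforce simp: U_def U1_def)
  have oU: "open U"
    unfolding U_def by (rule continuous_open_preimage[OF continuous_on_prj open_W open_ball])
  have f1U: "C2_derivs U f1 f1' f1''" by (rule C2_derivs_subset[OF f1 oU UU1])
  have "\<exists>F' F''. C2_derivs U F F' F'' \<and> (\<forall>z. F' z = \<sigma> *\<^sub>R f1' z)"
  proof (cases "\<sigma> = 1")
    case True
    then have "F = f1" by (auto simp: F_def)
    then show ?thesis using f1U True by auto
  next
    case False
    then have "\<sigma> = -1" by (auto simp: \<sigma>_def split: if_splits)
    then have "F = (\<lambda>z. - f1 z)" by (auto simp: F_def)
    then show ?thesis using C2_derivs_minus[OF f1U] \<open>\<sigma> = -1\<close> by auto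
  qed
  then obtain F' F'' where F: "C2_derivs U F F' F''" "\<And>z. F' z = \<sigma> *\<^sub>R f1' z" by blast
  have hom: "homogeneous F U"
    by (auto simp: homogeneous_def U_def F_def f1_def prj_scaleR scale_W)
  have inball: "prj z \<in> ball P r" if "z \<in> U" for z using that by (simp add: U_def)
  have prjU: "prj z \<in> U" if "z \<in> U" for z
    using that by (simp add: U_def prj_prj prj_in_W)
  have Fprj: "F (prj z) = F z" if "z \<in> U" for z
    using that by (simp add: F_def f1_def U_def prj_prj)
  show thesis
  proof (rule that)
    show "P \<in> U" using PM M_subset_W r by (auto simp: U_def prj_M)
    show "local_fn F F' F'' U"
      unfolding local_fn_def
    proof (intro conjI ballI F(1) hom)
      show "U \<subseteq> W" by (auto simp: U_def)
      fix z assume z: "z \<in> U"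
      have zW: "z \<in> W" using z by (auto simp: U_def)
      have cz: "z \<in> cone A \<longleftrightarrow> prj z \<in> cone A" for A
        using zW by (simp add: cone_def prj_prj prj_in_W)
      show "F z < 0 \<longleftrightarrow> z \<in> cone inn" "F z = 0 \<longleftrightarrow> z \<in> cone bd"
        using sides[OF inball[OF z]] Fprj[OF z] cz by auto
      \<comment> \<open>The derivative is known to be nonzero only in the small ball; homogeneity
        carries this along the ray from \<open>prj z\<close> to z.\<close>
      have nz: "F' (prj z) w \<noteq> 0"
        using 1(3)[of "prj z"] inball[OF z] by (auto simp: F(2) r_def \<sigma>_def blinfun.bilinear_simps)
      obtain s where s: "s > 0" "z = s *\<^sub>R prj z" "c = 0 \<Longrightarrow> s = 1"
        by (rule prj_cases[OF zW]) blast
      show "\<exists>w. F' z w \<noteq> 0"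
      proof (cases "c = 0")
        case True
        then have "z = prj z" using s(2,3) by simp
        then show ?thesis using nz by metis
      next
        case False
        from homogeneous_derivative[OF F(1) hom prjU[OF z] s(1) False, of w]
        show ?thesis using nz s(2) by metis
      qed
    qed
  qed
qed

lemma local_fnD:
  assumes "local_fn f f' f'' U"
  shows "C2_derivs U f f' f''" "U \<subseteq> W" "homogeneous f U" "open U"
    "z \<in> U \<Longrightarrow> \<exists>w. f' z w \<noteq> 0" "z \<in> U \<Longrightarrow> \<exists>w. f' z w > 0"
    "z \<in> U \<Longrightarrow> f z < 0 \<longleftrightarrow> z \<in> cone inn" "z \<in> U \<Longrightarrow> f z = 0 \<longleftrightarrow> z \<in> cone bd"
    "z \<in> U \<Longrightarrow> f z \<le> 0 \<longleftrightarrow> z \<in> cone \<Omega>"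
proof -
  show *: "C2_derivs U f f' f''" "U \<subseteq> W" "homogeneous f U" "open U"
    "z \<in> U \<Longrightarrow> \<exists>w. f' z w \<noteq> 0"
    "z \<in> U \<Longrightarrow> f z < 0 \<longleftrightarrow> z \<in> cone inn" "z \<in> U \<Longrightarrow> f z = 0 \<longleftrightarrow> z \<in> cone bd" for z
    using assms C2_derivsD(1) unfolding local_fn_def by blast+
  show "f z \<le> 0 \<longleftrightarrow> z \<in> cone \<Omega>" if "z \<in> U"
    using *(6,7)[OF that] cone_Omega(1) by (metis Un_iff less_eq_real_def)
  show "\<exists>w. f' z w > 0" if zU: "z \<in> U"
  proof -
    obtain w where w: "f' z w \<noteq> 0" using *(5)[OF zU] by blast
    show ?thesis
    proof (cases "f' z w > 0")
      case False
      then have "f' z (- w) > 0" using w by (simp add: blinfun.minus_right)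
      then show ?thesis by blast
    qed blast
  qed
qed

context
  fixes f f' f'' U P
  assumes lf: "local_fn f f' f'' U" and P: "P \<in> bd" "P \<in> U"
begin

lemma local_gradient:
  obtains \<nu> l where "l > 0" "c * g P \<nu> = 0" "g \<nu> \<nu> = 1" "\<And>w. f' P w = l * g \<nu> w"
proof -
  obtain w where "f' P w \<noteq> 0" using local_fnD(5)[OF lf P(2)] by blast
  from gradient[OF _ blinfun.bounded_linear_right homogeneous_radial[OF local_fnD(1,3)[OF lf] P(2)] this]
  show ?thesis using that P bd_M by blast
qed

text \<open>The implicit curve lies on the cone over the boundary. Projecting it to M keeps it twice
  continuously differentiable and, as Y is tangent to M, keeps its initial velocity.\<close>

lemma boundary_curve:
  assumes Y: "c * g P Y = 0" "f' P Y = 0"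
  obtains \<epsilon> \<alpha> where "\<epsilon> > 0" "C2_on {-\<epsilon><..<\<epsilon>} \<alpha>" "\<alpha> ` {-\<epsilon><..<\<epsilon>} \<subseteq> bd" "\<alpha> 0 = P"
    "(\<alpha> has_vector_derivative Y) (at 0)"
proof -
  note L = local_fnD[OF lf]
  obtain w where w: "f' P w > 0" using L(6)[OF P(2)] by blast
  have PM: "P \<in> M" using P bd_M by auto
  have fP: "f P = 0" using L(8)[OF P(2)] cone_M_iff[OF PM] P(1) by simp
  obtain \<epsilon> s s1 s2 where s: "\<epsilon> > 0" "s 0 = 0" "s1 0 = 0"
    "\<And>t. t \<in> {-\<epsilon><..<\<epsilon>} \<Longrightarrow> (s has_real_derivative s1 t) (at t)"
    "\<And>t. t \<in> {-\<epsilon><..<\<epsilon>} \<Longrightarrow> (s1 has_real_derivative s2 t) (at t)"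
    "continuous_on {-\<epsilon><..<\<epsilon>} s2"
    "\<And>t. t \<in> {-\<epsilon><..<\<epsilon>} \<Longrightarrow> f (P + t *\<^sub>R Y + s t *\<^sub>R w) = 0"
    "\<And>t \<sigma>. t \<in> {-\<epsilon><..<\<epsilon>} \<Longrightarrow> \<bar>\<sigma>\<bar> \<le> \<bar>s t\<bar> \<Longrightarrow>
       P + t *\<^sub>R Y + \<sigma> *\<^sub>R w \<in> U \<and> f' (P + t *\<^sub>R Y + \<sigma> *\<^sub>R w) w > 0"
    by (rule implicit_curve[OF L(1) P(2) fP Y(2) w]) blast
  define \<beta> where "\<beta> t = P + t *\<^sub>R Y + s t *\<^sub>R w" for t
  have bU: "\<beta> t \<in> U" if "t \<in> {-\<epsilon><..<\<epsilon>}" for t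
    using s(8)[OF that, of "s t"] by (simp add: \<beta>_def)
  have d1: "(\<beta> has_vector_derivative Y + s1 t *\<^sub>R w) (at t)" if "t \<in> {-\<epsilon><..<\<epsilon>}" for t
    unfolding \<beta>_def using s(4)[OF that]
    by (auto intro!: derivative_eq_intros simp: has_real_derivative_iff_has_vector_derivative)
  have d2: "((\<lambda>t. Y + s1 t *\<^sub>R w) has_vector_derivative s2 t *\<^sub>R w) (at t)" if "t \<in> {-\<epsilon><..<\<epsilon>}" for t
    using s(5)[OF that]
    by (auto intro!: derivative_eq_intros simp: has_real_derivative_iff_has_vector_derivative)
  have "C2_on {-\<epsilon><..<\<epsilon>} \<beta>"
    by (rule C2_on_curveI[OF d1 d2]) (auto intro!: continuous_intros s(6))
  then have C2: "C2_on {-\<epsilon><..<\<epsilon>} (\<lambda>t. prj (\<beta> t))"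
    by (rule C2_on_compose[OF C2_prj]) (use bU L(2) in auto)
  show thesis
  proof (rule that[OF s(1) C2])
    show "(\<lambda>t. prj (\<beta> t)) ` {-\<epsilon><..<\<epsilon>} \<subseteq> bd"
    proof clarify
      fix t assume t: "t \<in> {-\<epsilon><..<\<epsilon>}"
      have "\<beta> t \<in> cone bd" using L(8)[OF bU[OF t]] s(7)[OF t] by (simp add: \<beta>_def)
      then show "prj (\<beta> t) \<in> bd" by (simp add: cone_def)
    qed
    show "prj (\<beta> 0) = P" using s(2) PM by (simp add: \<beta>_def prj_M)
    show "((\<lambda>t. prj (\<beta> t)) has_vector_derivative Y) (at 0)"
      using prj_curve[OF PM Y(1), of \<beta> 0] d1[of 0] s(1-3) by (simp add: \<beta>_def)
  qed
qed

lemma boundary_tangent: "tangent_space bd P = {Y. c * g P Y = 0 \<and> f' P Y = 0}"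
proof (intro equalityI subsetI CollectI)
  note L = local_fnD[OF lf]
  fix Y assume "Y \<in> tangent_space bd P"
  then obtain \<gamma> where \<gamma>: "\<gamma> 0 = P" "\<forall>\<^sub>F t in nhds (0::real). \<gamma> t \<in> bd" "(\<gamma> has_vector_derivative Y) (at 0)"
    by (auto simp: tangent_space_def)
  have "Y \<in> tangent_space M P"
    unfolding tangent_space_def
    using \<gamma> bd_M by (intro CollectI exI[of _ \<gamma>]) (auto elim: eventually_mono)
  then have 1: "c * g P Y = 0" using tangent_space_M P(1) bd_M by auto
  have d: "((\<lambda>t. f (\<gamma> t)) has_real_derivative f' P Y) (at 0)"
    using C2_derivs_along(1)[OF L(1) _ \<gamma>(3)] \<gamma>(1) P(2) by simp
  have "isCont \<gamma> 0" using \<gamma>(3) by (rule has_vector_derivative_continuous)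
  then obtain \<delta> where "\<delta> > 0" "\<And>t. \<bar>t\<bar> < \<delta> \<Longrightarrow> \<gamma> t \<in> U"
    using curve_stays_in_open[of \<gamma> U] P(2) L(4) \<gamma>(1) by auto
  then have "\<forall>\<^sub>F t in nhds 0. \<gamma> t \<in> U"
    by (auto simp: eventually_nhds_metric intro!: exI[of _ \<delta>])
  with \<gamma>(2) have "\<forall>\<^sub>F t in nhds 0. f (\<gamma> t) = 0"
    by eventually_elim (use L(8) bd_M cone_M_iff in blast)
  then have "((\<lambda>t. 0) has_real_derivative f' P Y) (at (0::real))"
    using d DERIV_cong_ev[OF refl, of "\<lambda>t. f (\<gamma> t)" "\<lambda>t. 0" 0] by blast
  then show "c * g P Y = 0 \<and> f' P Y = 0" using 1 DERIV_unique[OF _ DERIV_const] by blast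
next
  fix Y assume "Y \<in> {Y. c * g P Y = 0 \<and> f' P Y = 0}"
  then have Y: "c * g P Y = 0" "f' P Y = 0" by auto
  obtain \<epsilon> \<alpha> where \<alpha>: "\<epsilon> > 0" "C2_on {-\<epsilon><..<\<epsilon>} \<alpha>" "\<alpha> ` {-\<epsilon><..<\<epsilon>} \<subseteq> bd" "\<alpha> 0 = P"
    "(\<alpha> has_vector_derivative Y) (at 0)" using boundary_curve[OF Y] .
  have "\<forall>\<^sub>F t in nhds 0. t \<in> {-\<epsilon><..<\<epsilon>}" using \<alpha>(1) by (intro eventually_nhds_in_open) auto
  then have "\<forall>\<^sub>F t in nhds 0. \<alpha> t \<in> bd" by eventually_elim (use \<alpha>(3) in blast)
  then show "Y \<in> tangent_space bd P" using \<alpha>(4,5) by (auto simp: tangent_space_def)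
qed

text \<open>The definite description needs uniqueness. A competitor is a unit vector orthogonal to
  the tangent space of the boundary, hence \<nu> or - \<nu>, and a curve leaving P with velocity -
  \<nu> enters the interior.\<close>

lemma outer_normal_eq:
  assumes l: "l > 0" and \<nu>: "c * g P \<nu> = 0" "g \<nu> \<nu> = 1" "\<And>w. f' P w = l * g \<nu> w"
  shows "outer_normal M g \<Omega> P = \<nu>"
  unfolding outer_normal_def
proof (rule the_equality, intro conjI)
  note L = local_fnD[OF lf]
  have PM: "P \<in> M" using P bd_M by auto
  have PW: "P \<in> W" using PM M_subset_W by auto
  have fP: "f P = 0" using L(8)[OF P(2)] cone_M_iff[OF PM] P(1) by simp
  show "\<nu> \<in> tangent_space M P" using \<nu>(1) by (simp add: tangent_space_M[OF PM])
  show "g \<nu> \<nu> = 1" by fact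
  show "\<forall>Y\<in>tangent_space bd P. g \<nu> Y = 0" using \<nu>(3) l by (simp add: boundary_tangent)
  have d: "((\<lambda>t. P + t *\<^sub>R \<nu>) has_vector_derivative \<nu>) (at 0)"
    by (auto intro!: derivative_eq_intros)
  have df: "((\<lambda>t. f (P + t *\<^sub>R \<nu>)) has_real_derivative l) (at 0)"
    using C2_derivs_along(1)[OF L(1) _ d] P(2) \<nu> by simp
  obtain e where e: "e > 0" "\<And>h. h > 0 \<Longrightarrow> h < e \<Longrightarrow> f (P + h *\<^sub>R \<nu>) > 0"
    using DERIV_pos_inc_right[OF df l] fP by auto
  obtain \<delta> where \<delta>: "\<delta> > 0" "\<And>t. \<bar>t\<bar> < \<delta> \<Longrightarrow> P + t *\<^sub>R \<nu> \<in> U"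
    using curve_stays_in_open[of "\<lambda>t. P + t *\<^sub>R \<nu>" U] P(2) L(4) by auto
  have "\<forall>\<^sub>F t in at_right (0::real). prj (P + t *\<^sub>R \<nu>) \<in> M - \<Omega>"
    unfolding eventually_at_right_field
  proof (intro exI[of _ "min e \<delta>"] conjI allI impI)
    fix t assume t: "0 < t" "t < min e \<delta>"
    then have U: "P + t *\<^sub>R \<nu> \<in> U" using \<delta> by simp
    have "P + t *\<^sub>R \<nu> \<notin> cone \<Omega>" using L(9)[OF U] e(2)[of t] t by simp
    then show "prj (P + t *\<^sub>R \<nu>) \<in> M - \<Omega>" using U L(2) prj_in_M by (auto simp: cone_def)
  qed (use e \<delta> in auto)
  then show "\<exists>\<gamma>. \<gamma> 0 = P \<and> (\<gamma> has_vector_derivative \<nu>) (at 0) \<and> (\<forall>\<^sub>F t in at_right 0. \<gamma> t \<in> M - \<Omega>)"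
    using prj_curve[OF PM \<nu>(1) d] prj_M[OF PM] by (intro exI[of _ "\<lambda>t. prj (P + t *\<^sub>R \<nu>)"]) auto
  fix \<nu>' assume "\<nu>' \<in> tangent_space M P \<and> g \<nu>' \<nu>' = 1 \<and> (\<forall>Y\<in>tangent_space bd P. g \<nu>' Y = 0) \<and>
    (\<exists>\<gamma>. \<gamma> 0 = P \<and> (\<gamma> has_vector_derivative \<nu>') (at 0) \<and> (\<forall>\<^sub>F t in at_right 0. \<gamma> t \<in> M - \<Omega>))"
  then obtain \<gamma> where n: "c * g P \<nu>' = 0" "g \<nu>' \<nu>' = 1" "\<And>Y. c * g P Y = 0 \<Longrightarrow> f' P Y = 0 \<Longrightarrow> g \<nu>' Y = 0"
    and \<gamma>: "\<gamma> 0 = P" "(\<gamma> has_vector_derivative \<nu>') (at 0)" "\<forall>\<^sub>F t in at_right (0::real). \<gamma> t \<in> M - \<Omega>"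
    by (auto simp: tangent_space_M[OF PM] boundary_tangent)
  \<comment> \<open>After removal of the \<nu>-component the rest Y is tangent to the boundary and
    orthogonal to \<nu> and \<nu>', hence to itself.\<close>
  define b where "b = g \<nu>' \<nu>"
  define Y where "Y = \<nu>' - b *\<^sub>R \<nu>"
  have Y: "c * g P Y = 0" 
  proof -
    have "c * g P Y = c * g P \<nu>' - b * (c * g P \<nu>)" by (simp add: Y_def g_simps algebra_simps)
    then show ?thesis unfolding n(1) \<nu>(1) by simp
  qed
  have gY: "g \<nu> Y = 0" using \<nu>(2) by (simp add: Y_def g_simps b_def sym)
  then have "g \<nu>' Y = 0" using n(3)[OF Y] \<nu>(3) by simp
  moreover have "g Y Z = g \<nu>' Z - b * g \<nu> Z" for Z by (simp add: Y_def g_simps)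
  ultimately have "g Y Y = 0" using gY by simp
  then have "Y = 0" using pos_def[OF PW Y] by force
  then have nb: "\<nu>' = b *\<^sub>R \<nu>" by (simp add: Y_def)
  then have "b * b = 1" using n(2) \<nu>(2) by (simp add: g_simps)
  then have "b = 1 \<or> b = -1" by algebra
  moreover have "b \<noteq> -1"
  proof
    assume "b = -1"
    have "isCont \<gamma> 0" using \<gamma>(2) by (rule has_vector_derivative_continuous)
    then obtain \<delta> where \<delta>: "\<delta> > 0" "\<And>t. \<bar>t\<bar> < \<delta> \<Longrightarrow> \<gamma> t \<in> U"
      using curve_stays_in_open[of \<gamma> U] P(2) L(4) \<gamma>(1) by auto
    have "((\<lambda>t. f (\<gamma> t)) has_real_derivative f' P \<nu>') (at 0)"
      using C2_derivs_along(1)[OF L(1) _ \<gamma>(2)] \<gamma>(1) P(2) by simp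
    then have "((\<lambda>t. f (\<gamma> t)) has_real_derivative - l) (at 0)"
      using nb \<open>b = -1\<close> \<nu> by (simp add: g_simps)
    then obtain e where e: "e > 0" "\<And>h. h > 0 \<Longrightarrow> h < e \<Longrightarrow> f (\<gamma> h) < 0"
      using DERIV_neg_dec_right[of "\<lambda>t. f (\<gamma> t)" "-l" 0] l \<gamma>(1) fP by auto
    obtain e' where e': "e' > 0" "\<And>t. 0 < t \<Longrightarrow> t < e' \<Longrightarrow> \<gamma> t \<in> M - \<Omega>"
      using \<gamma>(3) unfolding eventually_at_right_field by auto
    define t where "t = Min {e, e', \<delta>} / 2"
    have t: "0 < t" "t < e" "t < e'" "\<bar>t\<bar> < \<delta>" using e e' \<delta>(1) by (auto simp: t_def)
    have "\<gamma> t \<in> cone inn" using L(7)[OF \<delta>(2)[OF t(4)]] e(2) t by simp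
    moreover have "\<gamma> t \<in> M - \<Omega>" using e'(2) t by simp
    ultimately show False using cone_M_iff inn_sub by blast
  qed
  ultimately show "\<nu>' = \<nu>" using nb by simp
qed

text \<open>Differentiating f(\<alpha> t) = 0 twice gives f''(Y, Y) = - l g(\<alpha>'', \<nu>). The
  resulting quotient does not depend on \<alpha>, as the definite description requires.\<close>

lemma normal_curvature_eq:
  assumes l: "l > 0" and \<nu>: "c * g P \<nu> = 0" "g \<nu> \<nu> = 1" "\<And>w. f' P w = l * g \<nu> w"
    and Y: "c * g P Y = 0" "f' P Y = 0" "Y \<noteq> 0"
  shows "normal_curvature M g \<Omega> P Y = f'' P Y Y / (l * g Y Y)"
proof -
  note L = local_fnD[OF lf]
  have on: "outer_normal M g \<Omega> P = \<nu>" by (rule outer_normal_eq[OF l \<nu>])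
  have "P \<in> W" using P(1) bd_M M_subset_W by auto
  then have gY: "g Y Y > 0" using pos_def Y by blast
  have val: "- g (acceleration \<alpha> 0) \<nu> / g Y Y = f'' P Y Y / (l * g Y Y)"
    if \<alpha>: "\<epsilon> > 0" "C2_on {-\<epsilon><..<\<epsilon>} \<alpha>" "\<alpha> ` {-\<epsilon><..<\<epsilon>} \<subseteq> bd" "\<alpha> 0 = P" "velocity \<alpha> 0 = Y" for \<alpha> \<epsilon>
  proof -
    note d = C2_on_curveD[OF \<alpha>(2) open_greaterThanLessThan]
    have 0: "0 \<in> {-\<epsilon><..<\<epsilon>}" using \<alpha>(1) by simp
    have "isCont \<alpha> 0" using d(1)[OF 0] by (rule has_vector_derivative_continuous)
    then obtain \<delta>0 where \<delta>0: "\<delta>0 > 0" "\<And>t. \<bar>t\<bar> < \<delta>0 \<Longrightarrow> \<alpha> t \<in> U"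
      using curve_stays_in_open[of \<alpha> U] P(2) L(4) \<alpha>(4) by auto
    define \<delta> where "\<delta> = min \<delta>0 \<epsilon>"
    have \<delta>: "\<delta> > 0" using \<delta>0 \<alpha>(1) by (simp add: \<delta>_def)
    have tt: "t \<in> {-\<epsilon><..<\<epsilon>}" "\<alpha> t \<in> U" if "\<bar>t\<bar> < \<delta>" for t using that \<delta>0 by (auto simp: \<delta>_def)
    have "f'' P Y Y + f' P (acceleration \<alpha> 0) = 0"
    proof (rule second_derivative_unique(2)[OF \<delta>, where \<phi>="\<lambda>t. f (\<alpha> t)" and \<psi>="\<lambda>_. 0" and ?\<psi>1.0="\<lambda>_. 0"])
      show "f (\<alpha> t) = 0" if "\<bar>t\<bar> < \<delta>" for t
      proof -
        have "\<alpha> t \<in> bd" using \<alpha>(3) tt(1)[OF that] by blast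
        then show ?thesis using L(8)[OF tt(2)[OF that]] cone_M_iff bd_M by blast
      qed
      show "((\<lambda>t. f (\<alpha> t)) has_real_derivative f' (\<alpha> t) (velocity \<alpha> t)) (at t)" if "\<bar>t\<bar> < \<delta>" for t
        using C2_derivs_along(1)[where \<gamma>=\<alpha> and ?d1.0="velocity \<alpha>" and t=t, OF L(1) tt(2)[OF that] d(1)[OF tt(1)[OF that]]] .
      show "((\<lambda>t. f' (\<alpha> t) (velocity \<alpha> t)) has_real_derivative f'' P Y Y + f' P (acceleration \<alpha> 0)) (at 0)"
        using C2_derivs_along(2)[where \<gamma>=\<alpha> and ?d1.0="velocity \<alpha>" and t=0, OF L(1) _ d(1)[OF 0] d(2)[OF 0]] \<alpha>(4,5) P(2) by simp
    qed auto
    then have "f'' P Y Y = - l * g (acceleration \<alpha> 0) \<nu>" using \<nu>(3) by (simp add: sym)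
    then show ?thesis using l gY by (simp add: field_simps)
  qed
  show ?thesis
    unfolding normal_curvature_def on
  proof (rule the_equality)
    obtain \<epsilon> \<alpha> where \<alpha>: "\<epsilon> > 0" "C2_on {-\<epsilon><..<\<epsilon>} \<alpha>" "\<alpha> ` {-\<epsilon><..<\<epsilon>} \<subseteq> bd" "\<alpha> 0 = P"
      "(\<alpha> has_vector_derivative Y) (at 0)" using boundary_curve[OF Y(1,2)] .
    have v: "velocity \<alpha> 0 = Y" using \<alpha>(5) by (rule vector_derivative_at)
    show "\<exists>\<alpha> \<epsilon>. \<epsilon> > 0 \<and> C2_on {-\<epsilon><..<\<epsilon>} \<alpha> \<and> \<alpha> ` {-\<epsilon><..<\<epsilon>} \<subseteq> bd \<and> \<alpha> 0 = P \<and> velocity \<alpha> 0 = Y \<and>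
      f'' P Y Y / (l * g Y Y) = - g (acceleration \<alpha> 0) \<nu> / g Y Y"
      by (intro exI[of _ \<alpha>] exI[of _ \<epsilon>] conjI \<alpha>(1-4) v val[OF \<alpha>(1-4) v, symmetric])
  qed (use val in blast)
qed

end

end

section \<open>Convexity\<close>

text \<open>A compact segment in an open set has a neighbourhood of uniform width in it, and moving
  the endpoint by some distance moves no point of the segment farther.\<close>

lemma open_segments_into:
  fixes a :: "'e::euclidean_space"
  assumes "open G"
  shows "open {y. closed_segment a y \<subseteq> G}"
  unfolding open_contains_ball
proof (intro ballI)
  fix y assume "y \<in> {y. closed_segment a y \<subseteq> G}"
  then have "closed_segment a y \<subseteq> G" by simp
  then obtain e where e: "e > 0" "(\<Union>x\<in>closed_segment a y. cball x e) \<subseteq> G"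
    using compact_subset_open_imp_cball_epsilon_subset[OF compact_segment assms] by metis
  show "\<exists>e>0. ball y e \<subseteq> {y. closed_segment a y \<subseteq> G}"
  proof (intro exI[of _ e] conjI subsetI CollectI)
    fix y' z assume y': "y' \<in> ball y e" and "z \<in> closed_segment a y'"
    then obtain t where t: "0 \<le> t" "t \<le> 1" "z = (1 - t) *\<^sub>R a + t *\<^sub>R y'"
      by (auto simp: closed_segment_def)
    have "(1 - t) *\<^sub>R a + t *\<^sub>R y - z = t *\<^sub>R (y - y')" by (simp add: t(3) algebra_simps)
    then have "dist ((1 - t) *\<^sub>R a + t *\<^sub>R y) z = t * dist y y'" using t(1) by (simp add: dist_norm)
    also have "\<dots> \<le> 1 * dist y y'" using t by (intro mult_right_mono) auto
    also have "\<dots> \<le> e" using y' by simp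
    finally have "z \<in> cball ((1 - t) *\<^sub>R a + t *\<^sub>R y) e" by simp
    moreover have "(1 - t) *\<^sub>R a + t *\<^sub>R y \<in> closed_segment a y" using t by (auto simp: closed_segment_def)
    ultimately show "z \<in> G" using e(2) by blast
  qed (use e in auto)
qed

locale curved_domain = domain_in_space_form +
  fixes k0 :: real
  assumes k0_nonneg: "0 \<le> k0" and curvature: "normal_curvatures_ge M g \<Omega> k0"
begin

lemma hessian_bd:
  assumes lf: "local_fn f f' f'' U" and P: "P \<in> bd" "P \<in> U"
    and l: "l > 0" "c * g P \<nu> = 0" "g \<nu> \<nu> = 1" "\<And>w. f' P w = l * g \<nu> w"
    and Y: "c * g P Y = 0" "f' P Y = 0"
  shows "f'' P Y Y \<ge> k0 * (l * g Y Y)"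
proof (cases "Y = 0")
  case True
  then show ?thesis by (simp add: g_simps blinfun.zero_right)
next
  case False
  have "P \<in> W" using P(1) bd_M M_subset_W by auto
  then have gY: "g Y Y > 0" using pos_def Y False by blast
  have "Y \<in> tangent_space bd P - {0}" using Y False by (simp add: boundary_tangent[OF lf P])
  then have "normal_curvature M g \<Omega> P Y \<ge> k0"
    using curvature P(1) unfolding normal_curvatures_ge_def by blast
  then show ?thesis
    using normal_curvature_eq[OF lf P l Y False] gY l(1) by (simp add: pos_le_divide_eq)
qed

text \<open>Scaling reduces the claim to a point of M. There the radial part of V contributes
  nothing by homogeneity, and the tangent part is governed by the curvature bound with k0 \<ge>
  0.\<close>

lemma hessian_cone:
  assumes lf: "local_fn f f' f'' U" and z: "z \<in> U" "z \<in> cone bd" and V: "f' z V = 0"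
  shows "f'' z V V \<ge> 0"
proof -
  note L = local_fnD[OF lf]
  define x where "x = prj z"
  have x: "x \<in> bd" using z(2) by (simp add: x_def cone_def)
  then have xM: "x \<in> M" and xW: "x \<in> W" using bd_M M_subset_W by auto
  obtain r where r: "r > 0" "z = r *\<^sub>R x" "c = 0 \<Longrightarrow> r = 1"
    unfolding x_def by (rule prj_cases[of z]) (use z L(2) in auto)
  have xU: "x \<in> U"
  proof (cases "c = 0")
    case False
    have "inverse r *\<^sub>R z \<in> U" using homogeneousD(1)[OF L(3) z(1)] r(1) False by simp
    then show ?thesis using r by simp
  qed (use r z in simp)
  obtain \<nu> l where l: "l > 0" "c * g x \<nu> = 0" "g \<nu> \<nu> = 1" "\<And>w. f' x w = l * g \<nu> w"
    by (rule local_gradient[OF lf x xU]) blast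
  show ?thesis
  proof (cases "c = 0")
    case True
    then have "z = x" using r by simp
    have "k0 * (l * g V V) \<ge> 0"
      using k0_nonneg l(1) pos_def[OF xW, of V] True by (cases "V = 0") (auto simp: g_simps)
    then show ?thesis
      using hessian_bd[OF lf x xU l, of V] V \<open>z = x\<close> True by simp
  next
    case False
    define a where "a = c * g x V"
    define Y where "Y = V - a *\<^sub>R x"
    have VY: "V = Y + a *\<^sub>R x" by (simp add: Y_def)
    have Yt: "c * g x Y = 0" using M_norm'[OF xM False] False by (simp add: Y_def a_def g_simps)
    have fx: "f' x x = 0" using homogeneous_radial[OF L(1,3) xU] False by simp
    have "f' z (r *\<^sub>R V) = f' x V" using homogeneous_derivative[OF L(1,3) xU r(1) False] r(2) by simp
    then have "f' x V = 0" using V by (simp add: blinfun.scaleR_right)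
    then have Y0: "f' x Y = 0" using fx by (simp add: Y_def blinfun.diff_right blinfun.scaleR_right)
    have "f'' z V V = f'' x Y Y / r\<^sup>2"
      using homogeneous_hessian[OF L(1,3) xU r(1) False Y0, of a] r(2) VY by simp
    moreover have "g Y Y \<ge> 0" using pos_def[OF xW Yt] by (cases "Y = 0") (auto simp: g_simps)
    then have "f'' x Y Y \<ge> 0"
      using hessian_bd[OF lf x xU l Yt Y0] k0_nonneg l(1)
      by (smt (verit, best) mult_nonneg_nonneg)
    ultimately show ?thesis by simp
  qed
qed

text \<open>Slices of the boundary by planes are graphs of concave functions, hence the tangent lines
  of the boundary locally avoid the interior even where the curvature vanishes.\<close>

lemma tangent_line_outside:
  assumes lf: "local_fn f f' f'' U" and z: "z \<in> U" "z \<in> cone bd" and Y: "f' z Y = 0"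
  obtains \<delta> where "\<delta> > 0" "\<And>t. \<bar>t\<bar> < \<delta> \<Longrightarrow> z + t *\<^sub>R Y \<in> U \<and> f (z + t *\<^sub>R Y) \<ge> 0"
proof -
  note L = local_fnD[OF lf]
  obtain w where w: "f' z w > 0" using L(6)[OF z(1)] by blast
  have fz: "f z = 0" using L(8)[OF z(1)] z(2) by simp
  obtain \<epsilon> s s1 s2 where s: "\<epsilon> > 0" "s 0 = 0" "s1 0 = 0"
    "\<And>t. t \<in> {-\<epsilon><..<\<epsilon>} \<Longrightarrow> (s has_real_derivative s1 t) (at t)"
    "\<And>t. t \<in> {-\<epsilon><..<\<epsilon>} \<Longrightarrow> (s1 has_real_derivative s2 t) (at t)"
    "continuous_on {-\<epsilon><..<\<epsilon>} s2"
    "\<And>t. t \<in> {-\<epsilon><..<\<epsilon>} \<Longrightarrow> f (z + t *\<^sub>R Y + s t *\<^sub>R w) = 0"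
    "\<And>t \<sigma>. t \<in> {-\<epsilon><..<\<epsilon>} \<Longrightarrow> \<bar>\<sigma>\<bar> \<le> \<bar>s t\<bar> \<Longrightarrow>
       z + t *\<^sub>R Y + \<sigma> *\<^sub>R w \<in> U \<and> f' (z + t *\<^sub>R Y + \<sigma> *\<^sub>R w) w > 0"
    by (rule implicit_curve[OF L(1) z(1) fz Y w]) blast
  define \<beta> where "\<beta> t = z + t *\<^sub>R Y + s t *\<^sub>R w" for t
  define d1 where "d1 t = Y + s1 t *\<^sub>R w" for t
  have bU: "\<beta> t \<in> U" "f' (\<beta> t) w > 0" if "t \<in> {-\<epsilon><..<\<epsilon>}" for t
    using s(8)[OF that, of "s t"] by (simp_all add: \<beta>_def)
  have D1: "(\<beta> has_vector_derivative d1 t) (at t)" if "t \<in> {-\<epsilon><..<\<epsilon>}" for t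
    unfolding \<beta>_def d1_def using s(4)[OF that]
    by (auto intro!: derivative_eq_intros simp: has_real_derivative_iff_has_vector_derivative)
  have D2: "(d1 has_vector_derivative s2 t *\<^sub>R w) (at t)" if "t \<in> {-\<epsilon><..<\<epsilon>}" for t
    unfolding d1_def using s(5)[OF that]
    by (auto intro!: derivative_eq_intros simp: has_real_derivative_iff_has_vector_derivative)
  have F1: "((\<lambda>t. f (\<beta> t)) has_real_derivative f' (\<beta> t) (d1 t)) (at t)" if "t \<in> {-\<epsilon><..<\<epsilon>}" for t
    using C2_derivs_along(1)[where \<gamma>=\<beta> and ?d1.0=d1 and t=t, OF L(1) bU(1)[OF that] D1[OF that]] .
  have F2: "((\<lambda>t. f' (\<beta> t) (d1 t)) has_real_derivative f'' (\<beta> t) (d1 t) (d1 t) + f' (\<beta> t) (s2 t *\<^sub>R w)) (at t)"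
    if "t \<in> {-\<epsilon><..<\<epsilon>}" for t
    using C2_derivs_along(2)[where \<gamma>=\<beta> and ?d1.0=d1 and t=t, OF L(1) bU(1)[OF that] D1[OF that] D2[OF that]] .
  have z1: "f' (\<beta> t) (d1 t) = 0" if t: "t \<in> {-\<epsilon><..<\<epsilon>}" for t
  proof -
    have "((\<lambda>t. f (\<beta> t)) has_real_derivative 0) (at t)"
      by (rule has_field_derivative_transform_within_open[OF DERIV_const[of 0] open_greaterThanLessThan t])
        (use s(7) in \<open>simp add: \<beta>_def\<close>)
    with F1[OF t] show ?thesis using DERIV_unique by blast
  qed
  \<comment> \<open>The equation f''(\<beta>', \<beta>') + s'' f' w = 0 holds at every t, not only
    at 0, because the whole curve lies on the cone over the boundary. So s is concave.\<close>
  have s2: "s2 t \<le> 0" if t: "t \<in> {-\<epsilon><..<\<epsilon>}" for t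
  proof -
    have "((\<lambda>t. f' (\<beta> t) (d1 t)) has_real_derivative 0) (at t)"
      by (rule has_field_derivative_transform_within_open[OF DERIV_const[of 0] open_greaterThanLessThan t])
        (use z1 in simp)
    with F2[OF t] have "f'' (\<beta> t) (d1 t) (d1 t) + s2 t * f' (\<beta> t) w = 0"
      using DERIV_unique by (fastforce simp: blinfun.scaleR_right)
    moreover have "\<beta> t \<in> cone bd" using L(8)[OF bU(1)[OF t]] s(7)[OF t] by (simp add: \<beta>_def)
    then have "f'' (\<beta> t) (d1 t) (d1 t) \<ge> 0" using hessian_cone[OF lf bU(1)[OF t] _ z1[OF t]] by simp
    ultimately have "s2 t * f' (\<beta> t) w \<le> 0" by linarith
    then show ?thesis using bU(2)[OF t] by (simp add: mult_le_0_iff)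
  qed
  have s1: "s1 v \<le> s1 u" if "u \<le> v" "u \<in> {-\<epsilon><..<\<epsilon>}" "v \<in> {-\<epsilon><..<\<epsilon>}" for u v
  proof (rule DERIV_nonpos_imp_nonincreasing[OF that(1)])
    fix x assume "u \<le> x" "x \<le> v"
    then have "x \<in> {-\<epsilon><..<\<epsilon>}" using that by auto
    then show "\<exists>y. (s1 has_real_derivative y) (at x) \<and> y \<le> 0" using s(5) s2 by blast
  qed
  have sneg: "s t \<le> 0" if t: "t \<in> {-\<epsilon><..<\<epsilon>}" for t
  proof (cases "t \<ge> 0")
    case True
    have "s t \<le> s 0"
    proof (rule DERIV_nonpos_imp_nonincreasing[OF True])
      fix x assume "0 \<le> x" "x \<le> t"
      then have "x \<in> {-\<epsilon><..<\<epsilon>}" "s1 x \<le> 0" using t s1[of 0 x] s(1,3) by auto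
      then show "\<exists>y. (s has_real_derivative y) (at x) \<and> y \<le> 0" using s(4) by blast
    qed
    then show ?thesis using s(2) by simp
  next
    case False
    have "s t \<le> s 0"
    proof (rule DERIV_nonneg_imp_nondecreasing[of t 0 s])
      fix x assume "t \<le> x" "x \<le> 0"
      then have "x \<in> {-\<epsilon><..<\<epsilon>}" "s1 x \<ge> 0" using t s1[of x 0] s(1,3) by auto
      then show "\<exists>y. (s has_real_derivative y) (at x) \<and> y \<ge> 0" using s(4) by blast
    qed (use False in simp)
    then show ?thesis using s(2) by simp
  qed
  show thesis
  proof (rule that[OF s(1)])
    fix t assume "\<bar>t\<bar> < \<epsilon>"
    then have t: "t \<in> {-\<epsilon><..<\<epsilon>}" by auto
    \<comment> \<open>f vanishes on the curve and increases along w from there up to the tangent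
      line, because s t \<le> 0.\<close>
    have "f (z + t *\<^sub>R Y + s t *\<^sub>R w) \<le> f (z + t *\<^sub>R Y + 0 *\<^sub>R w)"
    proof (rule DERIV_nonneg_imp_nondecreasing[OF sneg[OF t]])
      fix \<sigma> assume "s t \<le> \<sigma>" "\<sigma> \<le> 0"
      then have "\<bar>\<sigma>\<bar> \<le> \<bar>s t\<bar>" by simp
      note * = s(8)[OF t this]
      have "((\<lambda>\<sigma>. z + t *\<^sub>R Y + \<sigma> *\<^sub>R w) has_vector_derivative w) (at \<sigma>)"
        by (auto intro!: derivative_eq_intros)
      from C2_derivs_along(1)[OF L(1) _ this] *
      have "((\<lambda>\<sigma>. f (z + t *\<^sub>R Y + \<sigma> *\<^sub>R w)) has_real_derivative f' (z + t *\<^sub>R Y + \<sigma> *\<^sub>R w) w) (at \<sigma>)"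
        by blast
      then show "\<exists>y. ((\<lambda>\<sigma>. f (z + t *\<^sub>R Y + \<sigma> *\<^sub>R w)) has_real_derivative y) (at \<sigma>) \<and> y \<ge> 0"
        using * less_imp_le by blast
    qed
    then show "z + t *\<^sub>R Y \<in> U \<and> f (z + t *\<^sub>R Y) \<ge> 0" using s(7)[OF t] s(8)[OF t, of 0] by simp
  qed
qed

text \<open>At the first boundary point f restricted to the segment has a local maximum, so the
  segment is tangent there. Tangent lines locally avoid the interior, so slightly earlier points
  would already be outside it.\<close>

lemma segment_avoids_bd:
  assumes a: "a \<in> cone inn" and b: "b \<in> cone inn" and seg: "closed_segment a b \<subseteq> cone \<Omega>"
  shows "closed_segment a b \<subseteq> cone inn"
proof (rule ccontr)
  assume "\<not> closed_segment a b \<subseteq> cone inn"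
  define z where "z t = a + t *\<^sub>R (b - a)" for t
  have zseg: "closed_segment a b = z ` {0..1}"
    unfolding closed_segment_image_interval by (simp add: z_def algebra_simps)
  define T where "T = {t \<in> {0..1}. z t \<notin> cone inn}"
  have cz: "continuous_on A z" for A unfolding z_def by (intro continuous_intros)
  have "T = {0..1} - z -` cone inn" by (auto simp: T_def)
  moreover have "open (z -` cone inn)" using continuous_on_open_vimage[of UNIV z] cz open_cone_inn by auto
  ultimately have "compact T" by (simp add: compact_diff)
  moreover have "T \<noteq> {}" using \<open>\<not> closed_segment a b \<subseteq> cone inn\<close> zseg by (auto simp: T_def)
  ultimately obtain t0 where t0: "t0 \<in> T" "\<And>t. t \<in> T \<Longrightarrow> t0 \<le> t" using compact_attains_inf by metis
  have "t0 \<noteq> 0" "t0 \<noteq> 1" using t0(1) a b by (auto simp: T_def z_def)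
  then have t01: "0 < t0" "t0 < 1" using t0(1) by (auto simp: T_def)
  have zO: "z t \<in> cone \<Omega>" if "t \<in> {0..1}" for t using seg zseg that by blast
  have zb: "z t0 \<in> cone bd" using t0(1) zO[of t0] cone_Omega(1) by (auto simp: T_def)
  then have pb: "prj (z t0) \<in> bd" by (simp add: cone_def)
  obtain f f' f'' U where lf: "local_fn f f' f'' U" and PU: "prj (z t0) \<in> U"
    using local_fn_exists[OF pb] by metis
  note L = local_fnD[OF lf]
  obtain r where r: "r > 0" "z t0 = r *\<^sub>R prj (z t0)" "c = 0 \<Longrightarrow> r = 1"
    by (rule prj_cases[of "z t0"]) (use zb cone_subset_W in auto)
  have zU: "z t0 \<in> U"
    using homogeneousD(1)[OF L(3) PU r(1)] r PU by (cases "c = 0") auto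
  obtain \<delta>1 where \<delta>1: "\<delta>1 > 0" "\<And>\<tau>. \<bar>\<tau>\<bar> < \<delta>1 \<Longrightarrow> z (t0 + \<tau>) \<in> U"
    using curve_stays_in_open[of "\<lambda>\<tau>. z (t0 + \<tau>)" U] zU L(4) unfolding z_def by auto
  have d: "(z has_vector_derivative (b - a)) (at t0)" unfolding z_def by (auto intro!: derivative_eq_intros)
  have "f' (z t0) (b - a) = 0"
  proof (rule DERIV_local_max[OF C2_derivs_along(1)[OF L(1) zU d]])
    show "0 < min \<delta>1 (min t0 (1 - t0))" using \<delta>1 t01 by simp
    show "\<forall>t. \<bar>t0 - t\<bar> < min \<delta>1 (min t0 (1 - t0)) \<longrightarrow> f (z t) \<le> f (z t0)"
    proof (intro allI impI)
      fix t assume t: "\<bar>t0 - t\<bar> < min \<delta>1 (min t0 (1 - t0))"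
      have "z t \<in> U" using \<delta>1(2)[of "t - t0"] t by auto
      moreover have "z t \<in> cone \<Omega>" using t by (intro zO) auto
      ultimately show "f (z t) \<le> f (z t0)" using L(8)[OF zU] L(9) zb by auto
    qed
  qed
  then obtain \<delta>2 where \<delta>2: "\<delta>2 > 0"
    "\<And>t. \<bar>t\<bar> < \<delta>2 \<Longrightarrow> z t0 + t *\<^sub>R (b - a) \<in> U \<and> f (z t0 + t *\<^sub>R (b - a)) \<ge> 0"
    by (rule tangent_line_outside[OF lf zU zb]) blast
  define t where "t = min \<delta>2 t0 / 2"
  have t: "0 < t" "t < \<delta>2" "t < t0" using \<delta>2(1) t01 by (auto simp: t_def)
  have "z t0 + (- t) *\<^sub>R (b - a) = z (t0 - t)" by (simp add: z_def algebra_simps)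
  then have "z (t0 - t) \<in> U" "f (z (t0 - t)) \<ge> 0" using \<delta>2(2)[of "- t"] t by auto
  then have "z (t0 - t) \<notin> cone inn" using L(7) by fastforce
  then have "t0 - t \<in> T" using t t01 by (auto simp: T_def)
  then show False using t0(2) t(1) by force
qed

end

lemma exists_not_in_span_pair:
  fixes a b :: "'e::euclidean_space"
  assumes "DIM('e) \<ge> 3"
  obtains e where "e \<notin> span {a, b}"
proof -
  have "dim {a, b} \<le> card {a, b}" by (rule dim_le_card') simp
  also have "\<dots> \<le> 2" by (simp add: card_insert_if)
  finally have "dim (span {a, b}) \<noteq> DIM('e)" using assms by simp
  then have "span {a, b} \<noteq> UNIV" by (metis dim_UNIV)
  then show thesis using that by blast
qed

lemma segment_through_0:
  fixes a y :: "'e::real_vector"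
  assumes "0 \<in> closed_segment a y" "y \<noteq> 0" "a \<noteq> 0"
  obtains s where "y = s *\<^sub>R a" "s \<le> 0"
proof -
  obtain t where t: "0 \<le> t" "t \<le> 1" "0 = (1 - t) *\<^sub>R a + t *\<^sub>R y"
    using assms(1) by (auto simp: closed_segment_def)
  show thesis
  proof (cases "t = 0")
    case True
    then show ?thesis using t assms(3) by simp
  next
    case False
    then have "y = inverse t *\<^sub>R (t *\<^sub>R y)" by simp
    also have "t *\<^sub>R y = - ((1 - t) *\<^sub>R a)" using t(3) by (simp add: eq_neg_iff_add_eq_0 add.commute)
    finally have "y = (- (inverse t * (1 - t))) *\<^sub>R a" by simp
    moreover have "- (inverse t * (1 - t)) \<le> 0" using t by simp
    ultimately show ?thesis using that by blast
  qed
qed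

context curved_domain
begin

text \<open>The set V of interior points visible from a is open, and closed among the interior
  points whose segment to a stays in W. If W is convex, connectedness finishes. On the sphere the
  only exceptions are points on the ray opposite to a. If an interior point q on that ray is a limit
  of V, then all points near q off the line through a are visible, and the segments to them sweep
  out, up to scaling, everything off that line. The interior is then the whole sphere and the claim
  is immediate.\<close>

lemma segments_in_inn:
  assumes a: "a \<in> cone inn" and b: "b \<in> cone inn" and abW: "closed_segment a b \<subseteq> W"
  shows "closed_segment a b \<subseteq> cone inn"
proof -
  define G where "G = cone inn"
  define V where "V = {y \<in> G. closed_segment a y \<subseteq> G}"
  have oG: "open G" by (simp add: G_def open_cone_inn)
  have GW: "G \<subseteq> W" by (simp add: G_def cone_subset_W)
  have openV: "open V"
    using open_Int[OF oG open_segments_into[OF oG, of a]] by (simp add: V_def Int_def)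
  have aV: "a \<in> V" using a by (simp add: V_def G_def)
  have closedV: "y \<in> V" if y: "y \<in> closure V" "y \<in> G" "closed_segment a y \<subseteq> W" for y
  proof -
    have "closed_segment a y \<subseteq> closure G"
    proof
      fix z assume "z \<in> closed_segment a y"
      then obtain t where t: "0 \<le> t" "t \<le> 1" "z = (1 - t) *\<^sub>R a + t *\<^sub>R y"
        by (auto simp: closed_segment_def)
      define p where "p v = (1 - t) *\<^sub>R a + t *\<^sub>R v" for v
      have "p v \<in> G" if "v \<in> V" for v
      proof -
        have "p v \<in> closed_segment a v" using t by (auto simp: p_def closed_segment_def)
        then show ?thesis using that by (auto simp: V_def)
      qed
      then have "p ` V \<subseteq> closure G" using closure_subset by blast
      moreover have "continuous_on (closure V) p" unfolding p_def by (intro continuous_intros)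
      ultimately have "p ` closure V \<subseteq> closure G"
        using image_closure_subset[of V p "closure G"] by simp
      then show "z \<in> closure G" using y(1) t(3) by (auto simp: p_def)
    qed
    then have "closed_segment a y \<subseteq> cone \<Omega>" using y(3) closure_inn by (auto simp: G_def)
    then have "closed_segment a y \<subseteq> cone inn"
      using segment_avoids_bd[OF a] y(2) by (simp add: G_def)
    then show ?thesis using y(2) by (simp add: V_def G_def)
  qed
  have step: "K \<subseteq> V" if K: "connected K" "K \<subseteq> G" "\<And>y. y \<in> K \<Longrightarrow> closed_segment a y \<subseteq> W" "K \<inter> V \<noteq> {}" for K
  proof -
    have *: "K \<subseteq> V \<union> (- closure V)" using closedV K(2,3) by blast
    have "V \<inter> K = {} \<or> (- closure V) \<inter> K = {}"
      by (rule connectedD[OF K(1) openV]) (use * closure_subset in auto)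
    then show ?thesis using * K(4) by blast
  qed
  show ?thesis
  proof (cases "convex W")
    case True
    have "G \<subseteq> V"
    proof (rule step)
      show "connected G" by (simp add: G_def connected_cone_inn)
      show "closed_segment a y \<subseteq> W" if "y \<in> G" for y
        using True that GW a by (intro closed_segment_subset) (auto simp: G_def)
      show "G \<inter> V \<noteq> {}" using aV by (auto simp: V_def)
    qed simp
    then show ?thesis using b by (auto simp: V_def G_def)
  next
    case False
    then have c: "c > 0" and W: "W = - {0}" using segments_W by auto
    have dim3: "DIM('a) \<ge> 3" using dim c by simp
    have a0: "a \<noteq> 0" using a W cone_subset_W by auto
    have segW: "closed_segment a y \<subseteq> W" if "\<And>s. y \<noteq> s *\<^sub>R a" for y
      using segment_through_0[of a y] that[of 0] that W a0 by auto
    show ?thesis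
    proof (cases "G \<subseteq> V")
      case True
      then show ?thesis using b by (auto simp: V_def G_def)
    next
      case nsub: False
      have "\<exists>q\<in>G. q \<in> closure V \<and> q \<notin> V"
      proof (rule ccontr)
        assume "\<not> ?thesis"
        then have *: "G \<subseteq> V \<union> (- closure V)" by blast
        have "V \<inter> G = {} \<or> (- closure V) \<inter> G = {}"
          by (rule connectedD[OF _ openV]) (use * closure_subset connected_cone_inn in \<open>auto simp: G_def\<close>)
        then show False using * nsub aV by (auto simp: V_def)
      qed
      then obtain q where q: "q \<in> G" "q \<in> closure V" "q \<notin> V" by blast
      then have "\<not> closed_segment a q \<subseteq> W" using closedV by blast
      then have "0 \<in> closed_segment a q" using W by auto
      moreover have "q \<noteq> 0" using q(1) GW W by auto
      ultimately obtain s where s: "q = s *\<^sub>R a" "s \<le> 0" by (rule segment_through_0[OF _ _ a0])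
      have s0: "s < 0" using s \<open>q \<noteq> 0\<close> by (cases "s = 0") auto
      obtain \<epsilon>1 where \<epsilon>1: "\<epsilon>1 > 0" "ball q \<epsilon>1 \<subseteq> G" using oG q(1) open_contains_ball_eq by blast
      \<comment> \<open>The bound by \<open>norm q\<close> keeps 0 and all positive multiples of a
        out of the ball, since q is a negative multiple of a.\<close>
      define \<epsilon> where "\<epsilon> = min \<epsilon>1 (norm q)"
      have \<epsilon>: "\<epsilon> > 0" "ball q \<epsilon> \<subseteq> G" "\<epsilon> \<le> norm q" using \<epsilon>1 \<open>q \<noteq> 0\<close> by (auto simp: \<epsilon>_def)
      obtain v where v: "v \<in> V" "v \<in> ball q \<epsilon>"
        using q(2) \<epsilon>(1) by (metis closure_approachable dist_commute mem_ball)
      have v_line: "v \<noteq> x *\<^sub>R a" for x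
      proof
        assume x: "v = x *\<^sub>R a"
        have "x < 0"
        proof (rule ccontr)
          assume "\<not> x < 0"
          then have "norm (q - v) = norm q + x * norm a"
            using s(1) s0 x by (simp add: algebra_simps flip: scaleR_left_diff_distrib)
          then show False using v(2) \<epsilon>(3) \<open>\<not> x < 0\<close> by (simp add: dist_norm not_less)
             (smt (verit) mult_nonneg_nonneg norm_ge_zero)
        qed
        have "closed_segment a v \<subseteq> W" using v(1) GW by (auto simp: V_def)
        moreover have "0 \<in> closed_segment a v"
          unfolding closed_segment_def
        proof (intro CollectI exI conjI)
          \<comment> \<open>The parameter t = 1 / (1 - x) solves (1 - t) + t x = 0, so this is where
            the segment meets 0.\<close>
          have "1 - inverse (1 - x) + inverse (1 - x) * x = 1 - inverse (1 - x) * (1 - x)"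
            by (simp add: algebra_simps)
          then have "1 - inverse (1 - x) + inverse (1 - x) * x = 0" using \<open>x < 0\<close> by simp
          moreover have "(1 - inverse (1 - x)) *\<^sub>R a + inverse (1 - x) *\<^sub>R v =
             (1 - inverse (1 - x) + inverse (1 - x) * x) *\<^sub>R a" by (simp add: x scaleR_left_distrib)
          ultimately show "0 = (1 - inverse (1 - x)) *\<^sub>R a + inverse (1 - x) *\<^sub>R v" by simp
          show "0 \<le> inverse (1 - x)" "inverse (1 - x) \<le> 1" using \<open>x < 0\<close> by (auto simp: field_simps)
        qed
        ultimately show False using W by blast
      qed
      \<comment> \<open>The ball without the line through a is connected, as the dimension is at
        least 3. If the segment from v to w meets the line, then w lies in the plane of a and v, and
        a detour through a point p near q outside that plane avoids the line.\<close>
      have in_V: "w \<in> V" if w: "w \<in> ball q \<epsilon>" "\<And>x. w \<noteq> x *\<^sub>R a" for w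
      proof -
        have conn: "z2 \<in> V" if "z1 \<in> V" "z1 \<in> ball q \<epsilon>" "z2 \<in> ball q \<epsilon>"
          "\<And>y x. y \<in> closed_segment z1 z2 \<Longrightarrow> y \<noteq> x *\<^sub>R a" for z1 z2
        proof -
          have "closed_segment z1 z2 \<subseteq> V"
          proof (rule step)
            show "closed_segment z1 z2 \<subseteq> G"
              using closed_segment_subset[OF that(2,3) convex_ball] \<epsilon>(2) by blast
            show "closed_segment a y \<subseteq> W" if "y \<in> closed_segment z1 z2" for y
              by (rule segW) (use \<open>\<And>y x. y \<in> closed_segment z1 z2 \<Longrightarrow> y \<noteq> x *\<^sub>R a\<close> that in blast)
          qed (use that(1) in auto)
          then show ?thesis by auto
        qed
        show ?thesis
        proof (cases "\<exists>y\<in>closed_segment v w. \<exists>x. y = x *\<^sub>R a")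
          case False
          then show ?thesis using conn[of v w] v w(1) by blast
        next
          case True
          then obtain y x where y: "y \<in> closed_segment v w" "y = x *\<^sub>R a" by blast
          then obtain t where t: "(1 - t) *\<^sub>R v + t *\<^sub>R w = x *\<^sub>R a" "0 \<le> t" "t \<le> 1"
            unfolding closed_segment_def by force
          have "t \<noteq> 0" using t(1) v_line by (cases "t = 0") auto
          have "w = inverse t *\<^sub>R (t *\<^sub>R w)" using \<open>t \<noteq> 0\<close> by simp
          also have "t *\<^sub>R w = x *\<^sub>R a - (1 - t) *\<^sub>R v" using t(1) by (simp add: algebra_simps)
          finally have w_span: "w \<in> span {a, v}"
            by (simp add: span_base span_scale span_diff)
          have v_span: "v \<in> span {a, v}" and q_span: "q \<in> span {a, v}"
            by (simp_all add: span_base span_scale s(1))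
          have a_span: "x *\<^sub>R a \<in> span {a, v}" for x by (simp add: span_base span_scale)
          obtain e where e: "e \<notin> span {a, v}" using exists_not_in_span_pair[OF dim3] .
          then have "e \<noteq> 0" using span_zero by blast
          define \<delta> where "\<delta> = \<epsilon> / (2 * norm e)"
          have \<delta>: "\<delta> > 0" using \<epsilon> \<open>e \<noteq> 0\<close> by (simp add: \<delta>_def)
          define p where "p = q + \<delta> *\<^sub>R e"
          have pb: "p \<in> ball q \<epsilon>" using \<epsilon> \<open>e \<noteq> 0\<close> by (simp add: p_def \<delta>_def dist_norm)
          have off: "(1 - u) *\<^sub>R y + u *\<^sub>R p \<noteq> x *\<^sub>R a"
            if y: "y \<in> span {a, v}" "\<And>x. y \<noteq> x *\<^sub>R a" for y u x
          proof
            assume eq: "(1 - u) *\<^sub>R y + u *\<^sub>R p = x *\<^sub>R a"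
            then have "u *\<^sub>R (\<delta> *\<^sub>R e) = x *\<^sub>R a - (1 - u) *\<^sub>R y - u *\<^sub>R q"
              by (simp add: p_def algebra_simps)
            then have "(u * \<delta>) *\<^sub>R e \<in> span {a, v}"
              using y(1) q_span a_span by (simp add: span_diff span_scale)
            then have k: "(u * \<delta>) *\<^sub>R e \<in> span {a, v}" .
            have "u = 0"
            proof (rule ccontr)
              assume "u \<noteq> 0"
              define k where "k = u * \<delta>"
              have "k \<noteq> 0" using \<open>u \<noteq> 0\<close> \<delta> by (simp add: k_def)
              moreover have "inverse k *\<^sub>R (k *\<^sub>R e) \<in> span {a, v}"
                using k unfolding k_def by (rule span_scale)
              ultimately show False using e by simp
            qed
            then show False using eq y(2) by simp
          qed
          have "p \<in> V"
            by (rule conn[OF v pb]) (use off[OF v_span v_line] in \<open>auto simp: closed_segment_def\<close>)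
          then show ?thesis
          proof (rule conn[OF _ pb w(1)])
            fix y x assume "y \<in> closed_segment p w"
            then have "y \<in> closed_segment w p" by (metis closed_segment_commute)
            then show "y \<noteq> x *\<^sub>R a" using off[OF w_span w(2)] by (auto simp: closed_segment_def)
          qed
        qed
      qed
      \<comment> \<open>As q lies on the opposite ray, the segment from a to q + \<delta> z contains
        a positive multiple of z: at a suitable parameter the contributions of a and q
        cancel.\<close>
      have off_line: "z \<in> G" if z: "\<And>x. z \<noteq> x *\<^sub>R a" for z
      proof -
        have "z \<noteq> 0" using z[of 0] by simp
        define \<delta> where "\<delta> = \<epsilon> / (2 * norm z)"
        have \<delta>: "\<delta> > 0" using \<epsilon> \<open>z \<noteq> 0\<close> by (simp add: \<delta>_def)
        have "q + \<delta> *\<^sub>R z \<in> V"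
        proof (rule in_V)
          show "q + \<delta> *\<^sub>R z \<in> ball q \<epsilon>" using \<epsilon> \<open>z \<noteq> 0\<close> by (simp add: \<delta>_def dist_norm)
          show "q + \<delta> *\<^sub>R z \<noteq> x *\<^sub>R a" for x
          proof
            assume "q + \<delta> *\<^sub>R z = x *\<^sub>R a"
            then have "\<delta> *\<^sub>R z = (x - s) *\<^sub>R a" using s(1) by (simp add: algebra_simps)
            then have "inverse \<delta> *\<^sub>R (\<delta> *\<^sub>R z) = (inverse \<delta> * (x - s)) *\<^sub>R a" by simp
            then show False using z \<delta> by simp
          qed
        qed
        then have sub: "closed_segment a (q + \<delta> *\<^sub>R z) \<subseteq> G" by (simp add: V_def)
        define t where "t = inverse (1 - s)"
        have t: "0 < t" "t \<le> 1" "1 - t + t * s = 0" using s0 by (auto simp: t_def field_simps)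
        have "(1 - t) *\<^sub>R a + t *\<^sub>R (q + \<delta> *\<^sub>R z) = (1 - t + t * s) *\<^sub>R a + (t * \<delta>) *\<^sub>R z"
          by (simp add: s(1) algebra_simps)
        also have "\<dots> = (t * \<delta>) *\<^sub>R z" using t(3) by simp
        finally have "(t * \<delta>) *\<^sub>R z \<in> closed_segment a (q + \<delta> *\<^sub>R z)"
          using t by (auto simp: closed_segment_def intro!: exI[of _ t])
        then have "(t * \<delta>) *\<^sub>R z \<in> G" using sub by blast
        moreover have "z \<in> G" if "k *\<^sub>R z \<in> G" "k > 0" for k
        proof -
          have "inverse k *\<^sub>R (k *\<^sub>R z) \<in> G"
            unfolding G_def by (rule cone_scale) (use that c in \<open>auto simp: G_def\<close>)
          then show ?thesis using that(2) by simp
        qed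
        ultimately show ?thesis using t(1) \<delta> by simp
      qed
      have "z \<in> G" if z: "z \<in> W" for z
      proof (cases "\<exists>x. z = x *\<^sub>R a")
        case True
        then obtain x where x: "z = x *\<^sub>R a" by blast
        then have "x \<noteq> 0" using z W by auto
        show ?thesis
        proof (cases "x > 0")
          case True
          then show ?thesis using x a c cone_scale[of x a inn] by (simp add: G_def)
        next
          case False
          then have "(x / s) *\<^sub>R q \<in> G"
            unfolding G_def using s0 \<open>x \<noteq> 0\<close> c q(1) by (intro cone_scale) (auto simp: G_def divide_neg_neg)
          then show ?thesis using s0 by (simp add: s(1) x)
        qed
      qed (use off_line in blast)
      then show ?thesis using abW by (auto simp: G_def)
    qed
  qed
qed

text \<open>P is a limit of interior points whose segments to R stay in W. Those segments are
  interior, and they converge to the one ending at P.\<close>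

lemma segment_to_bd:
  assumes R: "R \<in> cone inn" and P: "P \<in> bd" and seg: "closed_segment R P \<subseteq> W"
  shows "closed_segment R P \<subseteq> cone \<Omega>"
proof
  fix z assume z: "z \<in> closed_segment R P"
  then obtain t where t: "0 \<le> t" "t \<le> 1" "z = (1 - t) *\<^sub>R R + t *\<^sub>R P"
    by (auto simp: closed_segment_def)
  show "z \<in> cone \<Omega>"
  proof (rule closure_inn)
    show "z \<in> W" using seg z by blast
    define p where "p v = (1 - t) *\<^sub>R R + t *\<^sub>R v" for v
    define Y where "Y = inn \<inter> {y. closed_segment R y \<subseteq> W}"
    have "P \<in> {y. closed_segment R y \<subseteq> W} \<inter> closure inn"
      using seg P bd_eq Omega_closure by auto
    then have "P \<in> closure Y"
      using open_Int_closure_subset[OF open_segments_into[OF open_W, of R], of inn]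
      by (auto simp: Y_def Int_commute)
    moreover have "p v \<in> cone inn" if v: "v \<in> Y" for v
    proof -
      have "v \<in> cone inn" using v cone_M_iff inn_M by (auto simp: Y_def)
      then have "closed_segment R v \<subseteq> cone inn" using v R by (intro segments_in_inn) (auto simp: Y_def)
      moreover have "p v \<in> closed_segment R v" using t by (auto simp: p_def closed_segment_def)
      ultimately show ?thesis by blast
    qed
    then have "p ` Y \<subseteq> closure (cone inn)" using closure_subset by blast
    moreover have "continuous_on (closure Y) p" unfolding p_def by (intro continuous_intros)
    ultimately show "z \<in> closure (cone inn)"
      using image_closure_subset[of Y p "closure (cone inn)"] t(3) by (auto simp: p_def)
  qed
qed

text \<open>Convexity only gives f' P (R - P) \<le> 0. Applied to R = Q + \<delta> w, still in the
  cone over the interior, it leaves the surplus \<delta> f' P w, which makes the inequality at Q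
  strict. If R is opposite to P, homogeneity gives f' P (R - P) = 0.\<close>

lemma strict_support:
  assumes lf: "local_fn f f' f'' U" and P: "P \<in> bd" "P \<in> U" and Q: "Q \<in> inn"
  shows "f' P (Q - P) < 0"
proof -
  note L = local_fnD[OF lf]
  have PM: "P \<in> M" and PW: "P \<in> W" using P bd_M M_subset_W by auto
  have fP: "f P = 0" using L(8)[OF P(2)] cone_M_iff[OF PM] P(1) by simp
  obtain w where w: "f' P w > 0" using L(6)[OF P(2)] by blast
  have Qc: "Q \<in> cone inn" using Q cone_M_iff inn_M by auto
  obtain \<delta>0 where \<delta>0: "\<delta>0 > 0" "\<And>t. \<bar>t\<bar> < \<delta>0 \<Longrightarrow> Q + t *\<^sub>R w \<in> cone inn"
    using curve_stays_in_open[of "\<lambda>t. Q + t *\<^sub>R w" "cone inn"] Qc open_cone_inn by auto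
  define \<delta> where "\<delta> = \<delta>0 / 2"
  define R where "R = Q + \<delta> *\<^sub>R w"
  have \<delta>: "\<delta> > 0" "R \<in> cone inn" using \<delta>0 by (auto simp: \<delta>_def R_def)
  have RQ: "f' P (Q - P) = f' P (R - P) - \<delta> * f' P w"
    by (simp add: R_def blinfun.bilinear_simps)
  have "f' P (R - P) \<le> 0"
  proof (cases "closed_segment R P \<subseteq> W")
    case True
    have in_Omega: "P + t *\<^sub>R (R - P) \<in> cone \<Omega>" if t: "0 \<le> t" "t \<le> 1" for t
    proof -
      have "P + t *\<^sub>R (R - P) \<in> closed_segment R P"
        using t by (auto simp: closed_segment_def algebra_simps intro!: exI[of _ "1 - t"])
      then show ?thesis using segment_to_bd[OF \<delta>(2) P(1) True] by blast
    qed
    show ?thesis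
    proof (rule ccontr)
      assume "\<not> f' P (R - P) \<le> 0"
      then have pos: "f' P (R - P) > 0" by simp
      have d: "((\<lambda>t. P + t *\<^sub>R (R - P)) has_vector_derivative (R - P)) (at 0)"
        by (auto intro!: derivative_eq_intros)
      have df: "((\<lambda>t. f (P + t *\<^sub>R (R - P))) has_real_derivative f' P (R - P)) (at 0)"
        using C2_derivs_along(1)[OF L(1) _ d] P(2) by simp
      obtain e where e: "e > 0" "\<And>h. h > 0 \<Longrightarrow> h < e \<Longrightarrow> f (P + h *\<^sub>R (R - P)) > 0"
        using DERIV_pos_inc_right[OF df pos] fP by auto
      obtain \<delta>1 where \<delta>1: "\<delta>1 > 0" "\<And>t. \<bar>t\<bar> < \<delta>1 \<Longrightarrow> P + t *\<^sub>R (R - P) \<in> U"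
        using curve_stays_in_open[of "\<lambda>t. P + t *\<^sub>R (R - P)" U] P(2) L(4) by auto
      define t where "t = Min {1, e, \<delta>1} / 2"
      have t: "0 < t" "t < 1" "t < e" "\<bar>t\<bar> < \<delta>1" using e(1) \<delta>1(1) by (auto simp: t_def)
      have "f (P + t *\<^sub>R (R - P)) \<le> 0" using L(9)[OF \<delta>1(2)[OF t(4)]] in_Omega[of t] t by simp
      then show False using e(2)[of t] t by simp
    qed
  next
    case False
    have "\<not> convex W" using closed_segment_subset[of R W P] False \<delta>(2) cone_subset_W PW by auto
    then have c: "c > 0" and W: "W = - {0}" using segments_W by auto
    have "0 \<in> closed_segment P R" using False W by (auto simp: closed_segment_commute[of P R])
    moreover have "R \<noteq> 0" using \<delta>(2) cone_subset_W W by auto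
    ultimately obtain s where "R = s *\<^sub>R P" by (rule segment_through_0) (use PW W in auto)
    moreover have "f' P P = 0" using homogeneous_radial[OF L(1,3) P(2)] c by simp
    ultimately show ?thesis by (simp add: blinfun.bilinear_simps)
  qed
  moreover have "\<delta> * f' P w > 0" using \<delta>(1) w by simp
  ultimately show ?thesis using RQ by linarith
qed

end

section \<open>The touching ball\<close>

context space_form
begin

text \<open>Inversion turns the line A + t u into a circle through the origin; these are the
  velocity and acceleration of that circle.\<close>

lemma inversion_derivatives:
  assumes D: "g (A + t *\<^sub>R u) (A + t *\<^sub>R u) \<noteq> 0"
  defines "L \<equiv> \<lambda>t. A + t *\<^sub>R u"
  defines "D \<equiv> \<lambda>t. g (L t) (L t)"
  defines "d1 \<equiv> \<lambda>t. (1 / D t) *\<^sub>R u - (2 * g (L t) u / (D t)\<^sup>2) *\<^sub>R L t"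
  shows "((\<lambda>t. (1 / D t) *\<^sub>R L t) has_vector_derivative d1 t) (at t)"
    "(d1 has_vector_derivative (8 * (g (L t) u)\<^sup>2 / (D t)^3 - 2 * g u u / (D t)\<^sup>2) *\<^sub>R L t -
       (4 * g (L t) u / (D t)\<^sup>2) *\<^sub>R u) (at t)"
proof -
  have Dt: "D t \<noteq> 0" using D by (simp add: D_def L_def)
  have L: "(L has_vector_derivative u) (at t)" unfolding L_def by (auto intro!: derivative_eq_intros)
  have gLu: "((\<lambda>t. g (L t) u) has_real_derivative g u u) (at t)"
    using g.has_vector_derivative[OF L has_vector_derivative_const[of u]]
    by (simp add: has_real_derivative_iff_has_vector_derivative g_simps)
  have dD: "(D has_real_derivative 2 * g (L t) u) (at t)"
    using g.has_vector_derivative[OF L L] unfolding D_def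
    by (simp add: has_real_derivative_iff_has_vector_derivative sym)
  have h: "((\<lambda>t. 1 / D t) has_real_derivative - (2 * g (L t) u / (D t)\<^sup>2)) (at t)"
    using dD Dt by (auto intro!: derivative_eq_intros simp: power2_eq_square)
  have k: "((\<lambda>t. - (2 * g (L t) u / (D t)\<^sup>2)) has_real_derivative
      8 * (g (L t) u)\<^sup>2 / (D t)^3 - 2 * g u u / (D t)\<^sup>2) (at t)"
    using dD gLu Dt
    by (auto intro!: derivative_eq_intros simp: power2_eq_square power3_eq_cube field_simps)
  have e: "d1 = (\<lambda>t. (1 / D t) *\<^sub>R u + (- (2 * g (L t) u / (D t)\<^sup>2)) *\<^sub>R L t)"
    by (simp add: d1_def fun_eq_iff)
  show "((\<lambda>t. (1 / D t) *\<^sub>R L t) has_vector_derivative d1 t) (at t)"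
    using has_vector_derivative_scaleR[OF h L] by (simp add: e)
  show "(d1 has_vector_derivative (8 * (g (L t) u)\<^sup>2 / (D t)^3 - 2 * g u u / (D t)\<^sup>2) *\<^sub>R L t -
       (4 * g (L t) u / (D t)\<^sup>2) *\<^sub>R u) (at t)"
    unfolding e
    using has_vector_derivative_add[OF has_vector_derivative_scaleR[OF h has_vector_derivative_const[of u]]
        has_vector_derivative_scaleR[OF k L]]
    by (simp add: algebra_simps)
       (simp flip: scaleR_left_distrib)
qed

text \<open>\<open>g\<close> is positive definite only on the tangent space at P, and the usual
  vector z = g(y, y) x - g(x, y) y stays in it.\<close>

lemma cauchy_schwarz_tangent:
  assumes P: "P \<in> W" and x: "c * g P x = 0" and y: "c * g P y = 0"
  shows "(g x y)\<^sup>2 \<le> g x x * g y y"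
proof (cases "y = 0")
  case False
  have yy: "g y y > 0" using pos_def[OF P y False] .
  define z where "z = g y y *\<^sub>R x - g x y *\<^sub>R y"
  have "c * g P z = g y y * (c * g P x) - g x y * (c * g P y)"
    by (simp add: z_def g_simps algebra_simps)
  then have "c * g P z = 0" unfolding x y by simp
  then have "g z z \<ge> 0" using pos_def[OF P, of z] by (cases "z = 0") (auto simp: g_simps)
  moreover have "g z z = g y y * (g x x * g y y - (g x y)\<^sup>2)"
    using sym[of y x] by (simp add: z_def g_simps algebra_simps power2_eq_square)
  ultimately show ?thesis using yy by (simp add: zero_le_mult_iff)
qed (simp add: g_simps)

lemma norm_nonneg_tangent: "P \<in> W \<Longrightarrow> c * g P x = 0 \<Longrightarrow> g x x \<ge> 0"
  using pos_def[of P x] by (cases "x = 0") (auto simp: g_simps)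

text \<open>Reflection in the direction \<open>L\<close> carries the normal geometry at \<open>P + L / g L L\<close>
  back to \<open>P\<close>.\<close>

lemma circle_curvature_bound:
  assumes P: "P \<in> M" and u: "c * g P u = 0" and xi: "c * g P \<xi> = 0"
    and L: "L = \<xi> + t *\<^sub>R u - (c / 2) *\<^sub>R P" and D: "D = g L L" "D > 0"
    and nu: "g \<nu> \<nu> = 1" "c * g (P + (1 / D) *\<^sub>R L) \<nu> = 0" "g \<nu> ((1 / D) *\<^sub>R u - (2 * g L u / D\<^sup>2) *\<^sub>R L) = 0"
  shows "(g L \<nu>)\<^sup>2 \<le> g (\<xi> - \<tau> *\<^sub>R u) (\<xi> - \<tau> *\<^sub>R u)"
proof -
  have PW: "P \<in> W" using P M_subset_W by auto
  define m where "m = g L \<nu>"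
  \<comment> \<open>The image of \<nu> under the reflection that negates L. It is tangent to M at P
    and orthogonal to u, so g(\<xi> - \<tau> u, \<nu>') is independent of \<tau> and equals - g(L,
    \<nu>).\<close>
  define \<nu>' where "\<nu>' = \<nu> - (2 * m / D) *\<^sub>R L"
  have "D * (g \<nu> ((1 / D) *\<^sub>R u - (2 * g L u / D\<^sup>2) *\<^sub>R L)) = g \<nu> u - 2 * g L u / D * m"
    using D(2) sym[of \<nu> L] by (simp add: g_simps m_def field_simps power2_eq_square)
  then have gu: "g \<nu> u = 2 * g L u / D * m" using nu(3) by simp
  have u': "g \<nu>' u = 0" using gu by (simp add: \<nu>'_def g_simps field_simps)
  have "g \<nu>' \<nu>' = g \<nu> \<nu> - 4 * m * m / D + 4 * m * m / (D * D) * D"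
    using sym[of \<nu> L] by (simp add: \<nu>'_def g_simps m_def[symmetric] D(1)[symmetric] algebra_simps)
  then have n1: "g \<nu>' \<nu>' = 1" using nu(1) D(2) by simp
  have L': "g L \<nu>' = - m" using D by (simp add: \<nu>'_def g_simps m_def[symmetric] flip: D(1))
  have cPL: "c * g P L = - c / 2"
  proof -
    have "c * g P L = c * g P \<xi> + t * (c * g P u) - c * (c * g P P) / 2"
      by (simp add: L g_simps algebra_simps)
    then show ?thesis unfolding u xi M_norm[OF P] by simp
  qed
  have "c * g P \<nu>' = c * g P \<nu> - (2 * m / D) * (c * g P L)"
    by (simp add: \<nu>'_def g_simps algebra_simps)
  also have "\<dots> = c * g P \<nu> + c * m / D" unfolding cPL by simp
  also have "\<dots> = c * g (P + (1 / D) *\<^sub>R L) \<nu>"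
    by (simp add: g_simps m_def algebra_simps)
  finally have P': "c * g P \<nu>' = 0" using nu(2) by simp
  have "g L \<nu>' = g \<xi> \<nu>' + t * g u \<nu>' - (c * g P \<nu>') / 2"
    by (simp add: L g_simps)
  then have xm: "g \<xi> \<nu>' = - m" using P' u' L' sym[of u \<nu>'] by simp
  have "c * g P (\<xi> - \<tau> *\<^sub>R u) = c * g P \<xi> - \<tau> * (c * g P u)" by (simp add: g_simps algebra_simps)
  then have "c * g P (\<xi> - \<tau> *\<^sub>R u) = 0" unfolding u xi by simp
  from cauchy_schwarz_tangent[OF PW this P'] have
    "(g (\<xi> - \<tau> *\<^sub>R u) \<nu>')\<^sup>2 \<le> g (\<xi> - \<tau> *\<^sub>R u) (\<xi> - \<tau> *\<^sub>R u)" using n1 by simp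
  moreover have "g (\<xi> - \<tau> *\<^sub>R u) \<nu>' = - m" using xm u' sym[of u \<nu>'] by (simp add: g_simps)
  ultimately show ?thesis by (simp add: m_def)
qed

end

text \<open>Configuration of a hypothetical interior point \<open>Q\<close> outside the ball of curvature \<open>k0\<close> that
  touches the boundary at \<open>P\<close>. Inversion at \<open>P\<close> turns circles through \<open>P\<close> into straight lines
  \<open>\<xi> + \<real> u\<close> of the tangent space, whose distance to the origin is half the curvature of
  the circle. The arcs from \<open>P\<close> to \<open>Q\<close> rotate from the geodesic (\<open>s = 1\<close>) to the arc
  tangent to the boundary (\<open>s = 0\<close>).\<close>

locale boundary_arcs = curved_domain +
  fixes f :: "'a \<Rightarrow> real" and f' f'' U P \<nu> l Q \<xi> e p0 q0
  assumes lf: "local_fn f f' f'' U" and P: "P \<in> bd" "P \<in> U"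
    and l: "l > 0" and \<nu>: "c * g P \<nu> = 0" "g \<nu> \<nu> = 1" "\<And>w. f' P w = l * g \<nu> w"
    and Q: "Q \<in> inn" "closed_segment Q P \<subseteq> W"
    and e: "c * g P e = 0" "g e e = 1" "g e \<nu> = 0"
    and \<xi>: "\<xi> = p0 *\<^sub>R e - q0 *\<^sub>R \<nu>" and p0: "p0 \<ge> 0" and q0: "q0 > 0" "2 * q0 < k0"
    and a0: "g (\<xi> - (c/2) *\<^sub>R P) (\<xi> - (c/2) *\<^sub>R P) > 0"
    and Q_eq: "Q = P + (1 / g (\<xi> - (c/2) *\<^sub>R P) (\<xi> - (c/2) *\<^sub>R P)) *\<^sub>R (\<xi> - (c/2) *\<^sub>R P)"
begin

text \<open>The inversion of Q - P. For every point of the quadric such a vector has component - c/2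
  along P, so inversion at P is stereographic projection onto the tangent space, with \<xi> the
  image of Q.\<close>

definition "L0 = \<xi> - (c/2) *\<^sub>R P"
text \<open>u 1 = \<xi> gives the line through the origin, that is the geodesic; u 0 = e gives a
  circle tangent to the boundary, since e is orthogonal to \<nu>.\<close>

definition "u s = (1 - s) *\<^sub>R e + s *\<^sub>R \<xi>"
definition "A s = (1 - s) + s * p0"
text \<open>Homogeneous coordinates on the line L0 + \<sigma> u with \<sigma> = y / x. The point at
  infinity x = 0 is carried to P by \<open>circ\<close>, so an arc and its endpoint P are
  parametrised together.\<close>

definition "\<Lambda> s x y = x *\<^sub>R L0 + y *\<^sub>R u s"
definition "inverted s x y = (1 / g (\<Lambda> s x y) (\<Lambda> s x y)) *\<^sub>R \<Lambda> s x y"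
definition "circ s x y = P + x *\<^sub>R inverted s x y"

lemma PM: "P \<in> M" and PW: "P \<in> W"
  using P bd_M M_subset_W by auto

lemma fP: "f P = 0"
  using local_fnD(8)[OF lf P(2)] cone_M_iff[OF PM] P(1) by simp

lemma u_eq: "u s = A s *\<^sub>R e - (s * q0) *\<^sub>R \<nu>"
  by (simp only: u_def, simp add: \<xi> A_def algebra_simps)

lemma tangent_\<xi>: "c * g P \<xi> = 0"
proof -
  have "c * g P \<xi> = p0 * (c * g P e) - q0 * (c * g P \<nu>)" by (simp add: \<xi> g_simps algebra_simps)
  then show ?thesis unfolding e \<nu> by simp
qed

lemma tangent_u: "c * g P (u s) = 0"
proof -
  have "c * g P (u s) = A s * (c * g P e) - s * q0 * (c * g P \<nu>)" by (simp add: u_eq g_simps algebra_simps)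
  then show ?thesis unfolding e \<nu> by simp
qed

lemma c_P_L0: "c * g P L0 = - c / 2"
proof -
  have "c * g P L0 = c * g P \<xi> - c * (c * g P P) / 2" by (simp add: L0_def g_simps algebra_simps)
  then show ?thesis unfolding tangent_\<xi> M_norm[OF PM] by simp
qed

lemma c_P_\<Lambda>: "c * g P (\<Lambda> s x y) = - x * c / 2"
proof -
  have "c * g P (\<Lambda> s x y) = x * (c * g P L0) + y * (c * g P (u s))" by (simp add: \<Lambda>_def g_simps algebra_simps)
  then show ?thesis unfolding tangent_u c_P_L0 by simp
qed

lemma g_u: "g (u s) (u s) = (A s)\<^sup>2 + (s * q0)\<^sup>2"
  using e \<nu> sym[of \<nu> e] by (simp add: u_eq g_simps power2_eq_square)

lemma g_\<xi>: "g \<xi> \<xi> = p0\<^sup>2 + q0\<^sup>2"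
  using e \<nu> sym[of \<nu> e] by (simp add: \<xi> g_simps power2_eq_square)

lemma g_\<xi>_u: "g \<xi> (u s) = p0 * A s + s * q0\<^sup>2"
  using e \<nu> sym[of \<nu> e] by (simp only: u_eq, simp add: \<xi> g_simps power2_eq_square)

lemma g_\<nu>_u: "g \<nu> (u s) = - s * q0"
  using e \<nu> sym[of \<nu> e] by (simp add: u_eq g_simps)

lemma g_L0_u: "g L0 (u s) = g \<xi> (u s)"
proof -
  have "g L0 (u s) = g \<xi> (u s) - (c * g P (u s)) / 2" by (simp add: L0_def g_simps)
  then show ?thesis unfolding tangent_u by simp
qed

lemma g_L0: "g L0 L0 = g \<xi> \<xi> + c / 4"
proof -
  have "g (\<xi> - (c/2) *\<^sub>R P) L0 = g \<xi> L0 - (c * g P L0) / 2" by (simp add: g_simps)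
  then have "g L0 L0 = g \<xi> L0 - (c * g P L0) / 2" unfolding L0_def[symmetric] .
  also have "g \<xi> L0 = g \<xi> \<xi> - (c * g P \<xi>) / 2" using sym[of \<xi> P] by (simp add: L0_def g_simps)
  finally show ?thesis unfolding tangent_\<xi> c_P_L0 by simp
qed

lemma g_L0_pos: "g L0 L0 > 0"
  using a0 by (simp add: L0_def)

lemma g_\<Lambda>: "g (\<Lambda> s x y) (\<Lambda> s x y) = x\<^sup>2 * g L0 L0 + 2 * x * y * g L0 (u s) + y\<^sup>2 * g (u s) (u s)"
  using sym[of "u s" L0] by (simp add: \<Lambda>_def g_simps power2_eq_square algebra_simps)

context
  fixes s :: real
  assumes s: "0 \<le> s" "s \<le> 1"
begin

lemma A_nonneg: "A s \<ge> 1 - s" "A s \<ge> 0" "A s \<ge> s * p0"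
  using s p0 by (simp_all add: A_def)

lemma g_u_pos: "g (u s) (u s) > 0"
proof (cases "s = 0")
  case True
  then show ?thesis by (simp add: g_u A_def)
next
  case False
  then have "(s * q0)\<^sup>2 > 0" using s q0 by simp
  then show ?thesis unfolding g_u using zero_le_power2[of "A s"] by linarith
qed

lemma g_\<Lambda>_pos:
  assumes "x \<ge> 0" "y \<ge> 0" "x > 0 \<or> y > 0"
  shows "g (\<Lambda> s x y) (\<Lambda> s x y) > 0"
proof -
  have "g L0 (u s) \<ge> 0" using A_nonneg p0 s by (simp add: g_L0_u g_\<xi>_u)
  then have "2 * x * y * g L0 (u s) \<ge> 0" using assms by simp
  moreover have "x\<^sup>2 * g L0 L0 + y\<^sup>2 * g (u s) (u s) > 0"
    using assms(3)
  proof
    assume "x > 0"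
    then have "x\<^sup>2 * g L0 L0 > 0" using g_L0_pos by simp
    moreover have "y\<^sup>2 * g (u s) (u s) \<ge> 0" using g_u_pos by simp
    ultimately show ?thesis by linarith
  next
    assume "y > 0"
    then have "y\<^sup>2 * g (u s) (u s) > 0" using g_u_pos by simp
    moreover have "x\<^sup>2 * g L0 L0 \<ge> 0" using g_L0_pos by simp
    ultimately show ?thesis by linarith
  qed
  ultimately show ?thesis unfolding g_\<Lambda> by linarith
qed

text \<open>Since c g(P, \<Lambda>) = - x c / 2, the linear and the quadratic term in the square of
  \<open>circ\<close> cancel. For c < 0 the sign of the product with P identifies the correct
  sheet.\<close>

lemma circ_in_M:
  assumes "x \<ge> 0" "y \<ge> 0" "x > 0 \<or> y > 0"
  shows "circ s x y \<in> M"
proof -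
  define D where "D = g (\<Lambda> s x y) (\<Lambda> s x y)"
  have D: "D > 0" using g_\<Lambda>_pos[OF assms] by (simp add: D_def)
  have circ_eq: "circ s x y = P + (x / D) *\<^sub>R \<Lambda> s x y" by (simp add: circ_def inverted_def D_def)
  have one: "c * g (circ s x y) (circ s x y) = 1" if "c \<noteq> 0"
  proof -
    have "c * g (circ s x y) (circ s x y) = c * g P P + 2 * (x / D) * (c * g P (\<Lambda> s x y)) + c * (x / D)\<^sup>2 * D"
      using sym[of "\<Lambda> s x y" P] by (simp add: circ_eq g_simps D_def[symmetric] power2_eq_square algebra_simps)
    also have "c * g P P = 1" using M_norm'[OF PM that] that by simp
    finally show ?thesis unfolding c_P_\<Lambda> using D by (simp add: field_simps power2_eq_square)
  qed
  have "circ s x y \<in> W"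
  proof (cases "c \<ge> 0")
    case True
    show ?thesis
    proof (cases "c = 0")
      case False
      then have "W = - {0}" using True segments_W by auto
      moreover have "circ s x y \<noteq> 0" using one[OF False] by (auto simp: g_simps)
      ultimately show ?thesis by simp
    qed (simp add: flat_W)
  next
    case False
    have "c * g (circ s x y) P = c * g P P + (x / D) * (c * g P (\<Lambda> s x y))"
      using sym[of "\<Lambda> s x y" P] by (simp add: circ_eq g_simps algebra_simps)
    also have "c * g P P = 1" using M_norm'[OF PM] False by simp
    finally have "c * g (circ s x y) P = 1 - x * (x * c) / (D * 2)" unfolding c_P_\<Lambda> by simp
    moreover have "x * (x * c) / (D * 2) \<le> 0"
      using False D by (intro divide_nonpos_pos) (auto simp: mult_nonneg_nonpos mult_le_0_iff assms)
    ultimately show ?thesis using sheet[OF PW, of "circ s x y"] one False by simp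
  qed
  then show ?thesis using one by (simp add: M_def)
qed

lemma circ_scale:
  assumes "k > 0"
  shows "circ s (k * x) (k * y) = circ s x y"
proof -
  have "\<Lambda> s (k * x) (k * y) = k *\<^sub>R \<Lambda> s x y" by (simp add: \<Lambda>_def algebra_simps)
  then have "inverted s (k * x) (k * y) = (1 / k) *\<^sub>R inverted s x y" using assms by (simp add: inverted_def g_simps)
  then show ?thesis using assms by (simp add: circ_def)
qed

text \<open>Cancelling the e-component of \<xi> with a multiple of u leaves a vector of size q0 (1 -
  s p0 / A s) along \<nu>, and 0 \<le> s p0 \<le> A s. So the curvature of the arc, twice this
  distance, is at most 2 q0 < k0.\<close>

lemma distance_to_line:
  assumes "s > 0"
  obtains \<tau> where "g (\<xi> - \<tau> *\<^sub>R u s) (\<xi> - \<tau> *\<^sub>R u s) \<le> q0\<^sup>2"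
proof (cases "s = 1")
  case True
  then show ?thesis using that[of 1] by (simp add: u_def g_simps)
next
  case False
  then have A: "A s > 0" using A_nonneg(1) s by simp
  have "\<xi> - (p0 / A s) *\<^sub>R u s = (- (q0 * (1 - s * p0 / A s))) *\<^sub>R \<nu>"
    using A by (simp only: u_eq, simp add: \<xi> algebra_simps)
  then have "g (\<xi> - (p0 / A s) *\<^sub>R u s) (\<xi> - (p0 / A s) *\<^sub>R u s) = q0\<^sup>2 * (1 - s * p0 / A s)\<^sup>2"
    using \<nu>(2) by (simp add: g_simps power2_eq_square)
  moreover have "0 \<le> s * p0 / A s" "s * p0 / A s \<le> 1"
    using A A_nonneg(3) s p0 by (auto simp: divide_le_eq_1)
  then have "(1 - s * p0 / A s)\<^sup>2 \<le> 1" by (simp add: power_le_one)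
  ultimately show ?thesis using that[of "p0 / A s"] by (simp add: mult_left_le)
qed

lemma circ_start: "circ s 1 0 = Q"
  by (simp add: circ_def inverted_def \<Lambda>_def L0_def Q_eq)

text \<open>A curve in the domain that touches the boundary has curvature at least k0 there, because
  the second derivative of the defining function along it is nonpositive at the contact point. Here
  this reads k0 \<le> 2 g(n, L), while the arc has g(n, L) \<le> q0 < k0 / 2.\<close>

lemma circ_avoids_bd:
  assumes s0: "s > 0" and \<Omega>: "\<And>\<sigma>. \<sigma> \<ge> 0 \<Longrightarrow> circ s 1 \<sigma> \<in> cone \<Omega>" and \<sigma>0: "\<sigma>0 \<ge> 0"
  shows "circ s 1 \<sigma>0 \<in> cone inn"
proof (rule ccontr)
  define y where "y = circ s 1 \<sigma>0"
  define L where "L \<sigma> = L0 + \<sigma> *\<^sub>R u s" for \<sigma>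
  define D where "D \<sigma> = g (L \<sigma>) (L \<sigma>)" for \<sigma>
  assume "circ s 1 \<sigma>0 \<notin> cone inn"
  then have yc: "y \<in> cone bd" using \<Omega>[OF \<sigma>0] cone_Omega(1) by (auto simp: y_def)
  have "Q \<in> cone inn" using Q(1) cone_M_iff inn_M by auto
  then have "\<sigma>0 \<noteq> 0" using \<open>circ s 1 \<sigma>0 \<notin> cone inn\<close> circ_start by auto
  then have \<sigma>0: "\<sigma>0 > 0" using \<sigma>0 by simp
  have yM: "y \<in> M" using circ_in_M \<sigma>0 by (simp add: y_def)
  then have yb: "y \<in> bd" using yc cone_M_iff by auto
  obtain F F' F'' V where lF: "local_fn F F' F'' V" and yV: "y \<in> V" using local_fn_exists[OF yb] by metis
  note K = local_fnD[OF lF]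
  obtain n m where m: "m > 0" "c * g y n = 0" "g n n = 1" "\<And>w. F' y w = m * g n w"
    by (rule local_gradient[OF lF yb yV]) blast
  have L_\<Lambda>: "L \<sigma> = \<Lambda> s 1 \<sigma>" for \<sigma> by (simp add: L_def \<Lambda>_def)
  have Dpos: "D \<sigma> > 0" if "\<sigma> \<ge> 0" for \<sigma> using g_\<Lambda>_pos[of 1 \<sigma>] that by (simp add: D_def L_\<Lambda>)
  define \<gamma> where "\<gamma> \<sigma> = P + (1 / D \<sigma>) *\<^sub>R L \<sigma>" for \<sigma>
  have \<gamma>_circ: "\<gamma> \<sigma> = circ s 1 \<sigma>" for \<sigma> by (simp add: \<gamma>_def circ_def inverted_def D_def L_\<Lambda>)
  define d1 where "d1 \<sigma> = (1 / D \<sigma>) *\<^sub>R u s - (2 * g (L \<sigma>) (u s) / (D \<sigma>)\<^sup>2) *\<^sub>R L \<sigma>" for \<sigma>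
  define d2 where "d2 = (8 * (g (L \<sigma>0) (u s))\<^sup>2 / (D \<sigma>0)^3 - 2 * g (u s) (u s) / (D \<sigma>0)\<^sup>2) *\<^sub>R L \<sigma>0 -
       (4 * g (L \<sigma>0) (u s) / (D \<sigma>0)\<^sup>2) *\<^sub>R u s"
  have deriv1: "(\<gamma> has_vector_derivative d1 \<sigma>) (at \<sigma>)" if "\<sigma> \<ge> 0" for \<sigma>
    using has_vector_derivative_add[OF has_vector_derivative_const[of P] inversion_derivatives(1)[of L0 \<sigma> "u s"]]
      Dpos[OF that]
    unfolding \<gamma>_def D_def L_def d1_def by simp
  have deriv2: "(d1 has_vector_derivative d2) (at \<sigma>0)"
    using inversion_derivatives(2)[of L0 \<sigma>0 "u s"] Dpos[of \<sigma>0] \<sigma>0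
    unfolding D_def L_def d1_def d2_def by simp
  have y\<gamma>: "y = \<gamma> \<sigma>0" by (simp add: y_def \<gamma>_circ)
  have "isCont \<gamma> \<sigma>0" using deriv1[of \<sigma>0] \<sigma>0 by (intro has_vector_derivative_continuous) auto
  then have "isCont (\<lambda>t. \<gamma> (\<sigma>0 + t)) 0"
    by (simp add: isCont_iff)
  then obtain \<delta>1 where \<delta>1: "\<delta>1 > 0" "\<And>t. \<bar>t\<bar> < \<delta>1 \<Longrightarrow> \<gamma> (\<sigma>0 + t) \<in> V"
    using curve_stays_in_open[of "\<lambda>t. \<gamma> (\<sigma>0 + t)" V] yV K(4) y\<gamma> by auto
  define \<delta> where "\<delta> = min \<delta>1 \<sigma>0"
  have \<delta>: "\<delta> > 0" using \<delta>1(1) \<sigma>0 by (simp add: \<delta>_def)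
  have near: "t \<ge> 0" "\<gamma> t \<in> V" if "\<bar>t - \<sigma>0\<bar> < \<delta>" for t
    using that \<delta>1(2)[of "t - \<sigma>0"] by (auto simp: \<delta>_def)
  have Fy: "F y = 0" using K(8)[OF yV] yc by simp
  have max: "F' (\<gamma> \<sigma>0) (d1 \<sigma>0) = 0"
    "F'' (\<gamma> \<sigma>0) (d1 \<sigma>0) (d1 \<sigma>0) + F' (\<gamma> \<sigma>0) d2 \<le> 0"
  proof -
    have 1: "((\<lambda>t. F (\<gamma> t)) has_real_derivative F' (\<gamma> t) (d1 t)) (at t)" if "\<bar>t - \<sigma>0\<bar> < \<delta>" for t
      using C2_derivs_along(1)[where \<gamma>=\<gamma> and ?d1.0=d1 and t=t, OF K(1) near(2)[OF that] deriv1[OF near(1)[OF that]]] .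
    have 2: "F (\<gamma> t) \<le> F (\<gamma> \<sigma>0)" if "\<bar>t - \<sigma>0\<bar> < \<delta>" for t
      using K(9)[OF near(2)[OF that]] \<Omega>[OF near(1)[OF that]] Fy y\<gamma> by (simp add: \<gamma>_circ)
    have 3: "((\<lambda>t. F' (\<gamma> t) (d1 t)) has_real_derivative
       F'' (\<gamma> \<sigma>0) (d1 \<sigma>0) (d1 \<sigma>0) + F' (\<gamma> \<sigma>0) d2) (at \<sigma>0)"
      using C2_derivs_along(2)[where \<gamma>=\<gamma> and ?d1.0=d1 and t=\<sigma>0, OF K(1) _ deriv1 deriv2] yV y\<gamma> \<sigma>0 by simp
    show "F' (\<gamma> \<sigma>0) (d1 \<sigma>0) = 0" "F'' (\<gamma> \<sigma>0) (d1 \<sigma>0) (d1 \<sigma>0) + F' (\<gamma> \<sigma>0) d2 \<le> 0"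
      using second_derivative_at_max[OF \<delta> 1 2 3] by auto
  qed
  define d where "d = D \<sigma>0"
  define a where "a = g (L \<sigma>0) (u s)"
  define L' where "L' = L \<sigma>0"
  have d: "d > 0" using Dpos \<sigma>0 by (simp add: d_def)
  have gLL: "g L' L' = d" by (simp add: d_def D_def L'_def)
  have gLu: "g L' (u s) = a" "g (u s) L' = a" using sym by (simp_all add: L'_def a_def)
  have d1: "d1 \<sigma>0 = (1 / d) *\<^sub>R u s - (2 * a / d\<^sup>2) *\<^sub>R L'" by (simp add: d1_def d_def a_def L'_def)
  have d2: "d2 = (8 * a\<^sup>2 / d^3 - 2 * g (u s) (u s) / d\<^sup>2) *\<^sub>R L' - (4 * a / d\<^sup>2) *\<^sub>R u s"
    by (simp add: d2_def d_def a_def L'_def)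
  have cPL: "c * g P L' = - c / 2" using c_P_\<Lambda>[of s 1 \<sigma>0] by (simp add: L'_def L_\<Lambda>)
  have y_eq: "y = P + (1 / d) *\<^sub>R L'" by (simp add: y\<gamma> \<gamma>_def d_def L'_def)
  \<comment> \<open>The velocity is tangent to M at y, as the curvature bound at y requires.\<close>
  have "c * g y (d1 \<sigma>0) = (1/d) * (c * g P (u s)) - (2 * a / d\<^sup>2) * (c * g P L') + c * a / d\<^sup>2 - 2 * c * a / d^3 * d"
    by (simp add: y_eq d1 g_simps gLL gLu algebra_simps power2_eq_square power3_eq_cube)
  then have cyd: "c * g y (d1 \<sigma>0) = 0"
    unfolding tangent_u cPL using d by (simp add: power2_eq_square power3_eq_cube)
  have gd1: "g (d1 \<sigma>0) (d1 \<sigma>0) = g (u s) (u s) / d\<^sup>2"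
    using d by (simp add: d1 g_simps gLL gLu field_simps power2_eq_square)
  have n0: "g n (d1 \<sigma>0) = 0" using max(1) m(1,4) y\<gamma> by simp
  then have "d\<^sup>2 * ((1/d) * g n (u s) - (2 * a / d\<^sup>2) * g n L') = 0" by (simp add: d1 g_simps)
  then have nu: "d * g n (u s) = 2 * a * g n L'" using d by (simp add: field_simps power2_eq_square)
  \<comment> \<open>The normal part of the acceleration. The tangency relation \<open>nu\<close>
    removes the terms containing a and leaves - 2 g(n, L') g(u, u) / d^2.\<close>
  have "d^3 * g n d2 = 8 * a\<^sup>2 * g n L' - 2 * d * g (u s) (u s) * g n L' - 4 * a * (d * g n (u s))"
    using d by (simp add: d2 g_simps field_simps power2_eq_square power3_eq_cube)
  also have "\<dots> = - 2 * d * g (u s) (u s) * g n L'" unfolding nu by (simp add: power2_eq_square)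
  finally have "d * (d\<^sup>2 * g n d2) = d * (- 2 * g n L' * g (u s) (u s))"
    by (simp add: power2_eq_square power3_eq_cube mult_ac)
  then have "d\<^sup>2 * g n d2 = - 2 * g n L' * g (u s) (u s)" using d by (simp only: mult_left_cancel)
  then have nd2: "g n d2 = - 2 * g n L' * g (u s) (u s) / d\<^sup>2" using d by (simp add: field_simps)
  define q where "q = g (u s) (u s) / d\<^sup>2"
  have q: "q > 0" using g_u_pos d by (simp add: q_def)
  have "F'' y (d1 \<sigma>0) (d1 \<sigma>0) \<ge> k0 * (m * q)"
    using hessian_bd[OF lF yb yV m cyd] max(1) y\<gamma> gd1 by (simp add: q_def)
  moreover have "F' y d2 = m * (- 2 * g n L' * q)" using m(4)[of d2] nd2 by (simp add: q_def)
  ultimately have "k0 * (m * q) + m * (- 2 * g n L' * q) \<le> 0" using max(2) y\<gamma> by simp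
  moreover have "k0 * (m * q) + m * (- 2 * g n L' * q) = m * q * (k0 - 2 * g n L')"
    by (simp add: algebra_simps)
  ultimately have "m * q * (k0 - 2 * g n L') \<le> 0" by simp
  moreover have "m * q > 0" using m(1) q by simp
  ultimately have k: "k0 \<le> 2 * g n L'" using m(1) q by (auto simp: mult_le_0_iff)
  obtain \<tau> where \<tau>: "g (\<xi> - \<tau> *\<^sub>R u s) (\<xi> - \<tau> *\<^sub>R u s) \<le> q0\<^sup>2" using distance_to_line[OF s0] .
  have "(g L' n)\<^sup>2 \<le> g (\<xi> - \<tau> *\<^sub>R u s) (\<xi> - \<tau> *\<^sub>R u s)"
  proof (rule circle_curvature_bound[OF PM tangent_u[of s] tangent_\<xi> _ gLL[symmetric] d])
    show "L' = \<xi> + \<sigma>0 *\<^sub>R u s - (c / 2) *\<^sub>R P" by (simp add: L'_def L_def L0_def algebra_simps)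
    show "g n n = 1" "c * g (P + (1 / d) *\<^sub>R L') n = 0" using m(2,3) by (simp_all add: y_eq)
    show "g n ((1 / d) *\<^sub>R u s - (2 * g L' (u s) / d\<^sup>2) *\<^sub>R L') = 0" using n0 by (simp add: d1 gLu)
  qed
  then have "(g n L')\<^sup>2 \<le> q0\<^sup>2" using \<tau> sym[of n L'] by simp
  then have "g n L' \<le> q0" using q0(1) by (simp add: abs_le_square_iff[symmetric])
  then show False using k q0(2) by simp
qed

end

end

lemma isCont_tendsto_nhds: "isCont F x \<Longrightarrow> (F \<longlongrightarrow> F x) (nhds x)"
  by (simp add: isCont_def tendsto_at_iff_tendsto_nhds)

context boundary_arcs
begin

text \<open>The parameter \<sigma> suits derivatives along the line; r = 1 / (1 + \<sigma>) extends
  to r = 0 at P, for compactness arguments.\<close>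

lemma circ_parametrisation:
  assumes s: "0 \<le> s" "s \<le> 1"
  shows "(\<forall>r\<in>{0<..1}. circ s r (1 - r) \<in> X) \<longleftrightarrow> (\<forall>\<sigma>\<ge>0. circ s 1 \<sigma> \<in> X)"
proof (intro iffI ballI allI impI)
  fix \<sigma> :: real assume H: "\<forall>r\<in>{0<..1}. circ s r (1 - r) \<in> X" and \<sigma>: "\<sigma> \<ge> 0"
  have "circ s ((1 + \<sigma>) * (1 / (1 + \<sigma>))) ((1 + \<sigma>) * (1 - 1 / (1 + \<sigma>))) = circ s (1 / (1 + \<sigma>)) (1 - 1 / (1 + \<sigma>))"
    using \<sigma> by (intro circ_scale s) simp
  moreover have "(1 + \<sigma>) * (1 / (1 + \<sigma>)) = 1" "(1 + \<sigma>) * (1 - 1 / (1 + \<sigma>)) = \<sigma>"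
    using \<sigma> by (simp_all add: field_simps)
  ultimately show "circ s 1 \<sigma> \<in> X" using H \<sigma> by simp
next
  fix r :: real assume H: "\<forall>\<sigma>\<ge>0. circ s 1 \<sigma> \<in> X" and r: "r \<in> {0<..1}"
  have "circ s (r * 1) (r * ((1 - r) / r)) = circ s 1 ((1 - r) / r)" using r by (intro circ_scale s) simp
  then show "circ s r (1 - r) \<in> X" using H r by simp
qed

text \<open>For s = 1 the arc consists of nonnegative combinations \<alpha> P + \<beta> Q. Up to
  scaling it runs on the chord from Q to P, which convexity places in \<open>cone \<Omega>\<close>;
  \<open>circ_avoids_bd\<close> then removes the boundary.\<close>

lemma circ_geodesic: "\<sigma> \<ge> 0 \<Longrightarrow> circ 1 1 \<sigma> \<in> cone inn"
proof (rule circ_avoids_bd)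
  fix \<sigma> :: real assume \<sigma>: "\<sigma> \<ge> 0"
  define a where "a = g L0 L0"
  define X where "X = g \<xi> \<xi>"
  define D where "D = g (\<Lambda> 1 1 \<sigma>) (\<Lambda> 1 1 \<sigma>)"
  have a: "a > 0" "a = X + c / 4" using g_L0_pos g_L0 by (simp_all add: a_def X_def)
  have X: "X \<ge> 0" using g_\<xi> by (simp add: X_def)
  have u1: "u 1 = \<xi>" by (simp add: u_def)
  have D: "D > 0" using g_\<Lambda>_pos[of 1 1 \<sigma>] \<sigma> by (simp add: D_def)
  have D_eq: "D = a + 2 * \<sigma> * X + \<sigma>\<^sup>2 * X"
    using g_L0_u[of 1] by (simp add: D_def g_\<Lambda> u1 a_def X_def)
  \<comment> \<open>The coefficients come from substituting L0 = a (Q - P) and \<xi> = L0 + (c/2) P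
    into \<open>circ 1 1 \<sigma>\<close>.\<close>
  define \<beta> where "\<beta> = (1 + \<sigma>) * a / D"
  define \<alpha> where "\<alpha> = 1 + \<sigma> * c / (2 * D) - \<beta>"
  have "D * \<alpha> = D + \<sigma> * c / 2 - (1 + \<sigma>) * a" using D by (simp add: \<alpha>_def \<beta>_def field_simps)
  also have "\<dots> = \<sigma> * (a + \<sigma> * X)" by (simp add: D_eq a(2) field_simps power2_eq_square)
  finally have "D * \<alpha> \<ge> 0" using \<sigma> a(1) X by simp
  then have \<alpha>: "\<alpha> \<ge> 0" using D by (simp add: zero_le_mult_iff)
  have \<beta>: "\<beta> > 0" using \<sigma> a(1) D by (simp add: \<beta>_def)
  have QP: "Q - P = (1 / a) *\<^sub>R L0" using Q_eq by (simp add: a_def L0_def)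
  then have aQP: "a *\<^sub>R (Q - P) = L0" using a(1) by simp
  have \<xi>_L0: "\<xi> = L0 + (c/2) *\<^sub>R P" by (simp add: L0_def)
  have "\<Lambda> 1 1 \<sigma> = 1 *\<^sub>R L0 + \<sigma> *\<^sub>R \<xi>" by (simp add: \<Lambda>_def u1)
  also have "\<dots> = 1 *\<^sub>R L0 + \<sigma> *\<^sub>R (L0 + (c/2) *\<^sub>R P)"
    using \<xi>_L0 by (rule arg_cong[where f="\<lambda>x. 1 *\<^sub>R L0 + \<sigma> *\<^sub>R x"])
  finally have "\<Lambda> 1 1 \<sigma> = (1 + \<sigma>) *\<^sub>R L0 + (\<sigma> * c / 2) *\<^sub>R P" by (simp add: algebra_simps)
  then have "circ 1 1 \<sigma> = P + (1 / D) *\<^sub>R ((1 + \<sigma>) *\<^sub>R L0 + (\<sigma> * c / 2) *\<^sub>R P)"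
    by (simp add: circ_def inverted_def D_def)
  also have "\<dots> = P + (1 / D) *\<^sub>R ((1 + \<sigma>) *\<^sub>R (a *\<^sub>R (Q - P)) + (\<sigma> * c / 2) *\<^sub>R P)"
    by (simp only: aQP)
  also have "\<dots> = \<alpha> *\<^sub>R P + \<beta> *\<^sub>R Q"
    by (simp add: \<alpha>_def \<beta>_def algebra_simps add_divide_distrib)
  finally have eq: "circ 1 1 \<sigma> = \<alpha> *\<^sub>R P + \<beta> *\<^sub>R Q" .
  define k where "k = \<alpha> + \<beta>"
  have k: "k > 0" using \<alpha> \<beta> by (simp add: k_def)
  have "(\<alpha> / k) *\<^sub>R P + (\<beta> / k) *\<^sub>R Q \<in> closed_segment Q P"
    unfolding closed_segment_def
  proof (intro CollectI exI[of _ "\<alpha> / k"] conjI)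
    have "1 - \<alpha> / k = \<beta> / k" using k by (simp add: k_def field_simps)
    then show "(\<alpha> / k) *\<^sub>R P + (\<beta> / k) *\<^sub>R Q = (1 - \<alpha> / k) *\<^sub>R Q + (\<alpha> / k) *\<^sub>R P" by simp
    show "0 \<le> \<alpha> / k" "\<alpha> / k \<le> 1" using \<alpha> \<beta> k by (auto simp: k_def)
  qed
  moreover have "closed_segment Q P \<subseteq> cone \<Omega>"
    using segment_to_bd[OF _ P(1) Q(2)] Q(1) cone_M_iff inn_M by blast
  ultimately have in_cone: "(\<alpha> / k) *\<^sub>R P + (\<beta> / k) *\<^sub>R Q \<in> cone \<Omega>" by blast
  have "circ 1 1 \<sigma> = k *\<^sub>R ((\<alpha> / k) *\<^sub>R P + (\<beta> / k) *\<^sub>R Q)"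
    unfolding eq using k by (simp add: scaleR_add_right)
  then show "circ 1 1 \<sigma> \<in> cone \<Omega>"
    using in_cone cone_scale[OF _ k in_cone] by (cases "c = 0") (simp_all add: k_def \<alpha>_def)
qed auto

text \<open>All arcs end at P, which is not interior, so openness at that end needs entry into the
  interior uniformly in the direction. This holds near a transversal direction, as f' stays negative
  on a whole neighbourhood.\<close>

lemma near_P:
  assumes v0: "f' P v0 < 0"
  obtains \<rho> where "\<rho> > 0" "\<And>r v. 0 < r \<Longrightarrow> r < \<rho> \<Longrightarrow> dist v v0 < \<rho> \<Longrightarrow> P + r *\<^sub>R v \<in> cone inn"
proof -
  note L = local_fnD[OF lf]
  define \<Phi> where "\<Phi> p = P + fst p *\<^sub>R snd p" for p :: "real \<times> 'a"
  define T where "T = {p. \<Phi> p \<in> U \<and> f' (\<Phi> p) (snd p) < 0}"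
  have c\<Phi>: "continuous_on B \<Phi>" for B unfolding \<Phi>_def by (intro continuous_intros)
  have oV: "open (\<Phi> -` U)" using continuous_on_open_vimage[of UNIV \<Phi>] c\<Phi> L(4) by auto
  have "continuous_on (\<Phi> -` U) (\<lambda>p. f' (\<Phi> p) (snd p))"
    by (intro blinfun.continuous_on continuous_on_compose2[OF C2_derivsD(5)[OF L(1)] c\<Phi>] continuous_intros) auto
  from continuous_open_preimage[OF this oV, of "{..<0}"]
  have "open (\<Phi> -` U \<inter> (\<lambda>p. f' (\<Phi> p) (snd p)) -` {..<0})" by simp
  moreover have "T = \<Phi> -` U \<inter> (\<lambda>p. f' (\<Phi> p) (snd p)) -` {..<0}" by (auto simp: T_def)
  ultimately have "open T" by simp
  moreover have "(0, v0) \<in> T" using v0 P(2) by (simp add: T_def \<Phi>_def)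
  ultimately obtain A B where AB: "open A" "open B" "(0, v0) \<in> A \<times> B" "A \<times> B \<subseteq> T"
    using open_prod_elim[of T "(0, v0)"] by metis
  obtain a b where a: "a > 0" "ball 0 a \<subseteq> A" and b: "b > 0" "ball v0 b \<subseteq> B"
    using AB(1-3) open_contains_ball_eq[of A 0] open_contains_ball_eq[of B v0] by auto
  show thesis
  proof (rule that[of "min a b"])
    show "min a b > 0" using a b by simp
    fix r v assume r: "0 < r" "r < min a b" and v: "dist v v0 < min a b"
    have inT: "(t, v) \<in> T" if "0 \<le> t" "t \<le> r" for t
    proof -
      have "t \<in> ball 0 a" using that r by simp
      moreover have "v \<in> ball v0 b" using v by (simp add: dist_commute)
      ultimately show ?thesis using a(2) b(2) AB(4) by blast
    qed
    have "f (P + r *\<^sub>R v) < f (P + 0 *\<^sub>R v)"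
    proof (rule DERIV_neg_imp_decreasing[OF r(1)])
      fix t assume "0 \<le> t" "t \<le> r"
      then have t: "P + t *\<^sub>R v \<in> U" "f' (P + t *\<^sub>R v) v < 0" using inT by (auto simp: T_def \<Phi>_def)
      have "((\<lambda>t. P + t *\<^sub>R v) has_vector_derivative v) (at t)" by (auto intro!: derivative_eq_intros)
      from C2_derivs_along(1)[OF L(1) t(1) this] t(2)
      show "\<exists>y. ((\<lambda>t. f (P + t *\<^sub>R v)) has_real_derivative y) (at t) \<and> y < 0" by blast
    qed
    moreover have "P + r *\<^sub>R v \<in> U" using inT[of r] r by (simp add: T_def \<Phi>_def)
    ultimately show "P + r *\<^sub>R v \<in> cone inn" using L(7) fP by simp
  qed
qed

definition good :: "real \<Rightarrow> bool" where
  "good s \<longleftrightarrow> (\<forall>r\<in>{0<..1}. circ s r (1 - r) \<in> cone inn)"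

lemma isCont_inverted:
  assumes "0 \<le> s" "s \<le> 1" "0 \<le> r" "r \<le> 1"
  shows "isCont (\<lambda>p. inverted (fst p) (snd p) (1 - snd p)) (s, r)"
proof -
  have "isCont (\<lambda>p. \<Lambda> (fst p) (snd p) (1 - snd p)) (s, r)"
    unfolding \<Lambda>_def u_def by (intro continuous_intros)
  moreover have "g (\<Lambda> s r (1 - r)) (\<Lambda> s r (1 - r)) \<noteq> 0"
    using g_\<Lambda>_pos[of s r "1 - r"] assms by (cases "r = 0") auto
  ultimately show ?thesis
    unfolding inverted_def by (intro continuous_intros g.continuous) auto
qed

text \<open>By compactness of 0 \<le> r \<le> 1 it is enough to work near each r. At r = 0 the arc
  meets the boundary with normal component proportional to - s q0, which is negative because s >
  0.\<close>

lemma good_open: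
  assumes s: "0 < s" "s \<le> 1" and good: "good s"
  obtains \<epsilon> where "\<epsilon> > 0" "\<And>s'. \<bar>s' - s\<bar> \<le> \<epsilon> \<Longrightarrow> good s'"
proof -
  \<comment> \<open>Guarded by 0 < r, since at r = 0 every arc is at P, outside the
    interior.\<close>
  define G where "G = {p. 0 < snd p \<longrightarrow> circ (fst p) (snd p) (1 - snd p) \<in> cone inn}"
  have "(s, r) \<in> interior G" if r: "0 \<le> r" "r \<le> 1" for r
  proof -
    have ci: "isCont (\<lambda>p. inverted (fst p) (snd p) (1 - snd p)) (s, r)"
      using isCont_inverted[of s r] s r by simp
    have "\<forall>\<^sub>F p in nhds (s, r). p \<in> G"
    proof (cases "r = 0")
      case False
      then have "circ s r (1 - r) \<in> cone inn" using good r by (simp add: good_def)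
      moreover have "isCont (\<lambda>p. circ (fst p) (snd p) (1 - snd p)) (s, r)"
        unfolding circ_def by (intro continuous_intros ci)
      ultimately have "((\<lambda>p. circ (fst p) (snd p) (1 - snd p)) \<longlongrightarrow> circ s r (1 - r)) (nhds (s, r))"
        and "circ s r (1 - r) \<in> cone inn"
        using isCont_tendsto_nhds[where F="\<lambda>p. circ (fst p) (snd p) (1 - snd p)" and x="(s, r)"] by simp_all
      then have "\<forall>\<^sub>F p in nhds (s, r). circ (fst p) (snd p) (1 - snd p) \<in> cone inn"
        using open_cone_inn by (auto dest: topological_tendstoD)
      then show ?thesis by eventually_elim (simp add: G_def)
    next
      case True
      \<comment> \<open>The limit direction u / g(u, u) of the arc at P.\<close>
      define v0 where "v0 = inverted s 0 1"
      have gu: "g (u s) (u s) > 0" using g_u_pos s by simp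
      have "f' P v0 = - (l * s * q0) / g (u s) (u s)"
        using \<nu>(3)[of "u s"] g_\<nu>_u[of s] by (simp add: v0_def inverted_def \<Lambda>_def blinfun.scaleR_right)
      then have "f' P v0 < 0" using l s q0 gu by simp
      then obtain \<rho> where \<rho>: "\<rho> > 0"
        "\<And>r v. 0 < r \<Longrightarrow> r < \<rho> \<Longrightarrow> dist v v0 < \<rho> \<Longrightarrow> P + r *\<^sub>R v \<in> cone inn" by (rule near_P) blast
      have "\<forall>\<^sub>F p in nhds (s, r). dist (inverted (fst p) (snd p) (1 - snd p)) v0 < \<rho>"
      proof -
        have "((\<lambda>p. inverted (fst p) (snd p) (1 - snd p)) \<longlongrightarrow> v0) (nhds (s, r))"
          using isCont_tendsto_nhds[OF ci] True by (simp add: v0_def)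
        then show ?thesis using \<rho>(1) by (rule tendstoD)
      qed
      moreover have "\<forall>\<^sub>F p in nhds (s, r). snd p < \<rho>"
      proof -
        have "(snd \<longlongrightarrow> r) (nhds (s, r))" 
          using isCont_tendsto_nhds[where F=snd and x="(s, r)"] by (simp add: continuous_snd)
        then show ?thesis using \<rho>(1) True by (intro order_tendstoD(2)) auto
      qed
      ultimately show ?thesis by eventually_elim (use \<rho>(2) in \<open>auto simp: G_def circ_def\<close>)
    qed
    then show ?thesis by (auto simp: eventually_nhds interior_def)
  qed
  then have sub: "{s} \<times> {0..1} \<subseteq> interior G" by auto
  have "compact ({s} \<times> {0..1::real})" by (intro compact_Times) auto
  then obtain \<epsilon> where \<epsilon>: "\<epsilon> > 0" "(\<Union>p\<in>{s} \<times> {0..1}. cball p \<epsilon>) \<subseteq> interior G"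
    using compact_subset_open_imp_cball_epsilon_subset[OF _ open_interior sub] by metis
  show thesis
  proof (rule that[OF \<epsilon>(1)])
    fix s' assume s': "\<bar>s' - s\<bar> \<le> \<epsilon>"
    show "good s'"
      unfolding good_def
    proof
      fix r :: real assume r: "r \<in> {0<..1}"
      have "(s', r) \<in> cball (s, r) \<epsilon>" using s' by (simp add: dist_Pair_Pair dist_real_def abs_minus_commute)
      then have "(s', r) \<in> G" using \<epsilon>(2) r interior_subset by fastforce
      then show "circ s' r (1 - r) \<in> cone inn" using r by (simp add: G_def)
    qed
  qed
qed

lemma good_closure:
  assumes S: "S \<subseteq> {0<..1}" "\<And>s. s \<in> S \<Longrightarrow> good s" and s: "s \<in> closure S" and r: "r \<in> {0<..1}"
  shows "circ s r (1 - r) \<in> cone \<Omega>"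
proof (rule closure_inn)
  have "closure S \<subseteq> {0..1}" using S(1) by (intro closure_minimal) auto
  then have cS: "0 \<le> t \<and> t \<le> 1" if "t \<in> closure S" for t using that by auto
  show "circ s r (1 - r) \<in> W" using circ_in_M[of s r "1 - r"] cS[OF s] r M_subset_W by auto
  have "continuous_on (closure S) (\<lambda>t. circ t r (1 - r))"
  proof (rule continuous_at_imp_continuous_on, rule ballI)
    fix t assume "t \<in> closure S"
    then have t: "0 \<le> t" "t \<le> 1" using cS by auto
    have "isCont (\<lambda>t. (t, r)) t" by (intro continuous_intros)
    moreover have "isCont (\<lambda>p. inverted (fst p) (snd p) (1 - snd p)) (t, r)" using isCont_inverted t r by simp
    ultimately have "isCont (\<lambda>t. inverted t r (1 - r)) t"
      using isCont_o2[of t "\<lambda>t. (t, r)" "\<lambda>p. inverted (fst p) (snd p) (1 - snd p)"] by simp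
    then show "isCont (\<lambda>t. circ t r (1 - r)) t" unfolding circ_def by (intro continuous_intros)
  qed
  moreover have "(\<lambda>t. circ t r (1 - r)) ` S \<subseteq> closure (cone inn)"
    using S(2) r closure_subset by (fastforce simp: good_def)
  ultimately show "circ s r (1 - r) \<in> closure (cone inn)"
    using image_closure_subset[of S "\<lambda>t. circ t r (1 - r)" "closure (cone inn)"] s by auto
qed

text \<open>The interval (0, 1] is connected and contains the good value 1. Goodness is open by
  \<open>good_open\<close>, and closed because a limit arc lies in \<open>cone \<Omega>\<close> and
  then cannot touch the boundary.\<close>

lemma all_good:
  assumes "s \<in> {0<..1}"
  shows "good s"
proof -
  define S where "S = {s \<in> {0<..1}. good s}"
  have "1 \<in> S" using circ_geodesic circ_parametrisation[of 1 "cone inn"] by (simp add: S_def good_def)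
  have "openin (top_of_set {0<..1}) S"
    unfolding openin_contains_ball
  proof (intro conjI ballI)
    fix t assume "t \<in> S"
    then obtain \<epsilon> where \<epsilon>: "\<epsilon> > 0" "\<And>s'. \<bar>s' - t\<bar> \<le> \<epsilon> \<Longrightarrow> good s'"
      using good_open[of t] by (auto simp: S_def)
    then show "\<exists>e>0. ball t e \<inter> {0<..1} \<subseteq> S"
      by (intro exI[of _ \<epsilon>]) (auto simp: S_def dist_real_def abs_minus_commute)
  qed (auto simp: S_def)
  moreover have "closedin (top_of_set {0<..1}) S"
    unfolding closedin_closed
  proof (intro exI[of _ "closure S"] conjI equalityI subsetI)
    fix t assume t: "t \<in> {0<..1} \<inter> closure S"
    have "\<forall>r\<in>{0<..1}. circ t r (1 - r) \<in> cone \<Omega>"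
    proof
      fix r :: real assume r: "r \<in> {0<..1}"
      show "circ t r (1 - r) \<in> cone \<Omega>"
        by (rule good_closure[of S t, OF _ _ _ r]) (use t in \<open>simp_all add: S_def subset_iff\<close>)
    qed
    then have "\<forall>\<sigma>\<ge>0. circ t 1 \<sigma> \<in> cone \<Omega>" using circ_parametrisation[of t "cone \<Omega>"] t by auto
    then have "\<forall>\<sigma>\<ge>0. circ t 1 \<sigma> \<in> cone inn" using circ_avoids_bd[of t] t by auto
    then show "t \<in> S" using circ_parametrisation[of t "cone inn"] t by (auto simp: S_def good_def)
  next
    fix t assume "t \<in> S"
    moreover have "t \<in> closure S" using \<open>t \<in> S\<close> closure_subset by blast
    ultimately show "t \<in> {0<..1} \<inter> closure S" by (simp add: S_def)
  qed simp
  moreover have "connected {0::real<..1}" by simp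
  ultimately have "S = {} \<or> S = {0<..1}" unfolding connected_clopen by blast
  then have "s \<in> S" using \<open>1 \<in> S\<close> assms by blast
  then show ?thesis unfolding S_def by blast
qed

text \<open>The limit arc s = 0 lies in the domain and is tangent to the boundary at P with
  curvature 2 q0 < k0. So it leaves the domain to second order: the second derivative of f along it
  at P is at least l (k0 - 2 q0) > 0.\<close>

theorem no_boundary_arcs: False
proof -
  note L = local_fnD[OF lf]
  have cl0: "(0::real) \<in> closure {0<..1}" by (simp add: closure_greaterThanAtMost)
  have "\<forall>r\<in>{0<..1}. circ 0 r (1 - r) \<in> cone \<Omega>"
    using good_closure[OF order_refl all_good cl0] by blast
  then have in\<Omega>: "circ 0 1 \<sigma> \<in> cone \<Omega>" if "\<sigma> \<ge> 0" for \<sigma>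
    using circ_parametrisation[of 0 "cone \<Omega>"] that by auto
  \<comment> \<open>\<tau> = 1 / \<sigma> is a parameter regular at the endpoint P.\<close>
  have in\<Omega>': "circ 0 \<tau> 1 \<in> cone \<Omega>" if "\<tau> > 0" for \<tau>
    using in\<Omega>[of "1 / \<tau>"] circ_scale[of 0 \<tau> 1 "1 / \<tau>"] that by simp
  have u0: "u 0 = e" by (simp add: u_def)
  define D where "D \<tau> = g (e + \<tau> *\<^sub>R L0) (e + \<tau> *\<^sub>R L0)" for \<tau>
  have \<Lambda>0: "\<Lambda> 0 \<tau> 1 = e + \<tau> *\<^sub>R L0" for \<tau> by (simp add: \<Lambda>_def u0)
  have D: "D \<tau> > 0" if "\<tau> \<ge> 0" for \<tau> using g_\<Lambda>_pos[of 0 \<tau> 1] that by (simp add: D_def \<Lambda>0)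
  define i0 where "i0 \<tau> = (1 / D \<tau>) *\<^sub>R (e + \<tau> *\<^sub>R L0)" for \<tau>
  define i1 where "i1 \<tau> = (1 / D \<tau>) *\<^sub>R L0 - (2 * g (e + \<tau> *\<^sub>R L0) L0 / (D \<tau>)\<^sup>2) *\<^sub>R (e + \<tau> *\<^sub>R L0)" for \<tau>
  have di0: "(i0 has_vector_derivative i1 \<tau>) (at \<tau>)" if "\<tau> \<ge> 0" for \<tau>
    using inversion_derivatives(1)[of e \<tau> L0] D[OF that] unfolding i0_def i1_def D_def by simp
  obtain i2 where di1: "(i1 has_vector_derivative i2) (at 0)"
    using inversion_derivatives(2)[of e 0 L0] D[of 0] unfolding i1_def D_def by auto
  define \<gamma> where "\<gamma> \<tau> = P + \<tau> *\<^sub>R i0 \<tau>" for \<tau>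
  define \<gamma>1 where "\<gamma>1 \<tau> = i0 \<tau> + \<tau> *\<^sub>R i1 \<tau>" for \<tau>
  have \<gamma>_circ: "\<gamma> \<tau> = circ 0 \<tau> 1" for \<tau> by (simp add: \<gamma>_def circ_def inverted_def \<Lambda>0 i0_def D_def)
  have d1: "(\<gamma> has_vector_derivative \<gamma>1 \<tau>) (at \<tau>)" if "\<tau> \<ge> 0" for \<tau>
    unfolding \<gamma>_def \<gamma>1_def using di0[OF that] by (auto intro!: derivative_eq_intros)
  have d2: "(\<gamma>1 has_vector_derivative 2 *\<^sub>R i1 0) (at 0)"
    unfolding \<gamma>1_def using di0[of 0] di1 by (auto intro!: derivative_eq_intros simp: scaleR_2)
  have \<gamma>0: "\<gamma> 0 = P" by (simp add: \<gamma>_def)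
  have D0: "D 0 = 1" using e(2) by (simp add: D_def)
  have "isCont \<gamma> 0" using d1[of 0] by (intro has_vector_derivative_continuous) auto
  then obtain \<delta> where \<delta>: "\<delta> > 0" "\<And>t. \<bar>t\<bar> < \<delta> \<Longrightarrow> \<gamma> t \<in> U"
    using curve_stays_in_open[of \<gamma> U] P(2) L(4) \<gamma>0 by auto
  have fe: "f' P e = 0" using \<nu>(3) e(3) sym[of \<nu> e] by simp
  have \<gamma>10: "\<gamma>1 0 = e" by (simp add: \<gamma>1_def i0_def D0)
  have g\<nu>L0: "g \<nu> L0 = - q0"
  proof -
    have "g \<nu> L0 = g \<nu> \<xi> - (c * g P \<nu>) / 2" using sym[of \<nu> P] by (simp add: L0_def g_simps)
    also have "g \<nu> \<xi> = - q0" using e(3) sym[of \<nu> e] \<nu>(2) by (simp add: \<xi> g_simps)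
    finally show ?thesis unfolding \<nu>(1) by simp
  qed
  have "f' P (2 *\<^sub>R i1 0) = - 2 * l * q0"
    using g\<nu>L0 e(3) sym[of \<nu> e] by (simp add: \<nu>(3) i1_def D0 g_simps)
  moreover have "f'' P e e \<ge> k0 * l" using hessian_bd[OF lf P l \<nu> e(1) fe] e(2) by simp
  moreover have "k0 * l + (- 2 * l * q0) = l * (k0 - 2 * q0)" by (simp add: algebra_simps)
  moreover have "l * (k0 - 2 * q0) > 0" using l q0 by simp
  ultimately have pos: "f'' P e e + f' P (2 *\<^sub>R i1 0) > 0" by linarith
  have 1: "((\<lambda>t. f (\<gamma> t)) has_real_derivative f' (\<gamma> t) (\<gamma>1 t)) (at t)" if "0 \<le> t" "t < 0 + \<delta>" for t
    using C2_derivs_along(1)[where \<gamma>=\<gamma> and ?d1.0=\<gamma>1 and t=t, OF L(1) \<delta>(2) d1] that by auto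
  have 2: "((\<lambda>t. f' (\<gamma> t) (\<gamma>1 t)) has_real_derivative f'' P e e + f' P (2 *\<^sub>R i1 0)) (at 0)"
    using C2_derivs_along(2)[where \<gamma>=\<gamma> and ?d1.0=\<gamma>1 and t=0, OF L(1) _ d1 d2] P(2) \<gamma>0 \<gamma>10 by simp
  have 0: "f' (\<gamma> 0) (\<gamma>1 0) = 0" using fe \<gamma>0 \<gamma>10 by simp
  have "\<exists>d>0. \<forall>t. 0 < t \<longrightarrow> t < d \<longrightarrow> f (\<gamma> 0) < f (\<gamma> t)"
  proof (rule second_derivative_pos_right[OF \<delta>(1) _ 0 2 pos])
    show "((\<lambda>t. f (\<gamma> t)) has_real_derivative f' (\<gamma> t) (\<gamma>1 t)) (at t)" if "0 \<le> t" "t < 0 + \<delta>" for t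
      using 1[OF that] .
    show ?thesis if "d > 0" "\<And>t. 0 < t \<Longrightarrow> t < 0 + d \<Longrightarrow> f (\<gamma> 0) < f (\<gamma> t)" for d
      using that by auto
  qed
  then obtain d where d: "d > 0" "\<And>t. 0 < t \<Longrightarrow> t < d \<Longrightarrow> f (\<gamma> 0) < f (\<gamma> t)" by blast
  define t where "t = min d \<delta> / 2"
  have t: "0 < t" "t < d" "\<bar>t\<bar> < \<delta>" using d(1) \<delta>(1) by (auto simp: t_def)
  have "f (\<gamma> t) \<le> 0" using L(9)[OF \<delta>(2)[OF t(3)]] in\<Omega>'[OF t(1)] by (simp add: \<gamma>_circ)
  then show False using d(2)[of t] t fP \<gamma>0 by simp
qed

end

lemma inner_riesz:
  fixes \<phi> :: "'e::euclidean_space \<Rightarrow> real"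
  assumes "bounded_linear \<phi>"
  shows "\<exists>n. \<forall>w. \<phi> w = inner n w"
proof (intro exI allI)
  fix w
  show "\<phi> w = inner (adjoint \<phi> 1) w"
    using adjoint_works[of \<phi> w 1] assms by (simp add: linear_conv_bounded_linear inner_commute)
qed

context space_form
begin

text \<open>Two linear conditions, or one if c = 0, leave a nonzero vector in the assumed dimension,
  and tangency makes its square positive.\<close>

lemma exists_unit_tangent:
  assumes P: "P \<in> W"
  obtains e where "c * g P e = 0" "g e e = 1" "g N e = 0"
proof -
  obtain a where a: "\<And>w. g P w = inner a w"
    using inner_riesz[OF g.bounded_linear_right[of P]] by blast
  obtain b where b: "\<And>w. g N w = inner b w"
    using inner_riesz[OF g.bounded_linear_right[of N]] by blast
  define S where "S = (if c = 0 then {b} else {a, b})"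
  have "dim S \<le> card S" by (rule dim_le_card') (simp add: S_def)
  moreover have "card S < DIM('e)" using dim by (auto simp: S_def card_insert_if split: if_splits)
  ultimately have "dim S < DIM('e)" by simp
  then obtain x where x: "x \<noteq> 0" "\<And>y. y \<in> span S \<Longrightarrow> orthogonal x y"
    using orthogonal_to_subspace_exists by metis
  have "b \<in> span S" by (auto simp: S_def intro: span_base)
  then have "inner b x = 0" using x(2)[of b] by (simp add: orthogonal_def inner_commute)
  moreover have "c * inner a x = 0"
  proof (cases "c = 0")
    case False
    then have "a \<in> span S" by (auto simp: S_def intro: span_base)
    then show ?thesis using x(2)[of a] by (simp add: orthogonal_def inner_commute)
  qed simp
  ultimately have x': "c * g P x = 0" "g N x = 0" by (simp_all add: a b)
  have pos: "g x x > 0" using pos_def[OF P x'(1) x(1)] .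
  define k where "k = 1 / sqrt (g x x)"
  show thesis
  proof (rule that[of "k *\<^sub>R x"])
    show "c * g P (k *\<^sub>R x) = 0" "g N (k *\<^sub>R x) = 0" using x' by (auto simp: g_simps)
    show "g (k *\<^sub>R x) (k *\<^sub>R x) = 1" using pos by (simp add: g_simps k_def)
  qed
qed

lemma g_chord:
  assumes "P \<in> M" "Q \<in> M" "c \<noteq> 0"
  shows "g (P - Q) (P - Q) = 2 / c - 2 * g P Q"
  using M_norm'[OF assms(1,3)] M_norm'[OF assms(2,3)] sym[of Q P] by (simp add: g_simps)

end

section \<open>Blaschke's inclusion in the touching ball\<close>

context curved_domain
begin

abbreviation "normal \<equiv> outer_normal M g \<Omega>"

lemma normal_props:
  assumes "P \<in> bd"
  shows "c * g P (normal P) = 0" "g (normal P) (normal P) = 1"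
proof -
  obtain f f' f'' U where lf: "local_fn f f' f'' U" "P \<in> U" using local_fn_exists[OF assms] by metis
  obtain \<nu> l where l: "l > 0" "c * g P \<nu> = 0" "g \<nu> \<nu> = 1" "\<And>w. f' P w = l * g \<nu> w"
    by (rule local_gradient[OF lf(1) assms lf(2)]) blast
  have "normal P = \<nu>" by (rule outer_normal_eq[OF lf(1) assms lf(2) l])
  with l show "c * g P (normal P) = 0" "g (normal P) (normal P) = 1" by simp_all
qed

text \<open>The last inequality says that \<open>Q\<close> lies in the ball of curvature \<open>k0\<close> touching at \<open>P\<close>; the chord
  \<open>P - Q\<close> is taken in the ambient vector space.\<close>

lemma ball_inclusion:
  assumes P: "P \<in> bd" and Q: "Q \<in> inn"
  shows "g (P - Q) (normal P) > 0" "closed_segment Q P \<subseteq> W"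
    "k0 * g (P - Q) (P - Q) \<le> 2 * g (P - Q) (normal P)"
proof -
  obtain f f' f'' U where lf: "local_fn f f' f'' U" and PU: "P \<in> U" using local_fn_exists[OF P] by metis
  note L = local_fnD[OF lf]
  obtain \<nu> l where l: "l > 0" "c * g P \<nu> = 0" "g \<nu> \<nu> = 1" "\<And>w. f' P w = l * g \<nu> w"
    by (rule local_gradient[OF lf P PU]) blast
  have N: "normal P = \<nu>" by (rule outer_normal_eq[OF lf P PU l])
  have PM: "P \<in> M" and PW: "P \<in> W" using P bd_M M_subset_W by auto
  have QM: "Q \<in> M" and QW: "Q \<in> W" using Q inn_M M_subset_W by auto
  have neg: "f' P (Q - P) < 0" by (rule strict_support[OF lf P PU Q])
  then have "l * g \<nu> (Q - P) < 0" by (simp add: l(4))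
  then have "g \<nu> (Q - P) < 0" using l(1) by (simp add: mult_less_0_iff)
  then have pos: "g (P - Q) \<nu> > 0" using sym[of \<nu> P] sym[of \<nu> Q] by (simp add: g_simps)
  then show "g (P - Q) (normal P) > 0" by (simp add: N)
  show seg: "closed_segment Q P \<subseteq> W"
  proof (rule ccontr)
    assume "\<not> ?thesis"
    then have "\<not> convex W" using closed_segment_subset[of Q W P] QW PW by auto
    then have c: "c > 0" and W: "W = - {0}" using segments_W by auto
    \<comment> \<open>If Q is opposite to P, homogeneity gives f' P (Q - P) = 0, against strict
      support.\<close>
    have "0 \<in> closed_segment P Q" using \<open>\<not> closed_segment Q P \<subseteq> W\<close> W by (auto simp: closed_segment_commute[of P Q])
    then obtain s where "Q = s *\<^sub>R P" by (rule segment_through_0) (use QW PW W in auto)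
    moreover have "f' P P = 0" using homogeneous_radial[OF L(1,3) PU] c by simp
    ultimately have "f' P (Q - P) = 0" by (simp add: blinfun.bilinear_simps)
    then show False using neg by simp
  qed
  show "k0 * g (P - Q) (P - Q) \<le> 2 * g (P - Q) (normal P)"
  proof (rule ccontr)
    assume "\<not> ?thesis"
    then have contra: "2 * g (P - Q) \<nu> < k0 * g (P - Q) (P - Q)" by (simp add: N)
    define S where "S = g (P - Q) (P - Q)"
    have "k0 * S > 0" using contra pos by (simp add: S_def)
    then have S: "S > 0" using k0_nonneg by (simp add: zero_less_mult_iff)
    \<comment> \<open>The inversion of Q - P; adding (c/2) P makes it tangent to M at P.\<close>
    define L0 where "L0 = (1 / S) *\<^sub>R (Q - P)"
    have "g (Q - P) (Q - P) = S" by (simp add: S_def g_simps)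
    then have gL0: "g L0 L0 = 1 / S" using S by (simp add: L0_def g.scaleR_left g.scaleR_right)
    define \<xi> where "\<xi> = L0 + (c / 2) *\<^sub>R P"
    have L0: "\<xi> - (c / 2) *\<^sub>R P = L0" by (simp add: \<xi>_def)
    have t\<xi>: "c * g P \<xi> = 0"
    proof (cases "c = 0")
      case False
      have "g P (Q - P) = - S / 2"
        using g_chord[OF PM QM False] M_norm'[OF PM False] by (simp add: S_def g.diff_right)
      then show ?thesis using S M_norm'[OF PM False] False by (simp add: \<xi>_def L0_def g.add_right g.scaleR_right)
    qed simp
    \<comment> \<open>Half the curvature of the circle through Q that is tangent to the boundary at
      P; \<open>contra\<close> says that it is below k0 / 2.\<close>
    define q0 where "q0 = g (P - Q) \<nu> / S"
    have q0: "q0 > 0" "2 * q0 < k0" using pos contra S by (simp_all add: q0_def S_def[symmetric] field_simps)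
    have "g \<xi> \<nu> = g L0 \<nu> + (c * g P \<nu>) / 2" by (simp add: \<xi>_def g_simps)
    then have g\<xi>\<nu>: "g \<xi> \<nu> = - q0"
      using S unfolding l(2) by (simp add: L0_def q0_def g_simps field_simps)
    define T where "T = \<xi> + q0 *\<^sub>R \<nu>"
    have T: "g T \<nu> = 0" using g\<xi>\<nu> l(3) by (simp add: T_def g_simps)
    have "c * g P T = c * g P \<xi> + q0 * (c * g P \<nu>)" by (simp add: T_def g_simps algebra_simps)
    then have cT: "c * g P T = 0" unfolding t\<xi> l(2) by simp
    obtain e p0 where e: "c * g P e = 0" "g e e = 1" "g e \<nu> = 0" "T = p0 *\<^sub>R e" "p0 \<ge> 0"
    proof (cases "T = 0")
      case True
      \<comment> \<open>Here \<xi> is a multiple of \<nu>, so every unit tangent direction of the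
        boundary serves, with p0 = 0.\<close>
      obtain e where "c * g P e = 0" "g e e = 1" "g \<nu> e = 0" by (rule exists_unit_tangent[OF PW])
      then show ?thesis using that[of e 0] True sym[of e \<nu>] by simp
    next
      case False
      have pos: "g T T > 0" using pos_def[OF PW cT False] .
      define k where "k = sqrt (g T T)"
      have k: "k > 0" "k * k = g T T" using pos by (auto simp: k_def)
      show ?thesis
      proof (rule that[of "(1 / k) *\<^sub>R T" k])
        show "c * g P ((1 / k) *\<^sub>R T) = 0" using cT by (auto simp: g_simps)
        show "g ((1 / k) *\<^sub>R T) ((1 / k) *\<^sub>R T) = 1" using k by (simp add: g.scaleR_left g.scaleR_right flip: k(2))
        show "g ((1 / k) *\<^sub>R T) \<nu> = 0" using T by (simp add: g_simps)
      qed (use k in auto)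
    qed
    have \<xi>_eq: "\<xi> = p0 *\<^sub>R e - q0 *\<^sub>R \<nu>" using e(4) by (simp add: T_def algebra_simps)
    have "Q = P + (1 / g L0 L0) *\<^sub>R L0" using S by (simp only: gL0) (simp add: L0_def)
    then have Q_eq: "Q = P + (1 / g (\<xi> - (c/2) *\<^sub>R P) (\<xi> - (c/2) *\<^sub>R P)) *\<^sub>R (\<xi> - (c/2) *\<^sub>R P)"
      unfolding L0 .
    have "g L0 L0 > 0" using gL0 S by simp
    then have LL: "g (\<xi> - (c/2) *\<^sub>R P) (\<xi> - (c/2) *\<^sub>R P) > 0" unfolding L0 .
    have "boundary_arcs g c W \<Omega> k0 f f' f'' U P \<nu> l Q \<xi> e p0 q0"
      by (intro boundary_arcs.intro curved_domain_axioms boundary_arcs_axioms.intro)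
        (fact lf P PU l Q seg e \<xi>_eq q0 LL Q_eq)+
    then show False by (rule boundary_arcs.no_boundary_arcs)
  qed
qed

end

section \<open>Distances and geodesics\<close>

context space_form
begin

lemma path_velocity_tangent:
  assumes \<gamma>: "\<gamma> C1_differentiable_on {0..1}" "\<gamma> ` {0..1} \<subseteq> M" and t: "t \<in> {0..1::real}"
  shows "c * g (\<gamma> t) (velocity \<gamma> t) = 0"
proof (cases "c = 0")
  case False
  have d: "(\<gamma> has_vector_derivative velocity \<gamma> t) (at t within {0..1})"
    using \<gamma>(1) t by (meson C1_differentiable_on_eq has_vector_derivative_at_within vector_derivative_works)
  have "((\<lambda>t. g (\<gamma> t) (\<gamma> t)) has_vector_derivative 2 * g (\<gamma> t) (velocity \<gamma> t)) (at t within {0..1})"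
    using g.has_vector_derivative[OF d d] by (simp add: sym)
  moreover have "((\<lambda>t. g (\<gamma> t) (\<gamma> t)) has_vector_derivative 0) (at t within {0..1})"
    by (rule has_vector_derivative_transform[OF t _ has_vector_derivative_const[of "1 / c"]])
      (use M_norm' False \<gamma>(2) in blast)
  ultimately have "2 * g (\<gamma> t) (velocity \<gamma> t) = 0"
    using t by (intro vector_derivative_unique_within_closed_interval[of 0 1 t "\<lambda>t. g (\<gamma> t) (\<gamma> t)"]) auto
  then show ?thesis by simp
qed simp

definition speed where "speed \<gamma> t = sqrt (g (velocity \<gamma> t) (velocity \<gamma> t))"

lemma speed:
  assumes \<gamma>: "\<gamma> C1_differentiable_on {0..1}" "\<gamma> ` {0..1} \<subseteq> M"
  shows "speed \<gamma> integrable_on {0..1}" "t \<in> {0..1} \<Longrightarrow> speed \<gamma> t \<ge> 0"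
    "t \<in> {0..1} \<Longrightarrow> (speed \<gamma> t)\<^sup>2 = g (velocity \<gamma> t) (velocity \<gamma> t)"
    "integral {0..1} (speed \<gamma>) \<ge> 0"
proof -
  have "continuous_on {0..1} (velocity \<gamma>)" using \<gamma>(1) by (simp add: C1_differentiable_on_eq)
  then have "continuous_on {0..1} (speed \<gamma>)" unfolding speed_def by (intro continuous_intros g.continuous_on)
  then show 1: "speed \<gamma> integrable_on {0..1}" by (rule integrable_continuous_interval)
  have nn: "g (velocity \<gamma> t) (velocity \<gamma> t) \<ge> 0" if "t \<in> {0..1}" for t
    using norm_nonneg_tangent[OF _ path_velocity_tangent[OF \<gamma> that]] \<gamma>(2) that M_subset_W by blast
  then show 2: "t \<in> {0..1} \<Longrightarrow> speed \<gamma> t \<ge> 0" for t by (simp add: speed_def)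
  show "t \<in> {0..1} \<Longrightarrow> (speed \<gamma> t)\<^sup>2 = g (velocity \<gamma> t) (velocity \<gamma> t)" using nn by (simp add: speed_def)
  show "integral {0..1} (speed \<gamma>) \<ge> 0" using 1 2 by (intro integral_nonneg) auto
qed

lemma riem_dist_alt: "riem_dist M g x y = Inf {integral {0..1} (speed \<gamma>) |\<gamma>.
      \<gamma> C1_differentiable_on {0..1} \<and> \<gamma> ` {0..1} \<subseteq> M \<and> \<gamma> 0 = x \<and> \<gamma> 1 = y}"
  unfolding riem_dist_def speed_def ..

lemma riem_dist_upper:
  assumes "\<gamma> C1_differentiable_on {0..1}" "\<gamma> ` {0..1} \<subseteq> M" "\<gamma> 0 = x" "\<gamma> 1 = y"
  shows "riem_dist M g x y \<le> integral {0..1} (speed \<gamma>)"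
  unfolding riem_dist_alt
  by (rule cInf_lower) (use assms speed(4) in \<open>auto intro!: bdd_belowI[of _ 0]\<close>)

text \<open>Calibration: a function whose differential has norm at most 1 on M grows along a path by
  at most its length. A connecting path is assumed because the infimum of the empty set carries no
  information.\<close>

lemma riem_dist_lower:
  assumes slope: "\<And>z v. z \<in> M \<Longrightarrow> c * g z v = 0 \<Longrightarrow> \<bar>D z v\<bar> \<le> sqrt (g v v)"
    and deriv: "\<And>\<gamma> v t S. (\<gamma> has_vector_derivative v) (at t within S) \<Longrightarrow> \<gamma> t \<in> M \<Longrightarrow>
       ((\<lambda>t. b (\<gamma> t)) has_vector_derivative D (\<gamma> t) v) (at t within S)"
    and path: "\<exists>\<gamma>. \<gamma> C1_differentiable_on {0..1} \<and> \<gamma> ` {0..1} \<subseteq> M \<and> \<gamma> 0 = x \<and> \<gamma> 1 = y"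
  shows "b y - b x \<le> riem_dist M g x y"
  unfolding riem_dist_alt
proof (rule cInf_greatest)
  show "{integral {0..1} (speed \<gamma>) |\<gamma>.
      \<gamma> C1_differentiable_on {0..1} \<and> \<gamma> ` {0..1} \<subseteq> M \<and> \<gamma> 0 = x \<and> \<gamma> 1 = y} \<noteq> {}" using path by blast
  fix L assume "L \<in> {integral {0..1} (speed \<gamma>) |\<gamma>.
      \<gamma> C1_differentiable_on {0..1} \<and> \<gamma> ` {0..1} \<subseteq> M \<and> \<gamma> 0 = x \<and> \<gamma> 1 = y}"
  then obtain \<gamma> where \<gamma>: "L = integral {0..1} (speed \<gamma>)" "\<gamma> C1_differentiable_on {0..1}" "\<gamma> ` {0..1} \<subseteq> M"
    "\<gamma> 0 = x" "\<gamma> 1 = y" by blast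
  have vel: "(\<gamma> has_vector_derivative velocity \<gamma> t) (at t within {0..1})" if "t \<in> {0..1}" for t
    using \<gamma>(2) that by (meson C1_differentiable_on_eq has_vector_derivative_at_within vector_derivative_works)
  have "((\<lambda>t. D (\<gamma> t) (velocity \<gamma> t)) has_integral b (\<gamma> 1) - b (\<gamma> 0)) {0..1}"
  proof (rule fundamental_theorem_of_calculus)
    show "((\<lambda>t. b (\<gamma> t)) has_vector_derivative D (\<gamma> t) (velocity \<gamma> t)) (at t within {0..1})"
      if "t \<in> {0..1}" for t
      using deriv[OF vel[OF that]] \<gamma>(3) that by blast
  qed simp
  moreover have "(speed \<gamma> has_integral L) {0..1}"
    using speed(1)[OF \<gamma>(2,3)] \<gamma>(1) by (simp add: has_integral_integrable_integral)
  ultimately have "b (\<gamma> 1) - b (\<gamma> 0) \<le> L"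
  proof (rule has_integral_le)
    fix t :: real assume t: "t \<in> {0..1}"
    have "\<gamma> t \<in> M" using \<gamma>(3) t by blast
    from slope[OF this path_velocity_tangent[OF \<gamma>(2,3) t]]
    show "D (\<gamma> t) (velocity \<gamma> t) \<le> speed \<gamma> t" by (simp add: speed_def)
  qed
  then show "b y - b x \<le> L" using \<gamma>(4,5) by simp
qed

end

section \<open>Geodesics in terms of generalised sine and cosine\<close>

locale space_form_exp = space_form +
  fixes cs sn :: "real \<Rightarrow> real"
  assumes cs_0: "cs 0 = 1" and sn_0: "sn 0 = 0"
    and cs_deriv: "(cs has_real_derivative - c * sn t) (at t)"
    and sn_deriv: "(sn has_real_derivative cs t) (at t)"
    and cs_flat: "c = 0 \<Longrightarrow> cs t = 1" and cs_pos: "c < 0 \<Longrightarrow> cs t > 0"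
begin

lemma cs_sn: "(cs t)\<^sup>2 + c * (sn t)\<^sup>2 = 1"
proof -
  have "((\<lambda>t. (cs t)\<^sup>2 + c * (sn t)\<^sup>2) has_real_derivative 0) (at t)" for t
    by (auto intro!: derivative_eq_intros cs_deriv sn_deriv)
  then have "(cs t)\<^sup>2 + c * (sn t)\<^sup>2 = (cs 0)\<^sup>2 + c * (sn 0)\<^sup>2"
    using DERIV_isconst_all[of "\<lambda>t. (cs t)\<^sup>2 + c * (sn t)\<^sup>2"] by blast
  then show ?thesis by (simp add: cs_0 sn_0)
qed

text \<open>The exponential map: the unit-speed geodesic from Q with initial velocity w.\<close>

definition ray :: "'a \<Rightarrow> 'a \<Rightarrow> real \<Rightarrow> 'a" where
  "ray Q w t = cs t *\<^sub>R Q + sn t *\<^sub>R w"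
definition ray' :: "'a \<Rightarrow> 'a \<Rightarrow> real \<Rightarrow> 'a" where
  "ray' Q w t = (- c * sn t) *\<^sub>R Q + cs t *\<^sub>R w"

lemma ray_0: "ray Q w 0 = Q"
  by (simp add: ray_def cs_0 sn_0)

lemma ray_deriv: "(ray Q w has_vector_derivative ray' Q w t) (at t within S)"
    "(ray' Q w has_vector_derivative - c *\<^sub>R ray Q w t) (at t within S)"
proof -
  have c: "(cs has_real_derivative - c * sn t) (at t within S)" "(sn has_real_derivative cs t) (at t within S)"
    using cs_deriv sn_deriv by (auto intro: has_field_derivative_at_within)
  note d = has_vector_derivative_add[OF has_vector_derivative_scaleR has_vector_derivative_scaleR]
  show "(ray Q w has_vector_derivative ray' Q w t) (at t within S)"
    using d[OF c(1) has_vector_derivative_const[of Q] c(2) has_vector_derivative_const[of w]]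
    unfolding ray_def[abs_def] ray'_def by simp
  show "(ray' Q w has_vector_derivative - c *\<^sub>R ray Q w t) (at t within S)"
    using d[OF DERIV_cmult[OF c(2), of "- c"] has_vector_derivative_const[of Q] c(1) has_vector_derivative_const[of w]]
    unfolding ray_def ray'_def[abs_def] by (simp add: algebra_simps)
qed

context
  fixes Q w
  assumes Q: "Q \<in> M" and w: "c * g Q w = 0" "g w w = 1"
begin

text \<open>Extra factors c are kept so that the identities also hold for c = 0.\<close>

lemma ray_norms: "c * (c * g (ray Q w t) (ray Q w t)) = c" "g (ray' Q w t) (ray' Q w t) = 1"
    "c * g (ray Q w t) (ray' Q w t) = 0" "c * (c * g (ray Q w t) Q) = c * cs t"
proof -
  note Qn = M_norm[OF Q]
  have "c * (c * g (ray Q w t) (ray Q w t)) =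
      (cs t)\<^sup>2 * (c * (c * g Q Q)) + 2 * c * cs t * sn t * (c * g Q w) + c * (c * (sn t)\<^sup>2 * g w w)"
    using sym[of w Q] by (simp add: ray_def g_simps algebra_simps power2_eq_square)
  also have "\<dots> = c * ((cs t)\<^sup>2 + c * (sn t)\<^sup>2)" unfolding Qn w by (simp add: algebra_simps)
  finally show "c * (c * g (ray Q w t) (ray Q w t)) = c" by (simp add: cs_sn)
  have "g (ray' Q w t) (ray' Q w t) =
      (sn t)\<^sup>2 * (c * (c * g Q Q)) - 2 * cs t * sn t * (c * g Q w) + (cs t)\<^sup>2 * g w w"
    using sym[of w Q] by (simp add: ray'_def g_simps algebra_simps power2_eq_square)
  also have "\<dots> = (cs t)\<^sup>2 + c * (sn t)\<^sup>2" unfolding Qn w by (simp add: algebra_simps)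
  finally show "g (ray' Q w t) (ray' Q w t) = 1" by (simp add: cs_sn)
  have "c * g (ray Q w t) (ray' Q w t) =
      - (cs t * sn t) * (c * (c * g Q Q)) + (cs t)\<^sup>2 * (c * g Q w) - c * (sn t)\<^sup>2 * (c * g Q w)
      + c * cs t * sn t * g w w"
    using sym[of w Q] by (simp add: ray_def ray'_def g_simps algebra_simps power2_eq_square)
  then show "c * g (ray Q w t) (ray' Q w t) = 0" unfolding Qn w by simp
  have "c * (c * g (ray Q w t) Q) = cs t * (c * (c * g Q Q)) + c * sn t * (c * g Q w)"
    using sym[of w Q] by (simp add: ray_def g_simps algebra_simps)
  then show "c * (c * g (ray Q w t) Q) = c * cs t" unfolding Qn w by simp
qed

lemma ray_in_M: "ray Q w t \<in> M"
proof (cases "c = 0")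
  case False
  have one: "c * g (ray Q w t) (ray Q w t) = 1" using ray_norms(1)[of t] False by simp
  have "ray Q w t \<in> W"
  proof (cases "c > 0")
    case True
    then have "W = - {0}" using segments_W by auto
    moreover have "ray Q w t \<noteq> 0" using one by (auto simp: g_simps)
    ultimately show ?thesis by simp
  next
    case False
    then have "c < 0" using \<open>c \<noteq> 0\<close> by simp
    moreover have "c * g (ray Q w t) Q = cs t" using ray_norms(4)[of t] \<open>c \<noteq> 0\<close> by simp
    ultimately show ?thesis using sheet[of Q "ray Q w t"] Q M_subset_W one cs_pos by auto
  qed
  then show ?thesis using one by (simp add: M_def)
next
  case True
  then have "M = UNIV" by (rule M_flat)
  then show ?thesis by simp
qed

lemma ray_geodesic: "geodesic_line M g (ray Q w)"
proof -
  have v: "velocity (ray Q w) t = ray' Q w t" for t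
    using ray_deriv(1) by (rule vector_derivative_at)
  have a: "acceleration (ray Q w) t = - c *\<^sub>R ray Q w t" for t
    unfolding v[abs_def] using ray_deriv(2) by (rule vector_derivative_at)
  have "C2_on UNIV (ray Q w)"
  proof (rule C2_on_curveI[OF ray_deriv(1) ray_deriv(2)])
    have "continuous_on UNIV (ray Q w)"
      using ray_deriv(1) by (meson continuous_at_imp_continuous_on has_vector_derivative_continuous)
    then show "continuous_on UNIV (\<lambda>t. - c *\<^sub>R ray Q w t)" by (intro continuous_intros)
  qed
  moreover have "g (acceleration (ray Q w) t) z = 0" if "z \<in> tangent_space M (ray Q w t)" for t z
    using that unfolding tangent_space_M[OF ray_in_M] a by (auto simp: g_simps)
  ultimately show ?thesis
    unfolding geodesic_line_def by (auto simp: v ray_norms(2) intro: ray_in_M)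
qed

lemma ray_path:
  assumes "t \<ge> 0"
  obtains \<gamma> where "\<gamma> C1_differentiable_on {0..1}" "\<gamma> ` {0..1} \<subseteq> M" "\<gamma> 0 = Q" "\<gamma> 1 = ray Q w t"
    "speed \<gamma> = (\<lambda>_. t)"
proof -
  define \<gamma> where "\<gamma> r = ray Q w (t * r)" for r
  have d: "(\<gamma> has_vector_derivative t *\<^sub>R ray' Q w (t * r)) (at r)" for r
  proof -
    have "((\<lambda>r. t * r) has_real_derivative t) (at r)" by (auto intro!: derivative_eq_intros)
    from vector_diff_chain_at[OF this[unfolded has_real_derivative_iff_has_vector_derivative] ray_deriv(1)]
    show ?thesis by (simp add: \<gamma>_def[abs_def] o_def)
  qed
  have v: "velocity \<gamma> r = t *\<^sub>R ray' Q w (t * r)" for r using d by (rule vector_derivative_at)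
  have cr: "continuous_on UNIV (ray' Q w)"
    using ray_deriv(2) by (meson continuous_at_imp_continuous_on has_vector_derivative_continuous)
  have "\<gamma> C1_differentiable_on {0..1}"
    unfolding C1_differentiable_on_eq v
    using d differentiableI_vector by (auto intro!: continuous_intros continuous_on_compose2[OF cr])
  moreover have "speed \<gamma> r = t" for r
    using assms by (simp add: speed_def v g_simps ray_norms(2) real_sqrt_mult)
  moreover have "\<gamma> ` {0..1} \<subseteq> M" "\<gamma> 0 = Q" "\<gamma> 1 = ray Q w t" using ray_in_M ray_0 by (auto simp: \<gamma>_def)
  ultimately show thesis using that[of \<gamma>] by (simp add: fun_eq_iff)
qed

lemma riem_dist_ray:
  assumes "t \<ge> 0"
  shows "riem_dist M g Q (ray Q w t) \<le> t"
proof -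
  obtain \<gamma> where \<gamma>: "\<gamma> C1_differentiable_on {0..1}" "\<gamma> ` {0..1} \<subseteq> M" "\<gamma> 0 = Q" "\<gamma> 1 = ray Q w t"
    "speed \<gamma> = (\<lambda>_. t)" using ray_path[OF assms] .
  then show ?thesis using riem_dist_upper[OF \<gamma>(1-4)] by simp
qed

end

text \<open>The vector \<gamma>'' + c \<gamma> is tangent to M and orthogonal to itself, hence 0,
  and the linear equation \<gamma>'' = - c \<gamma> determines \<gamma>. This is the uniqueness
  behind \<open>radial_direction\<close>.\<close>

lemma geodesic_line_ray:
  assumes \<gamma>: "geodesic_line M g \<gamma>"
  shows "c * g (\<gamma> 0) (velocity \<gamma> 0) = 0" "g (velocity \<gamma> 0) (velocity \<gamma> 0) = 1"
    "\<gamma> = ray (\<gamma> 0) (velocity \<gamma> 0)"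
proof -
  have C2: "C2_on UNIV \<gamma>" and M: "\<gamma> t \<in> M" and unit: "g (velocity \<gamma> t) (velocity \<gamma> t) = 1"
    and acc: "\<And>w. w \<in> tangent_space M (\<gamma> t) \<Longrightarrow> g (acceleration \<gamma> t) w = 0" for t
    using \<gamma> unfolding geodesic_line_def by auto
  note d = C2_on_curveD[OF C2 open_UNIV UNIV_I]
  show "g (velocity \<gamma> 0) (velocity \<gamma> 0) = 1" by (rule unit)
  have tan: "c * g (\<gamma> t) (velocity \<gamma> t) = 0" for t
  proof (cases "c = 0")
    case False
    have "((\<lambda>t. g (\<gamma> t) (\<gamma> t)) has_vector_derivative 2 * g (\<gamma> t) (velocity \<gamma> t)) (at t)"
      using g.has_vector_derivative[OF d(1)[of t] d(1)[of t]] by (simp add: sym)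
    then have "((\<lambda>t. 1 / c) has_vector_derivative 2 * g (\<gamma> t) (velocity \<gamma> t)) (at t)"
      using M_norm'[OF M False] by simp
    then show ?thesis using vector_derivative_unique_at[OF has_vector_derivative_const] by fastforce
  qed simp
  then show "c * g (\<gamma> 0) (velocity \<gamma> 0) = 0" .
  have ode: "acceleration \<gamma> t = - c *\<^sub>R \<gamma> t" for t
  proof -
    define z where "z = acceleration \<gamma> t + c *\<^sub>R \<gamma> t"
    have "c * g (\<gamma> t) (acceleration \<gamma> t) + c = 0"
    proof -
      have "((\<lambda>t. c * g (\<gamma> t) (velocity \<gamma> t)) has_vector_derivative
          c * (g (\<gamma> t) (acceleration \<gamma> t) + g (velocity \<gamma> t) (velocity \<gamma> t))) (at t)"
        using g.has_vector_derivative[OF d(1)[of t] d(2)[of t]] by (intro has_vector_derivative_mult_right)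
      then have "((\<lambda>t. 0) has_vector_derivative c * (g (\<gamma> t) (acceleration \<gamma> t) + 1)) (at t)"
        unfolding tan unit .
      then have "c * (g (\<gamma> t) (acceleration \<gamma> t) + 1) = 0"
        using vector_derivative_unique_at[OF has_vector_derivative_const] by fastforce
      then show ?thesis by (simp add: algebra_simps)
    qed
    moreover have "c * g (\<gamma> t) z = c * g (\<gamma> t) (acceleration \<gamma> t) + c * (c * g (\<gamma> t) (\<gamma> t))"
      by (simp add: z_def g_simps algebra_simps)
    ultimately have zt: "c * g (\<gamma> t) z = 0" using M_norm[OF M[of t]] by simp
    then have "g (acceleration \<gamma> t) z = 0" by (intro acc) (simp add: tangent_space_M[OF M])
    then have "g z z = 0" using zt by (simp add: z_def g.add_left g.scaleR_left)
    then have "z = 0" using pos_def[OF _ zt] M[of t] M_subset_W by force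
    then show ?thesis by (simp add: z_def eq_neg_iff_add_eq_0)
  qed
  \<comment> \<open>Constants of motion: following the flow back by t recovers the initial position
    and the initial velocity.\<close>
  define a where "a t = cs t *\<^sub>R \<gamma> t - sn t *\<^sub>R velocity \<gamma> t" for t
  define b where "b t = (c * sn t) *\<^sub>R \<gamma> t + cs t *\<^sub>R velocity \<gamma> t" for t
  have "(a has_vector_derivative 0) (at t)" for t
    using has_vector_derivative_diff[OF has_vector_derivative_scaleR[OF cs_deriv d(1)] has_vector_derivative_scaleR[OF sn_deriv d(2)], of t]
    unfolding a_def[abs_def] ode by (simp add: algebra_simps)
  then have a: "a t = a 0" for t
    using has_vector_derivative_zero_constant[of UNIV a] by (metis UNIV_I convex_UNIV)
  have "(b has_vector_derivative 0) (at t)" for t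
    using has_vector_derivative_add[OF has_vector_derivative_scaleR[OF DERIV_cmult[OF sn_deriv] d(1)] has_vector_derivative_scaleR[OF cs_deriv d(2)], of c t]
    unfolding b_def[abs_def] ode by (simp add: algebra_simps)
  then have b: "b t = b 0" for t
    using has_vector_derivative_zero_constant[of UNIV b] by (metis UNIV_I convex_UNIV)
  show "\<gamma> = ray (\<gamma> 0) (velocity \<gamma> 0)"
  proof
    fix t
    have "ray (\<gamma> 0) (velocity \<gamma> 0) t = cs t *\<^sub>R a t + sn t *\<^sub>R b t"
      unfolding a[of t] b[of t] by (simp add: ray_def a_def b_def cs_0 sn_0)
    also have "\<dots> = ((cs t)\<^sup>2 + c * (sn t)\<^sup>2) *\<^sub>R \<gamma> t"
      by (simp add: a_def b_def algebra_simps power2_eq_square)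
    finally show "\<gamma> t = ray (\<gamma> 0) (velocity \<gamma> 0) t" by (simp add: cs_sn)
  qed
qed

end

section \<open>The angle estimate\<close>

locale ball_estimate = curved_domain g c W \<Omega> k0 + space_form_exp g c W cs sn
  for g :: "'a::euclidean_space \<Rightarrow> 'a \<Rightarrow> real" and c W \<Omega> k0 cs sn +
  assumes dist_ray: "x \<in> M \<Longrightarrow> y \<in> M \<Longrightarrow> \<exists>w. c * g x w = 0 \<and> g w w = 1 \<and>
      y = ray x w (riem_dist M g x y) \<and> 0 \<le> riem_dist M g x y \<and> 0 \<le> sn (riem_dist M g x y)"
begin

context
  fixes P Q
  assumes P: "P \<in> bd" and Q: "Q \<in> inn"
begin

abbreviation "\<delta> \<equiv> riem_dist M g Q P"
abbreviation "h \<equiv> dist_to_boundary M g \<Omega> Q"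
abbreviation "N \<equiv> normal P"
abbreviation "cos_phi \<equiv> cos (boundary_angle M g \<Omega> Q P)"

lemma PQ_M: "P \<in> M" "Q \<in> M" "P \<in> W" "Q \<in> W"
  using P Q bd_M inn_M M_subset_W by auto

text \<open>If sn \<delta> = 0 then P = Q or P = - Q. The first fails because Q is interior and P is
  not; in the second case 0 would lie on the chord, which stays in W.\<close>

lemma sn_dist_pos: "sn \<delta> > 0"
proof -
  obtain w where w: "P = ray Q w \<delta>" "0 \<le> sn \<delta>" using dist_ray[OF PQ_M(2,1)] by blast
  have "sn \<delta> \<noteq> 0"
  proof
    assume 0: "sn \<delta> = 0"
    then have "(cs \<delta>)\<^sup>2 = 1" using cs_sn[of \<delta>] by simp
    then have "cs \<delta> = 1 \<or> cs \<delta> = - 1" by (simp add: power2_eq_1_iff)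
    moreover have "P = cs \<delta> *\<^sub>R Q" using w(1) 0 by (simp add: ray_def)
    moreover have "P \<noteq> Q" using P Q bd_inn by auto
    ultimately have "P = - Q" "cs \<delta> = - 1" by auto
    then have "c \<noteq> 0" using cs_flat[of \<delta>] by auto
    have "0 = (1 - 1/2) *\<^sub>R Q + (1/2) *\<^sub>R P" using \<open>P = - Q\<close> by simp
    moreover have "(1 - 1/2) *\<^sub>R Q + (1/2) *\<^sub>R P \<in> closed_segment Q P"
      unfolding closed_segment_def by (intro CollectI exI[of _ "1/2"]) auto
    ultimately have "0 \<in> closed_segment Q P" by simp
    then have "0 \<in> W" using ball_inclusion(2)[OF P Q] by blast
    then show False using norm_pos[OF _ \<open>c \<noteq> 0\<close>] by (force simp: g_simps)
  qed
  then show ?thesis using w(2) by simp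
qed

text \<open>Because sn \<delta> > 0, the initial velocity of a geodesic can be read off from its
  position P at time \<delta>, so the definite description is unique. Reversing time expresses Q
  through P and v, and Cauchy-Schwarz keeps the argument of arccos in its domain.\<close>

lemma radial:
  obtains v where "c * g P v = 0" "g v v = 1" "Q = cs \<delta> *\<^sub>R P - sn \<delta> *\<^sub>R v" "cos_phi = g v N"
proof -
  obtain w where w: "c * g Q w = 0" "g w w = 1" "P = ray Q w \<delta>" using dist_ray[OF PQ_M(2,1)] by blast
  define v where "v = ray' Q w \<delta>"
  have vel: "velocity (ray Q w') t = ray' Q w' t" for w' t
    using ray_deriv(1) by (rule vector_derivative_at)
  have rad: "radial_direction M g Q P = v"
    unfolding radial_direction_def
  proof (rule the_equality)
    show "\<exists>\<gamma>. geodesic_line M g \<gamma> \<and> \<gamma> 0 = Q \<and> \<gamma> \<delta> = P \<and> v = velocity \<gamma> \<delta>"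
      using ray_geodesic[OF PQ_M(2) w(1,2)] w(3) vel by (intro exI[of _ "ray Q w"]) (simp add: ray_0 v_def)
    fix v' assume "\<exists>\<gamma>. geodesic_line M g \<gamma> \<and> \<gamma> 0 = Q \<and> \<gamma> \<delta> = P \<and> v' = velocity \<gamma> \<delta>"
    then obtain \<gamma> where \<gamma>: "geodesic_line M g \<gamma>" "\<gamma> 0 = Q" "\<gamma> \<delta> = P" "v' = velocity \<gamma> \<delta>" by blast
    then have \<gamma>_eq: "\<gamma> = ray Q (velocity \<gamma> 0)" using geodesic_line_ray(3)[OF \<gamma>(1)] by simp
    then have "ray Q (velocity \<gamma> 0) \<delta> = ray Q w \<delta>" using \<gamma>(3) w(3) by metis
    then have "velocity \<gamma> 0 = w" using sn_dist_pos by (simp add: ray_def)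
    then have "\<gamma> = ray Q w" using \<gamma>_eq by simp
    then show "v' = v" using \<gamma>(4) vel by (simp add: v_def)
  qed
  note rn = ray_norms[OF PQ_M(2) w(1,2), of \<delta>]
  have v: "c * g P v = 0" "g v v = 1" using rn(2,3) w(3) by (simp_all add: v_def)
  have "cs \<delta> *\<^sub>R P - sn \<delta> *\<^sub>R v = ((cs \<delta>)\<^sup>2 + c * (sn \<delta>)\<^sup>2) *\<^sub>R Q"
    by (subst w(3)) (simp add: v_def ray_def ray'_def algebra_simps power2_eq_square)
  then have Q_eq: "Q = cs \<delta> *\<^sub>R P - sn \<delta> *\<^sub>R v" by (simp add: cs_sn)
  note n = normal_props[OF P]
  have "(g v N)\<^sup>2 \<le> 1" using cauchy_schwarz_tangent[OF PQ_M(3) v(1) n(1)] v(2) n(2) by simp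
  then have "\<bar>g v N\<bar> \<le> 1" by (simp add: abs_square_le_1)
  then have "cos_phi = g v N"
    using v(2) n(2) by (simp add: boundary_angle_def angle_def rad abs_le_iff)
  then show thesis using that v Q_eq by blast
qed

text \<open>Since g(P - Q, N) = sn \<delta> cos \<phi>, this is strict support at P.\<close>

lemma cos_phi_pos: "cos_phi > 0"
proof -
  obtain v where v: "c * g P v = 0" "g v v = 1" "Q = cs \<delta> *\<^sub>R P - sn \<delta> *\<^sub>R v" "cos_phi = g v N"
    by (rule radial)
  note n = normal_props[OF P]
  have PN: "(1 - cs \<delta>) * g P N = 0"
    using n(1) cs_flat[of \<delta>] by auto
  have "g (P - Q) N = (1 - cs \<delta>) * g P N + sn \<delta> * g v N"
    by (subst v(3)) (simp add: g_simps algebra_simps)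
  then have "g (P - Q) N = sn \<delta> * cos_phi" using PN v(4) by simp
  then show ?thesis using ball_inclusion(1)[OF P Q] sn_dist_pos by (simp add: zero_less_mult_iff)
qed

lemma h_bounds: "0 \<le> h" "z \<in> bd \<Longrightarrow> h \<le> riem_dist M g Q z"
proof -
  have nn: "0 \<le> riem_dist M g Q z" if "z \<in> bd" for z using dist_ray[OF PQ_M(2), of z] that bd_M by blast
  then show "0 \<le> h" unfolding dist_to_boundary_def using P by (intro cInf_greatest) auto
  show "h \<le> riem_dist M g Q z" if "z \<in> bd"
    unfolding dist_to_boundary_def using that nn by (intro cInf_lower bdd_belowI[of _ 0]) auto
qed

text \<open>A ray meeting the boundary before time h would give a boundary point closer than h. The
  alternative t = 0 keeps the estimates available without a proof that h > 0.\<close>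

lemma rays_inside:
  assumes w: "c * g Q w = 0" "g w w = 1" and t: "0 \<le> t" "t = 0 \<or> t < h"
  shows "ray Q w t \<in> inn"
proof (cases "t = 0")
  case False
  define K where "K = ray Q w ` {0..t}"
  have rM: "ray Q w s \<in> M" for s by (rule ray_in_M[OF PQ_M(2) w])
  have "continuous_on {0..t} (ray Q w)"
    using ray_deriv(1) by (meson continuous_at_imp_continuous_on has_vector_derivative_continuous)
  then have "connected K" unfolding K_def by (intro connected_continuous_image) auto
  moreover have "K \<subseteq> W" using rM M_subset_W by (auto simp: K_def)
  moreover have "K \<inter> cone bd = {}"
  proof (rule ccontr)
    assume "K \<inter> cone bd \<noteq> {}"
    then obtain s where s: "0 \<le> s" "s \<le> t" "ray Q w s \<in> cone bd" by (auto simp: K_def)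
    then have "ray Q w s \<in> bd" using cone_M_iff[OF rM] by simp
    then have "h \<le> riem_dist M g Q (ray Q w s)" by (rule h_bounds(2))
    also have "\<dots> \<le> s" by (rule riem_dist_ray[OF PQ_M(2) w s(1)])
    finally show False using s(2) t False by simp
  qed
  moreover have "Q \<in> K" using t(1) ray_0[of Q w] by (auto simp: K_def image_iff intro!: bexI[of _ 0])
  then have "K \<inter> cone \<Omega> \<noteq> {}" using Q inn_sub cone_M_iff[OF PQ_M(2)] by blast
  ultimately have "K \<subseteq> cone inn" by (rule connected_off_bd)
  moreover have "ray Q w t \<in> K" using t(1) by (simp add: K_def)
  ultimately show ?thesis using cone_M_iff[OF rM] by blast
qed (use Q ray_0 in simp)

text \<open>\<open>k0 P - N\<close> is a multiple of the centre of the touching ball and \<open>G\<close> is its product with \<open>Q\<close>. The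
  second inequality places the point at distance \<open>t\<close> from \<open>Q\<close>, straight away from the centre, in the ball.\<close>

lemma curved_estimate:
  assumes c: "c \<noteq> 0" and t: "0 \<le> t" "t = 0 \<or> t < h"
  defines "G \<equiv> k0 / c * cs \<delta> + sn \<delta> * cos_phi"
  shows "k0\<^sup>2 / c + 1 - c * G\<^sup>2 \<ge> 0" "k0 / c \<le> cs t * G - sn t * sqrt (k0\<^sup>2 / c + 1 - c * G\<^sup>2)"
proof -
  obtain v where v: "c * g P v = 0" "g v v = 1" "Q = cs \<delta> *\<^sub>R P - sn \<delta> *\<^sub>R v" "cos_phi = g v N"
    by (rule radial)
  note n = normal_props[OF P]
  have PN: "g P N = 0" "g N P = 0" and Pv: "g P v = 0" using n(1) v(1) c sym[of N P] by auto
  have PP: "g P P = 1 / c" and QQ: "g Q Q = 1 / c" using M_norm' PQ_M c by auto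
  define Z where "Z = k0 *\<^sub>R P - N"
  have "g Z Q = k0 * (cs \<delta> * g P P - sn \<delta> * g P v) - (cs \<delta> * g N P - sn \<delta> * g N v)"
    by (subst v(3)) (simp add: Z_def g_simps algebra_simps)
  then have ZQ: "g Z Q = G" using PP PN Pv v(4) sym[of v N] by (simp add: G_def)
  have ZZ: "g Z Z = k0\<^sup>2 / c + 1" using PP PN n(2) by (simp add: Z_def g_simps power2_eq_square)
  \<comment> \<open>The part of Z tangent to M at Q; - T points straight away from the centre of the
    touching ball.\<close>
  define T where "T = Z - (c * G) *\<^sub>R Q"
  have QT: "g Q T = 0" using ZQ QQ c sym[of Q Z] by (simp add: T_def g_simps)
  have ZT: "g Z T = k0\<^sup>2 / c + 1 - c * G\<^sup>2" using ZQ ZZ by (simp add: T_def g_simps power2_eq_square)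
  have TT: "g T T = k0\<^sup>2 / c + 1 - c * G\<^sup>2"
  proof -
    have "g T T = g Z T - c * G * g Q T" by (subst (1) T_def) (simp only: g_simps real_scaleR_def)
    then show ?thesis using QT ZT by simp
  qed
  have inside: "k0 / c \<le> cs t * G + sn t * g Z w" if w: "c * g Q w = 0" "g w w = 1" for w
  proof -
    define X where "X = ray Q w t"
    have X: "X \<in> inn" unfolding X_def by (rule rays_inside[OF w t])
    then have XM: "X \<in> M" using inn_M by auto
    have "k0 * (2 / c - 2 * g P X) \<le> 2 * g (P - X) N"
      using ball_inclusion(3)[OF P X] g_chord[OF PQ_M(1) XM c] by simp
    then have "k0 * (2 / c - 2 * g P X) \<le> - 2 * g N X" using PN sym[of X N] by (simp add: g.diff_left)
    moreover have "k0 * (2 / c - 2 * g P X) = 2 * (k0 / c - k0 * g P X)" by (simp add: algebra_simps)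
    ultimately have "k0 / c \<le> g Z X" by (simp add: Z_def g.diff_left g.scaleR_left)
    also have "g Z X = cs t * G + sn t * g Z w" by (simp add: X_def ray_def g.add_right g.scaleR_right ZQ)
    finally show ?thesis .
  qed
  have nn: "g T T \<ge> 0" using norm_nonneg_tangent[OF PQ_M(4), of T] QT by simp
  then show "k0\<^sup>2 / c + 1 - c * G\<^sup>2 \<ge> 0" using TT by simp
  show "k0 / c \<le> cs t * G - sn t * sqrt (k0\<^sup>2 / c + 1 - c * G\<^sup>2)"
  proof (cases "T = 0")
    case True
    \<comment> \<open>Z is a multiple of Q, so no direction at Q is distinguished and any unit
      tangent vector serves.\<close>
    obtain w where w: "c * g Q w = 0" "g w w = 1" by (rule exists_unit_tangent[OF PQ_M(4)])
    have "Z = (c * G) *\<^sub>R Q" using True by (simp add: T_def)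
    then have "g Z w = 0" using w(1) c by (simp add: g_simps)
    moreover have "k0\<^sup>2 / c + 1 - c * G\<^sup>2 = 0" using TT True by (simp add: g_simps)
    ultimately show ?thesis using inside[OF w] by simp
  next
    case False
    define k where "k = sqrt (g T T)"
    have k: "k > 0" "k * k = g T T" using pos_def[OF PQ_M(4) _ False] QT by (auto simp: k_def)
    define w where "w = (- (1 / k)) *\<^sub>R T"
    have "c * g Q w = 0" using QT by (simp add: w_def g_simps)
    moreover have "g w w = 1" using k by (simp add: w_def g_simps flip: k(2))
    moreover have "g Z w = - k"
    proof -
      have "g Z w = - (1 / k) * (k * k)" using ZT TT k(2) by (simp add: w_def g_simps)
      then show ?thesis using k(1) by simp
    qed
    ultimately show ?thesis using inside[of w] TT by (simp add: k_def)
  qed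
qed

text \<open>The centre of the touching ball is P - N / k0, and y is the vector from it to Q; its
  square is given by the law of cosines with angle \<phi> at P. Moving Q by t along y must not leave
  the ball of radius 1 / k0.\<close>

lemma flat_estimate:
  assumes c: "c = 0" and k0: "k0 > 0" and t: "0 \<le> t" "t = 0 \<or> t < h"
  shows "(sn \<delta>)\<^sup>2 - 2 * sn \<delta> * cos_phi / k0 + 1 / k0\<^sup>2 \<ge> 0"
    "sqrt ((sn \<delta>)\<^sup>2 - 2 * sn \<delta> * cos_phi / k0 + 1 / k0\<^sup>2) + sn t \<le> 1 / k0"
proof -
  obtain v where v: "c * g P v = 0" "g v v = 1" "Q = cs \<delta> *\<^sub>R P - sn \<delta> *\<^sub>R v" "cos_phi = g v N"
    by (rule radial)
  note n = normal_props[OF P]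
  define a where "a = sn \<delta>"
  have Q_eq: "Q = P - a *\<^sub>R v" using v(3) cs_flat[OF c] by (simp add: a_def)
  define y where "y = (1 / k0) *\<^sub>R N - a *\<^sub>R v"
  define q where "q = a\<^sup>2 - 2 * a * cos_phi / k0 + 1 / k0\<^sup>2"
  have yy: "g y y = q"
    using v(2,4) n(2) sym[of N v] by (simp add: y_def q_def g_simps power2_eq_square algebra_simps)
  have nn: "g x x \<ge> 0" for x using norm_nonneg_tangent[OF PQ_M(4), of x] c by simp
  show "(sn \<delta>)\<^sup>2 - 2 * sn \<delta> * cos_phi / k0 + 1 / k0\<^sup>2 \<ge> 0" using nn[of y] yy by (simp add: q_def a_def)
  have inside: "g (y + sn t *\<^sub>R w) (y + sn t *\<^sub>R w) \<le> 1 / k0\<^sup>2" if w: "g w w = 1" for w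
  proof -
    define X where "X = ray Q w t"
    have X: "X \<in> inn" unfolding X_def by (rule rays_inside) (use c w t in auto)
    have "k0 * g (P - X) (P - X) \<le> 2 * g (P - X) N" using ball_inclusion(3)[OF P X] .
    then have b: "g (P - X) (P - X) \<le> 2 * g (P - X) N / k0" using k0 by (simp add: field_simps)
    have "X = Q + sn t *\<^sub>R w" using cs_flat[OF c] by (simp add: X_def ray_def)
    then have eq: "y + sn t *\<^sub>R w = (1 / k0) *\<^sub>R N - (P - X)" by (simp add: y_def Q_eq)
    have "g (y + sn t *\<^sub>R w) (y + sn t *\<^sub>R w) = 1 / k0\<^sup>2 - 2 * g (P - X) N / k0 + g (P - X) (P - X)"
      unfolding eq using n(2) sym[of N "P - X"]
      by (simp add: g.diff_left[of "(1 / k0) *\<^sub>R N"] g.diff_right[of _ "(1 / k0) *\<^sub>R N"]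
          g.scaleR_left g.scaleR_right power2_eq_square diff_divide_distrib)
    then show ?thesis using b by simp
  qed
  have "sqrt q + sn t \<le> 1 / k0"
  proof (cases "y = 0")
    case True
    obtain w where w: "c * g Q w = 0" "g w w = 1" by (rule exists_unit_tangent[OF PQ_M(4)])
    have "(sn t)\<^sup>2 \<le> (1 / k0)\<^sup>2" using inside[OF w(2)] True w(2) by (simp add: g_simps power2_eq_square)
    then have "sn t \<le> 1 / k0" by (rule power2_le_imp_le) (use k0 in simp)
    moreover have "q = 0" using yy True by (simp add: g_simps)
    ultimately show ?thesis by simp
  next
    case False
    define r where "r = sqrt q"
    have r: "r > 0" "r * r = q" using pos_def[OF PQ_M(4) _ False] c yy by (auto simp: r_def)
    define w where "w = (1 / r) *\<^sub>R y"
    have "g w w = 1" using r(1) by (simp add: w_def g_simps yy r(2)[symmetric])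
    moreover have "y + sn t *\<^sub>R w = (1 + sn t / r) *\<^sub>R y" by (simp add: w_def algebra_simps)
    ultimately have "(1 + sn t / r)\<^sup>2 * q \<le> 1 / k0\<^sup>2" using inside[of w] yy by (simp add: g_simps power2_eq_square)
    moreover have "(1 + sn t / r)\<^sup>2 * q = (r + sn t)\<^sup>2"
      using r(1) by (simp add: r(2)[symmetric] power2_eq_square field_simps)
    ultimately have "(r + sn t)\<^sup>2 \<le> (1 / k0)\<^sup>2" by (simp add: power_one_over)
    then have "r + sn t \<le> 1 / k0" by (rule power2_le_imp_le) (use k0 in simp)
    then show ?thesis by (simp add: r_def)
  qed
  then show "sqrt ((sn \<delta>)\<^sup>2 - 2 * sn \<delta> * cos_phi / k0 + 1 / k0\<^sup>2) + sn t \<le> 1 / k0" by (simp add: q_def a_def)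
qed

end

end

section \<open>From the touching ball to the angle: trigonometry of the triangle\<close>

lemma sqrt_quotient_le:
  fixes C x y :: real
  assumes "C \<ge> 0" "y > 0" "y\<^sup>2 - x\<^sup>2 \<le> y\<^sup>2 * C\<^sup>2"
  shows "sqrt (1 - x\<^sup>2 / y\<^sup>2) \<le> C"
proof (rule real_le_lsqrt)
  have "1 - x\<^sup>2 / y\<^sup>2 = (y\<^sup>2 - x\<^sup>2) / y\<^sup>2" using assms(2) by (simp add: field_simps)
  also have "\<dots> \<le> C\<^sup>2" using assms(2,3) by (simp add: divide_le_eq mult.commute)
  finally show "1 - x\<^sup>2 / y\<^sup>2 \<le> C\<^sup>2" .
qed (use assms in simp)

lemma quotient_le_sqrt:
  fixes x y z :: real
  assumes "y > 0" "z\<^sup>2 + x\<^sup>2 \<le> y\<^sup>2"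
  shows "z / y \<le> sqrt (1 - x\<^sup>2 / y\<^sup>2)"
proof (rule real_le_rsqrt)
  have "(z / y)\<^sup>2 = z\<^sup>2 / y\<^sup>2" by (simp add: power_divide)
  also have "\<dots> \<le> (y\<^sup>2 - x\<^sup>2) / y\<^sup>2" using assms by (intro divide_right_mono) auto
  also have "\<dots> = 1 - x\<^sup>2 / y\<^sup>2" using assms(1) by (simp add: field_simps)
  finally show "(z / y)\<^sup>2 \<le> 1 - x\<^sup>2 / y\<^sup>2" .
qed

text \<open>R^2 (1 - C^2) is the squared distance from the centre to the line through O and P. It is
  at most the squared distance X from the centre to O, and sqrt X \<le> R - h.\<close>

lemma flat_conclusion:
  fixes k0 h d C :: real
  assumes k0: "k0 > 0" and h: "0 \<le> h" and C: "0 \<le> C"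
    and X: "d\<^sup>2 - 2 * d * C / k0 + 1 / k0\<^sup>2 \<ge> 0"
    and est: "\<And>t. 0 \<le> t \<Longrightarrow> t = 0 \<or> t < h \<Longrightarrow> sqrt (d\<^sup>2 - 2 * d * C / k0 + 1 / k0\<^sup>2) + t \<le> 1 / k0"
  shows "C \<ge> sqrt (2 * h * k0 - h\<^sup>2 * k0\<^sup>2)" "sqrt (2 * h * k0 - h\<^sup>2 * k0\<^sup>2) \<ge> h * k0"
proof -
  define X where "X = d\<^sup>2 - 2 * d * C / k0 + 1 / k0\<^sup>2"
  define R where "R = 1 / k0"
  have R: "R > 0" "k0 * R = 1" using k0 by (auto simp: R_def)
  \<comment> \<open>The estimate is available only for t < h or t = 0; the bound at h follows by
    density.\<close>
  have "h \<le> R - sqrt X"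
  proof (cases "h = 0")
    case True
    then show ?thesis using est[of 0] by (simp add: X_def R_def)
  next
    case False
    then show ?thesis
      using h est by (intro dense_le_bounded[of 0 h]) (auto simp: X_def R_def algebra_simps)
  qed
  then have sX: "sqrt X \<le> R - h" by simp
  have Xnn: "X \<ge> 0" using X by (simp add: X_def)
  have "(sqrt X)\<^sup>2 \<le> (R - h)\<^sup>2" using sX by (intro power_mono) (use Xnn in auto)
  then have "X \<le> (R - h)\<^sup>2" using Xnn by simp
  \<comment> \<open>Pythagoras: the foot of the perpendicular from the centre lies at distance C R
    from P.\<close>
  moreover have "X = (d - C * R)\<^sup>2 + R\<^sup>2 * (1 - C\<^sup>2)"
    using k0 by (simp add: X_def R_def power2_eq_square field_simps)
  ultimately have "R\<^sup>2 * (1 - C\<^sup>2) \<le> (R - h)\<^sup>2" using zero_le_power2[of "d - C * R"] by linarith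
  then have "k0\<^sup>2 * (R\<^sup>2 * (1 - C\<^sup>2)) \<le> k0\<^sup>2 * (R - h)\<^sup>2" by (intro mult_left_mono) auto
  moreover have "k0\<^sup>2 * (R\<^sup>2 * (1 - C\<^sup>2)) = (k0 * R)\<^sup>2 * (1 - C\<^sup>2)" by (simp add: power_mult_distrib)
  moreover have "k0\<^sup>2 * (R - h)\<^sup>2 = (k0 * R - h * k0)\<^sup>2" by (simp add: power2_eq_square algebra_simps)
  ultimately have "1 - C\<^sup>2 \<le> (1 - h * k0)\<^sup>2" using R(2) by simp
  then have "2 * h * k0 - h\<^sup>2 * k0\<^sup>2 \<le> C\<^sup>2" by (simp add: power2_eq_square algebra_simps)
  then show "C \<ge> sqrt (2 * h * k0 - h\<^sup>2 * k0\<^sup>2)" using C by (intro real_le_lsqrt) auto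
  have "h \<le> R" using sX Xnn real_sqrt_ge_zero[of X] by linarith
  then have "h * k0 \<le> 1" using k0 by (simp add: R_def field_simps)
  then have "(h * k0) * (h * k0) \<le> (h * k0) * 1" using h k0 by (intro mult_left_mono) auto
  then show "sqrt (2 * h * k0 - h\<^sup>2 * k0\<^sup>2) \<ge> h * k0"
    by (intro real_le_rsqrt) (simp add: power2_eq_square algebra_simps)
qed

text \<open>With all lengths multiplied by k, a is cosh of the distance \<theta> from O to the
  centre, and \<open>est\<close> gives \<theta> \<le> \<rho> - \<eta>. Comparison with the
  perpendicular from the centre to the line O P gives sinh \<rho> sin \<phi> \<le> sinh
  \<theta>.\<close>

lemma hyperbolic_conclusion:
  fixes \<rho> \<eta> C D :: real
  defines "a \<equiv> cosh \<rho> * cosh D - sinh \<rho> * sinh D * C"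
  assumes \<rho>: "\<rho> > 0" and \<eta>: "0 \<le> \<eta>" and C: "0 \<le> C" "C \<le> 1" and D: "D \<ge> 0" and a1: "a\<^sup>2 \<ge> 1"
    and est: "\<And>\<tau>. 0 \<le> \<tau> \<Longrightarrow> \<tau> = 0 \<or> \<tau> < \<eta> \<Longrightarrow> cosh \<tau> * a + sinh \<tau> * sqrt (a\<^sup>2 - 1) \<le> cosh \<rho>"
  shows "C \<ge> sqrt (1 - (sinh (\<rho> - \<eta>))\<^sup>2 / (sinh \<rho>)\<^sup>2)"
    "sqrt (1 - (sinh (\<rho> - \<eta>))\<^sup>2 / (sinh \<rho>)\<^sup>2) \<ge> sinh \<eta> / sinh \<rho>"
proof -
  have s: "sinh \<rho> > 0" "sinh D \<ge> 0" using \<rho> D by auto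
  have "sinh \<rho> * sinh D * C \<le> sinh \<rho> * sinh D * 1" using s C by (intro mult_left_mono) auto
  then have "a \<ge> cosh (\<rho> - D)" by (simp add: a_def cosh_diff)
  then have "a > 0" using cosh_real_pos[of "\<rho> - D"] by linarith
  then have a1': "a \<ge> 1" using a1 power2_le_imp_le[of 1 a] by simp
  define \<theta> where "\<theta> = arcosh a"
  have \<theta>: "\<theta> \<ge> 0" "cosh \<theta> = a" "sinh \<theta> = sqrt (a\<^sup>2 - 1)"
    using a1' by (simp_all add: \<theta>_def sinh_arcosh_real)
  have bound: "\<tau> \<le> \<rho> - \<theta>" if "0 \<le> \<tau>" "\<tau> = 0 \<or> \<tau> < \<eta>" for \<tau>
  proof -
    have "cosh (\<tau> + \<theta>) \<le> cosh \<rho>" using est[OF that] by (simp add: cosh_add \<theta>)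
    then show ?thesis using that(1) \<theta>(1) \<rho> by (simp add: cosh_real_nonneg_le_iff)
  qed
  have "\<eta> \<le> \<rho> - \<theta>"
  proof (cases "\<eta> = 0")
    case True
    then show ?thesis using bound[of 0] by simp
  next
    case False
    then show ?thesis using \<eta> bound by (intro dense_le_bounded[of 0 \<eta>]) auto
  qed
  then have \<theta>\<eta>: "\<theta> \<le> \<rho> - \<eta>" by simp
  then have "cosh \<theta> \<le> cosh (\<rho> - \<eta>)" using \<theta>(1) by (simp add: cosh_real_nonneg_le_iff)
  then have "a\<^sup>2 \<le> (cosh (\<rho> - \<eta>))\<^sup>2" using \<open>a > 0\<close> by (intro power_mono) (simp_all add: \<theta>(2))
  \<comment> \<open>The subtracted term is cosh^2 of the perpendicular; a^2 exceeds this minimum by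
    a square.\<close>
  moreover have "a\<^sup>2 - ((cosh \<rho>)\<^sup>2 - (sinh \<rho> * C)\<^sup>2) = (sinh D * cosh \<rho> - cosh D * (sinh \<rho> * C))\<^sup>2"
  proof -
    have cD: "(cosh D)\<^sup>2 = 1 + (sinh D)\<^sup>2" by (simp add: cosh_square_eq)
    have "a\<^sup>2 - (sinh D * cosh \<rho> - cosh D * (sinh \<rho> * C))\<^sup>2 =
       ((cosh D)\<^sup>2 - (sinh D)\<^sup>2) * ((cosh \<rho>)\<^sup>2 - (sinh \<rho> * C)\<^sup>2)"
      by (simp add: a_def power2_eq_square algebra_simps)
    then show ?thesis by (simp add: cD)
  qed
  ultimately have "(cosh \<rho>)\<^sup>2 - (sinh \<rho> * C)\<^sup>2 \<le> (cosh (\<rho> - \<eta>))\<^sup>2"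
    using zero_le_power2[of "sinh D * cosh \<rho> - cosh D * (sinh \<rho> * C)"] by linarith
  then have "(sinh \<rho>)\<^sup>2 - (sinh (\<rho> - \<eta>))\<^sup>2 \<le> (sinh \<rho>)\<^sup>2 * C\<^sup>2"
    by (simp add: cosh_square_eq power_mult_distrib)
  then show "C \<ge> sqrt (1 - (sinh (\<rho> - \<eta>))\<^sup>2 / (sinh \<rho>)\<^sup>2)"
    using C s by (intro sqrt_quotient_le) auto
  define B where "B = \<rho> - \<eta>"
  have B: "B \<ge> 0" "\<rho> = \<eta> + B" using \<theta>\<eta> \<theta>(1) by (auto simp: B_def)
  \<comment> \<open>The second estimate amounts to superadditivity of sinh^2 on nonnegative
    arguments.\<close>
  have "(sinh (\<eta> + B))\<^sup>2 = (sinh \<eta>)\<^sup>2 * (cosh B)\<^sup>2 + (cosh \<eta>)\<^sup>2 * (sinh B)\<^sup>2 + 2 * (sinh \<eta> * cosh B) * (cosh \<eta> * sinh B)"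
    by (simp add: sinh_add power2_eq_square algebra_simps)
  also have "\<dots> = (sinh \<eta>)\<^sup>2 + (sinh B)\<^sup>2 + (2 * (sinh \<eta>)\<^sup>2 * (sinh B)\<^sup>2 + 2 * (sinh \<eta> * cosh B) * (cosh \<eta> * sinh B))"
    by (simp add: cosh_square_eq algebra_simps)
  finally have "(sinh \<eta>)\<^sup>2 + (sinh B)\<^sup>2 \<le> (sinh (\<eta> + B))\<^sup>2" using \<eta> B(1) by simp
  then show "sqrt (1 - (sinh (\<rho> - \<eta>))\<^sup>2 / (sinh \<rho>)\<^sup>2) \<ge> sinh \<eta> / sinh \<rho>"
    using s by (intro quotient_le_sqrt) (auto simp: B_def)
qed

text \<open>The perpendicular argument again, now limited by the range on which cos is monotone. The
  bound \<rho> \<le> \<pi> / 2, a consequence of k0 \<ge> 0, supplies the signs of the cosines that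
  are squared or dropped.\<close>

lemma spherical_conclusion:
  fixes \<rho> \<eta> C D :: real
  defines "a \<equiv> cos \<rho> * cos D + sin \<rho> * sin D * C"
  assumes \<rho>: "0 < \<rho>" "\<rho> \<le> pi / 2" and \<eta>: "0 \<le> \<eta>" and C: "0 \<le> C" and a1: "a\<^sup>2 \<le> 1"
    and est: "\<And>\<tau>. 0 \<le> \<tau> \<Longrightarrow> \<tau> = 0 \<or> \<tau> < \<eta> \<Longrightarrow> cos \<rho> \<le> cos \<tau> * a - sin \<tau> * sqrt (1 - a\<^sup>2)"
  shows "C \<ge> sqrt (1 - (sin (\<rho> - \<eta>))\<^sup>2 / (sin \<rho>)\<^sup>2)"
    "sqrt (1 - (sin (\<rho> - \<eta>))\<^sup>2 / (sin \<rho>)\<^sup>2) \<ge> sin \<eta> / sin \<rho>"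
proof -
  have s: "sin \<rho> > 0" using \<rho> pi_gt_zero by (intro sin_gt_zero) linarith+
  have a: "-1 \<le> a" "a \<le> 1" using a1 by (auto simp: abs_square_le_1 abs_le_iff)
  define \<theta> where "\<theta> = arccos a"
  have \<theta>: "0 \<le> \<theta>" "\<theta> \<le> pi" "cos \<theta> = a" "sin \<theta> = sqrt (1 - a\<^sup>2)"
    using a by (simp_all add: \<theta>_def arccos_lbound arccos_ubound sin_arccos)
  have bound: "cos \<rho> \<le> cos (\<tau> + \<theta>)" if "0 \<le> \<tau>" "\<tau> = 0 \<or> \<tau> < \<eta>" for \<tau>
    using est[OF that] by (simp add: cos_add \<theta>)
  have \<theta>\<rho>: "\<theta> \<le> \<rho>"
  proof -
    have "cos \<rho> \<le> cos \<theta>" using bound[of 0] by simp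
    then show ?thesis using cos_mono_le_eq[of \<rho> \<theta>] \<theta>(1,2) \<rho> pi_gt_zero by auto
  qed
  have \<theta>\<eta>: "\<theta> + \<eta> \<le> \<rho>"
  proof (rule ccontr)
    assume "\<not> ?thesis"
    then have "\<rho> < min (\<theta> + \<eta>) pi" using \<rho> pi_gt_zero by auto
    \<comment> \<open>\<theta> + \<eta> might exceed \<pi>, so the contradiction is sought at an
      intermediate \<sigma> below \<pi>, where cos is still decreasing.\<close>
    then obtain \<sigma> where \<sigma>: "\<rho> < \<sigma>" "\<sigma> < min (\<theta> + \<eta>) pi" using dense by blast
    have "cos \<rho> \<le> cos ((\<sigma> - \<theta>) + \<theta>)" using \<sigma> \<theta>\<rho> by (intro bound) auto
    moreover have "cos \<sigma> < cos \<rho>" using \<sigma> \<rho> by (intro cos_monotone_0_pi) auto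
    ultimately show False by simp
  qed
  have "cos (\<rho> - \<eta>) \<le> cos \<theta>" using \<theta>(1) \<theta>\<eta> \<rho> \<eta> by (intro cos_monotone_0_pi_le) auto
  moreover have c0: "cos (\<rho> - \<eta>) \<ge> 0" using \<theta>\<eta> \<theta>(1) \<rho> \<eta> by (intro cos_ge_zero) auto
  ultimately have "(cos (\<rho> - \<eta>))\<^sup>2 \<le> a\<^sup>2" by (intro power_mono) (simp_all add: \<theta>(3))
  moreover have "a\<^sup>2 + (cos \<rho> * sin D - sin \<rho> * C * cos D)\<^sup>2 = (cos \<rho>)\<^sup>2 + (sin \<rho> * C)\<^sup>2"
  proof -
    have id: "(p * x + q * y)\<^sup>2 + (p * y - q * x)\<^sup>2 = (y\<^sup>2 + x\<^sup>2) * (p\<^sup>2 + q\<^sup>2)" for p q x y :: real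
      by (simp add: power2_eq_square algebra_simps)
    have "a = cos \<rho> * cos D + sin \<rho> * C * sin D" by (simp add: a_def)
    then show ?thesis using id[of "cos \<rho>" "cos D" "sin \<rho> * C" "sin D"] by simp
  qed
  ultimately have "(cos (\<rho> - \<eta>))\<^sup>2 \<le> (cos \<rho>)\<^sup>2 + (sin \<rho> * C)\<^sup>2"
    using zero_le_power2[of "cos \<rho> * sin D - sin \<rho> * C * cos D"] by linarith
  then have "(sin \<rho>)\<^sup>2 - (sin (\<rho> - \<eta>))\<^sup>2 \<le> (sin \<rho>)\<^sup>2 * C\<^sup>2"
    by (simp add: cos_squared_eq power_mult_distrib)
  then show "C \<ge> sqrt (1 - (sin (\<rho> - \<eta>))\<^sup>2 / (sin \<rho>)\<^sup>2)"
    using C s by (intro sqrt_quotient_le) auto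
  define B where "B = \<rho> - \<eta>"
  have B: "B \<ge> 0" "\<rho> = \<eta> + B" using \<theta>\<eta> \<theta>(1) by (auto simp: B_def)
  \<comment> \<open>In this form the mixed term has the sign of cos (\<eta> + B) = cos \<rho> \<ge>
    0.\<close>
  have eq: "(sin (\<eta> + B))\<^sup>2 = (sin \<eta>)\<^sup>2 + (sin B)\<^sup>2 + 2 * (sin \<eta> * sin B) * cos (\<eta> + B)"
  proof -
    have "(sin (\<eta> + B))\<^sup>2 = (sin \<eta>)\<^sup>2 * (cos B)\<^sup>2 + (cos \<eta>)\<^sup>2 * (sin B)\<^sup>2 + 2 * (sin \<eta> * sin B) * (cos \<eta> * cos B)"
      by (simp add: sin_add power2_eq_square algebra_simps)
    also have "\<dots> = (sin \<eta>)\<^sup>2 + (sin B)\<^sup>2 + 2 * (sin \<eta> * sin B) * (cos \<eta> * cos B - sin \<eta> * sin B)"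
      by (simp add: cos_squared_eq algebra_simps) (simp add: power2_eq_square)
    finally show ?thesis by (simp add: cos_add)
  qed
  have "sin \<eta> \<ge> 0" "sin B \<ge> 0" "cos (\<eta> + B) \<ge> 0"
    using \<eta> B \<rho> pi_gt_zero by (auto intro!: sin_ge_zero cos_ge_zero)
  then have "(sin \<eta>)\<^sup>2 + (sin B)\<^sup>2 \<le> (sin (\<eta> + B))\<^sup>2" unfolding eq by simp
  then show "sqrt (1 - (sin (\<rho> - \<eta>))\<^sup>2 / (sin \<rho>)\<^sup>2) \<ge> sin \<eta> / sin \<rho>"
    using s by (intro quotient_le_sqrt) (auto simp: B_def)
qed

context space_form
begin

text \<open>The second factor is the square of the projection of w to the tangent space at z, that
  is, of the gradient of z \<mapsto> g(z, w) on M. It supplies the slope condition for the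
  calibrations on hyperbolic space and the sphere.\<close>

lemma slope_bound:
  assumes z: "z \<in> M" and v: "c * g z v = 0"
  shows "(g v w)\<^sup>2 \<le> g v v * (g w w - c * (g z w)\<^sup>2)"
proof -
  define T where "T = w - (c * g z w) *\<^sub>R z"
  have "c * g z T = c * g z w - g z w * (c * (c * g z z))" by (simp add: T_def g_simps algebra_simps)
  then have T: "c * g z T = 0" unfolding M_norm[OF z] by simp
  have "g v T = g v w - g z w * (c * g z v)" using sym[of v z] by (simp add: T_def g_simps)
  then have vT: "g v T = g v w" unfolding v by simp
  have "g T T = g w w - 2 * c * (g z w)\<^sup>2 + (g z w)\<^sup>2 * (c * (c * g z z))"
    using sym[of w z] by (simp add: T_def g_simps power2_eq_square algebra_simps)
  then have TT: "g T T = g w w - c * (g z w)\<^sup>2" unfolding M_norm[OF z] by (simp add: algebra_simps)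
  have "z \<in> W" using z M_subset_W by auto
  from cauchy_schwarz_tangent[OF this v T] show ?thesis by (simp add: vT TT)
qed

end

lemma (in space_form_exp) dist_rayI:
  assumes Q: "Q \<in> M" and w: "c * g Q w = 0" "g w w = 1" and t: "0 \<le> t" "0 \<le> sn t"
    and y: "y = ray Q w t" and lower: "t \<le> riem_dist M g Q y"
  shows "\<exists>w. c * g Q w = 0 \<and> g w w = 1 \<and> y = ray Q w (riem_dist M g Q y) \<and>
      0 \<le> riem_dist M g Q y \<and> 0 \<le> sn (riem_dist M g Q y)"
proof -
  have "riem_dist M g Q y = t" using riem_dist_ray[OF Q w t(1)] lower y by simp
  then show ?thesis using w y t by auto
qed

section \<open>Euclidean space\<close>

lemma space_form_exp_euclidean:
  assumes "DIM('a::euclidean_space) \<ge> 2"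
  shows "space_form_exp (inner :: 'a \<Rightarrow> 'a \<Rightarrow> real) 0 UNIV (\<lambda>_. 1) (\<lambda>t. t)"
proof (intro space_form_exp.intro space_form.intro space_form_axioms.intro space_form_exp_axioms.intro
    bounded_bilinear_inner)
  show "bounded_linear \<phi> \<Longrightarrow> \<exists>n. \<forall>w. \<phi> w = inner n w" for \<phi> :: "'a \<Rightarrow> real" by (rule inner_riesz)
  show "((\<lambda>_. 1) has_real_derivative - 0 * t) (at t)" "((\<lambda>t. t) has_real_derivative 1) (at t)" for t :: real
    by (auto intro!: derivative_eq_intros)
qed (use assms in \<open>auto simp: inner_commute\<close>)

lemma dist_ray_euclidean:
  fixes x y :: "'a::euclidean_space"
  assumes "DIM('a) \<ge> 2"
  shows "\<exists>w. inner w w = 1 \<and> y = x + riem_dist UNIV inner x y *\<^sub>R w \<and> 0 \<le> riem_dist UNIV inner x y"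
proof -
  interpret E: space_form_exp "inner :: 'a \<Rightarrow> 'a \<Rightarrow> real" 0 UNIV "\<lambda>_. 1" "\<lambda>t. t"
    by (rule space_form_exp_euclidean[OF assms])
  have M: "E.M = UNIV" by (rule E.M_flat) simp
  have ray: "E.ray Q w t = Q + t *\<^sub>R w" for Q w t by (simp add: E.ray_def)
  obtain w t where w: "inner w w = 1" "y = x + t *\<^sub>R w" "t \<ge> 0"
  proof (cases "x = y")
    case True
    obtain w :: 'a where "inner w w = 1" by (rule E.exists_unit_tangent[OF UNIV_I, of x x]) blast
    then show ?thesis using that[of w 0] True by simp
  next
    case False
    then show ?thesis
      using that[of "(1 / norm (y - x)) *\<^sub>R (y - x)" "norm (y - x)"]
      by (simp add: power2_norm_eq_inner[symmetric] power2_eq_square)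
  qed
  \<comment> \<open>The linear function with gradient w calibrates the straight segment.\<close>
  have "inner y w - inner x w \<le> riem_dist E.M inner x y"
  proof (rule E.riem_dist_lower[where D="\<lambda>z v. inner v w"])
    show "\<bar>inner v w\<bar> \<le> sqrt (inner v v)" for v
      using Cauchy_Schwarz_ineq2[of v w] w(1) by (simp add: norm_eq_sqrt_inner)
    show "((\<lambda>t. inner (\<gamma> t) w) has_vector_derivative inner v w) (at t within S)"
      if "(\<gamma> has_vector_derivative v) (at t within S)" for \<gamma> v t S
      using bounded_linear.has_vector_derivative[OF bounded_linear_inner_left that] .
    show "\<exists>\<gamma>. \<gamma> C1_differentiable_on {0..1} \<and> \<gamma> ` {0..1} \<subseteq> E.M \<and> \<gamma> 0 = x \<and> \<gamma> 1 = y"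
      by (rule E.ray_path[of x w t]) (use w M ray in auto)
  qed
  then have "t \<le> riem_dist E.M inner x y" using w(1,2) by (simp add: inner_add_left)
  then have "\<exists>w. 0 * inner x w = 0 \<and> inner w w = 1 \<and> y = E.ray x w (riem_dist E.M inner x y) \<and>
      0 \<le> riem_dist E.M inner x y \<and> 0 \<le> riem_dist E.M inner x y"
    using w M ray by (intro E.dist_rayI[of x w t y]) simp_all
  then show ?thesis unfolding ray M by blast
qed

lemma ball_estimate_euclidean:
  fixes \<Omega> :: "'a::euclidean_space set"
  assumes dim: "DIM('a) \<ge> 2" and dom: "compact_C2_domain UNIV \<Omega>"
    and k0: "k0 > 0" "normal_curvatures_ge UNIV inner \<Omega> k0"
  shows "ball_estimate inner 0 UNIV \<Omega> k0 (\<lambda>_. 1) (\<lambda>t. t)"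
proof -
  interpret E: space_form_exp "inner :: 'a \<Rightarrow> 'a \<Rightarrow> real" 0 UNIV "\<lambda>_. 1" "\<lambda>t. t"
    by (rule space_form_exp_euclidean[OF dim])
  have M: "E.M = UNIV" by (rule E.M_flat) simp
  show ?thesis
  proof unfold_locales
    show "closed_domain E.M \<Omega>" "C2_hypersurface E.M (boundary_in E.M \<Omega>)"
      using dom by (simp_all add: M compact_C2_domain_def)
    show "0 \<le> k0" "normal_curvatures_ge E.M inner \<Omega> k0" using k0 by (simp_all add: M)
    show "\<exists>w. 0 * inner x w = 0 \<and> inner w w = 1 \<and> y = E.ray x w (riem_dist E.M inner x y) \<and>
        0 \<le> riem_dist E.M inner x y \<and> 0 \<le> riem_dist E.M inner x y" for x y
      using dist_ray_euclidean[OF dim, of y x] by (simp add: M E.ray_def)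
  qed
qed

lemma euclidean_theorem:
  fixes \<Omega> :: "'a::euclidean_space set"
  assumes dim: "DIM('a) \<ge> 2" and dom: "compact_C2_domain UNIV \<Omega>"
    and k0: "k0 > 0" "normal_curvatures_ge UNIV inner \<Omega> k0"
    and Q: "Q \<in> top_of_set UNIV interior_of \<Omega>" and P: "P \<in> boundary_in UNIV \<Omega>"
  defines "h \<equiv> dist_to_boundary UNIV inner \<Omega> Q"
  shows "cos (boundary_angle UNIV inner \<Omega> Q P) \<ge> sqrt (2 * h * k0 - h\<^sup>2 * k0\<^sup>2)"
    "sqrt (2 * h * k0 - h\<^sup>2 * k0\<^sup>2) \<ge> h * k0"
proof -
  interpret E: ball_estimate "inner :: 'a \<Rightarrow> 'a \<Rightarrow> real" 0 UNIV \<Omega> k0 "\<lambda>_. 1" "\<lambda>t. t"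
    by (rule ball_estimate_euclidean[OF dim dom k0])
  have M: "E.M = UNIV" by (rule E.M_flat) simp
  have PQ: "P \<in> boundary_in E.M \<Omega>" "Q \<in> top_of_set E.M interior_of \<Omega>" using P Q unfolding M by auto
  have h: "h = dist_to_boundary E.M inner \<Omega> Q" unfolding h_def M ..
  note est = E.flat_estimate[OF PQ refl k0(1), folded h]
  note concl = flat_conclusion[OF k0(1) E.h_bounds(1)[OF PQ, folded h] less_imp_le[OF E.cos_phi_pos[OF PQ]]
      est(1)[OF order_refl] est(2)]
  show "cos (boundary_angle UNIV inner \<Omega> Q P) \<ge> sqrt (2 * h * k0 - h\<^sup>2 * k0\<^sup>2)"
    "sqrt (2 * h * k0 - h\<^sup>2 * k0\<^sup>2) \<ge> h * k0"
    using concl unfolding M by blast+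
qed

section \<open>Hyperbolic space\<close>

lemma minkowski_eq_inner: "minkowski x y = inner (fst x, - snd x) y"
  by (simp add: minkowski_def inner_prod_def)

lemma bounded_bilinear_minkowski:
  "bounded_bilinear (minkowski :: 'a::euclidean_space \<times> real \<Rightarrow> 'a \<times> real \<Rightarrow> real)"
proof -
  have "bounded_linear (\<lambda>x :: 'a \<times> real. (fst x, - snd x))"
    by (intro bounded_linear_Pair bounded_linear_fst bounded_linear_minus bounded_linear_snd)
  from bounded_bilinear.comp1[OF bounded_bilinear_inner this]
  show ?thesis by (simp add: minkowski_eq_inner[abs_def])
qed

lemma minkowski_sym: "minkowski x y = minkowski y x"
  by (simp add: minkowski_def inner_commute)

abbreviation future_cone :: "('a::euclidean_space \<times> real) set" where
  "future_cone \<equiv> {z. norm (fst z) < snd z}"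

lemma minkowski_self: "minkowski z z = (norm (fst z))\<^sup>2 - (snd z)\<^sup>2"
  by (simp add: minkowski_def power2_norm_eq_inner flip: power2_eq_square)

lemma future_cone_pos: "z \<in> future_cone \<Longrightarrow> snd z > 0"
  by (metis mem_Collect_eq norm_ge_zero order_le_less_trans)

lemma minkowski_neg:
  assumes "x \<in> future_cone" "y \<in> future_cone"
  shows "minkowski x y < 0"
proof -
  have "inner (fst x) (fst y) \<le> norm (fst x) * norm (fst y)" by (rule norm_cauchy_schwarz)
  also have "\<dots> < snd x * snd y" 
    using assms future_cone_pos[OF assms(1)] by (intro mult_strict_mono) auto
  finally show ?thesis by (simp add: minkowski_def)
qed

lemma future_cone_iff: "z \<in> future_cone \<longleftrightarrow> minkowski z z < 0 \<and> snd z > 0"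
proof
  assume "z \<in> future_cone"
  then show "minkowski z z < 0 \<and> snd z > 0"
    using minkowski_neg[of z z] future_cone_pos[of z] by blast
next
  assume z: "minkowski z z < 0 \<and> snd z > 0"
  then have "(norm (fst z))\<^sup>2 < (snd z)\<^sup>2" by (simp add: minkowski_self)
  then show "z \<in> future_cone" using z power2_less_imp_less[of "norm (fst z)" "snd z"] by simp
qed

text \<open>Orthogonality to a timelike z expresses \<open>snd v\<close> through the space parts,
  and Cauchy-Schwarz there makes it smaller than \<open>norm (fst v)\<close>.\<close>

lemma minkowski_positive:
  assumes z: "z \<in> future_cone" and v: "minkowski z v = 0" "v \<noteq> 0"
  shows "minkowski v v > 0"
proof -
  have sz: "snd z > 0" "norm (fst z) < snd z" using z future_cone_pos[OF z] by auto
  have eq: "snd z * snd v = inner (fst z) (fst v)" using v(1) by (simp add: minkowski_def)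
  have "fst v \<noteq> 0"
  proof
    assume "fst v = 0"
    then have "snd v = 0" using eq sz by simp
    then show False using v(2) \<open>fst v = 0\<close> by (simp add: prod_eq_iff)
  qed
  then have "norm (fst z) * norm (fst v) < snd z * norm (fst v)" using sz by simp
  moreover have "snd z * \<bar>snd v\<bar> = \<bar>snd z * snd v\<bar>" using sz(1) by (simp add: abs_mult)
  then have "snd z * \<bar>snd v\<bar> \<le> norm (fst z) * norm (fst v)"
    unfolding eq using Cauchy_Schwarz_ineq2[of "fst z" "fst v"] by simp
  ultimately have "snd z * \<bar>snd v\<bar> < snd z * norm (fst v)" by linarith
  then have "\<bar>snd v\<bar> < norm (fst v)" using sz(1) by simp
  then have "\<bar>snd v\<bar>\<^sup>2 < (norm (fst v))\<^sup>2" by (intro power_strict_mono) auto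
  then show ?thesis by (simp add: minkowski_self)
qed

text \<open>Otherwise - z would be in the future cone, and its product with x would be negative
  too.\<close>

lemma minkowski_sheet:
  assumes x: "x \<in> future_cone" and z: "minkowski z z < 0" "minkowski z x < 0"
  shows "z \<in> future_cone"
proof (rule ccontr)
  assume "z \<notin> future_cone"
  then have "snd z \<le> 0" using z(1) by (metis future_cone_iff not_less)
  have "(norm (fst z))\<^sup>2 < (snd z)\<^sup>2" using z(1) by (simp add: minkowski_self)
  then have "- z \<in> future_cone"
    using power2_less_imp_less[of "norm (fst z)" "- snd z"] \<open>snd z \<le> 0\<close> by simp
  from minkowski_neg[OF this x] show False using z(2) by (simp add: minkowski_def)
qed

lemma convex_future_cone: "convex future_cone"
proof (rule convexI)
  fix x y :: "'a \<times> real" and u v :: real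
  assume xy: "x \<in> future_cone" "y \<in> future_cone" and uv: "0 \<le> u" "0 \<le> v" "u + v = 1"
  have "norm (fst (u *\<^sub>R x + v *\<^sub>R y)) \<le> u * norm (fst x) + v * norm (fst y)"
    using uv norm_triangle_ineq[of "u *\<^sub>R fst x" "v *\<^sub>R fst y"] by simp
  also have "\<dots> < u * snd x + v * snd y"
  proof (cases "u = 0")
    case True
    then show ?thesis using uv xy by simp
  next
    case False
    then have "u * norm (fst x) < u * snd x" using uv xy by simp
    moreover have "v * norm (fst y) \<le> v * snd y" using uv xy by (intro mult_left_mono) auto
    ultimately show ?thesis by linarith
  qed
  finally show "u *\<^sub>R x + v *\<^sub>R y \<in> future_cone" by simp
qed

lemma space_form_exp_hyperbolic:
  assumes "DIM('a::euclidean_space) \<ge> 2" and k: "k > 0"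
  shows "space_form_exp (minkowski :: 'a \<times> real \<Rightarrow> 'a \<times> real \<Rightarrow> real) (- k\<^sup>2) future_cone
    (\<lambda>t. cosh (k * t)) (\<lambda>t. sinh (k * t) / k)"
proof (intro space_form_exp.intro space_form.intro space_form_axioms.intro space_form_exp_axioms.intro
    bounded_bilinear_minkowski minkowski_sym)
  show "\<exists>n. \<forall>w. \<phi> w = minkowski n w" if "bounded_linear \<phi>" for \<phi> :: "'a \<times> real \<Rightarrow> real"
  proof -
    obtain a where "\<And>w. \<phi> w = inner a w" using inner_riesz[OF \<open>bounded_linear \<phi>\<close>] by blast
    then show ?thesis by (intro exI[of _ "(fst a, - snd a)"]) (simp add: minkowski_eq_inner)
  qed
  show "open (future_cone :: ('a \<times> real) set)"
    by (intro open_Collect_less continuous_intros)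
  show "((\<lambda>t. cosh (k * t)) has_real_derivative - (- k\<^sup>2) * (sinh (k * t) / k)) (at t)"
    "((\<lambda>t. sinh (k * t) / k) has_real_derivative cosh (k * t)) (at t)" for t
    using k by (auto intro!: derivative_eq_intros simp: power2_eq_square)
  show "convex (future_cone :: ('a \<times> real) set) \<and> - k\<^sup>2 \<le> 0 \<or> - k\<^sup>2 > 0 \<and> (future_cone :: ('a \<times> real) set) = - {0}"
    using convex_future_cone by simp
  show "r *\<^sub>R z \<in> future_cone" if "z \<in> future_cone" "r > 0" for z :: "'a \<times> real" and r
    using that by simp
  show "- k\<^sup>2 * minkowski z z > 0" if "z \<in> future_cone" for z :: "'a \<times> real"
    using minkowski_neg[OF that that] k by (simp add: mult_pos_neg)
  show "minkowski v v > 0" if "z \<in> future_cone" "- k\<^sup>2 * minkowski z v = 0" "v \<noteq> 0" for z v :: "'a \<times> real"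
    using minkowski_positive[OF that(1) _ that(3)] that(2) k by simp
  show "z \<in> future_cone" if "x \<in> future_cone" "- k\<^sup>2 * minkowski z z > 0" "- k\<^sup>2 * minkowski z x > 0" for x z :: "'a \<times> real"
    using minkowski_sheet[OF that(1), of z] that(2,3) k by (simp add: mult_less_0_iff)
  show "(if - k\<^sup>2 = 0 then 2 else 3) \<le> DIM('a \<times> real)" using assms(1) by simp
qed (use k in auto)

lemma hyperbolic_M:
  assumes "k > 0"
  shows "{z \<in> future_cone. - k\<^sup>2 \<noteq> 0 \<longrightarrow> - k\<^sup>2 * minkowski z z = 1} = hyperbolic_space k"
proof -
  have "z \<in> future_cone \<and> - k\<^sup>2 * minkowski z z = 1 \<longleftrightarrow> minkowski z z = - (1 / k\<^sup>2) \<and> snd z > 0" for z :: "'a \<times> real"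
  proof -
    have "- k\<^sup>2 * minkowski z z = 1 \<longleftrightarrow> minkowski z z = - (1 / k\<^sup>2)"
      using assms by (auto simp: field_simps)
    then show ?thesis using assms by (auto simp: future_cone_iff simp del: mem_Collect_eq)
  qed
  then show ?thesis using assms by (auto simp: hyperbolic_space_def)
qed

lemma ball_estimate_hyperbolic:
  fixes \<Omega> :: "('a::euclidean_space \<times> real) set"
  assumes dim: "DIM('a) \<ge> 2" and k: "k > 0" and dom: "compact_C2_domain (hyperbolic_space k) \<Omega>"
    and k0: "k0 > k" "normal_curvatures_ge (hyperbolic_space k) minkowski \<Omega> k0"
  shows "ball_estimate minkowski (- k\<^sup>2) future_cone \<Omega> k0 (\<lambda>t. cosh (k * t)) (\<lambda>t. sinh (k * t) / k)"
proof -
  interpret E: space_form_exp "minkowski :: 'a \<times> real \<Rightarrow> 'a \<times> real \<Rightarrow> real" "- k\<^sup>2" future_cone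
    "\<lambda>t. cosh (k * t)" "\<lambda>t. sinh (k * t) / k"
    by (rule space_form_exp_hyperbolic[OF dim k])
  have M: "E.M = hyperbolic_space k" unfolding E.M_def by (rule hyperbolic_M[OF k])
  have c: "- k\<^sup>2 \<noteq> 0" using k by simp
  show ?thesis
  proof (intro ball_estimate.intro curved_domain.intro domain_in_space_form.intro E.space_form_axioms
      E.space_form_exp_axioms domain_in_space_form_axioms.intro curved_domain_axioms.intro ball_estimate_axioms.intro)
    show "closed_domain E.M \<Omega>" "C2_hypersurface E.M (boundary_in E.M \<Omega>)"
      using dom unfolding M compact_C2_domain_def by auto
    show "0 \<le> k0" "normal_curvatures_ge E.M minkowski \<Omega> k0" using k0 k unfolding M by auto
    fix x y :: "'a \<times> real" assume x: "x \<in> E.M" and y: "y \<in> E.M"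
    have xx: "minkowski x x = - 1 / k\<^sup>2" and yy: "minkowski y y = - 1 / k\<^sup>2"
      using E.M_norm'[OF x c] E.M_norm'[OF y c] by simp_all
    have xW: "x \<in> future_cone" "y \<in> future_cone" using x y E.M_subset_W by auto
    \<comment> \<open>This is cosh (k d) for the distance d to be determined; z below is the part of
      y tangent to M at x.\<close>
    define p where "p = - k\<^sup>2 * minkowski x y"
    have xy: "minkowski x y = - p / k\<^sup>2" using k by (simp add: p_def)
    have p: "p > 0" using minkowski_neg[OF xW] k by (simp add: p_def mult_pos_neg)
    define z where "z = y - p *\<^sub>R x"
    have xz: "minkowski x z = 0" by (simp add: z_def E.g_simps xx xy)
    have zz: "minkowski z z = (p\<^sup>2 - 1) / k\<^sup>2"
      using minkowski_sym[of y x]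
      by (simp add: z_def E.g_simps xx xy yy power2_eq_square field_simps) (simp add: diff_divide_distrib)
    obtain w t where w: "minkowski x w = 0" "minkowski w w = 1" "t \<ge> 0" "y = E.ray x w t"
    proof (cases "z = 0")
      case True
      obtain w where w: "- k\<^sup>2 * minkowski x w = 0" "minkowski w w = 1" by (rule E.exists_unit_tangent[OF xW(1), of x]) blast
      have "p\<^sup>2 = 1" using zz True k by (simp add: E.g_simps)
      then have "p = 1" using p by (auto simp: power2_eq_1_iff)
      then have "y = x" using True by (simp add: z_def)
      then show ?thesis using that[of w 0] w k by (simp add: E.ray_0)
    next
      case False
      have "minkowski z z > 0" using minkowski_positive[OF xW(1) xz False] .
      then have "p\<^sup>2 - 1 > 0" using zz k by (simp add: zero_less_divide_iff)
      then have p1: "p > 1" using p power2_less_imp_less[of 1 p] by simp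
      define s where "s = sqrt (p\<^sup>2 - 1)"
      have s: "s > 0" "s * s = p\<^sup>2 - 1" using \<open>p\<^sup>2 - 1 > 0\<close> by (auto simp: s_def)
      have zz': "minkowski z z = s * s / k\<^sup>2" using zz s(2) by simp
      define t where "t = arcosh p / k"
      define w where "w = (k / s) *\<^sub>R z"
      have "minkowski x w = 0" using xz by (simp add: w_def E.g_simps)
      moreover have "minkowski w w = 1"
        using k s(1) by (simp add: w_def E.g_simps zz' power2_eq_square)
      moreover have "t \<ge> 0" using p1 k by (simp add: t_def)
      moreover have "y = E.ray x w t"
        using p1 k s(1) by (simp add: E.ray_def t_def sinh_arcosh_real w_def z_def flip: s_def)
      ultimately show ?thesis by (rule that)
    qed
    have wt: "- k\<^sup>2 * minkowski x w = 0" using w(1) by simp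
    \<comment> \<open>The signed distance to the totally geodesic hypersurface through x orthogonal
      to w. Unlike the distance from x, it is smooth everywhere.\<close>
    define b where "b u = arsinh (k * minkowski u w) / k" for u
    define D where "D u v = minkowski v w / sqrt ((k * minkowski u w)\<^sup>2 + 1)" for u v
    have "b y - b x \<le> riem_dist E.M minkowski x y"
    proof (rule E.riem_dist_lower[where D=D])
      show "\<bar>D u v\<bar> \<le> sqrt (minkowski v v)" if u: "u \<in> E.M" "- k\<^sup>2 * minkowski u v = 0" for u v
      proof -
        define q where "q = (k * minkowski u w)\<^sup>2 + 1"
        have q: "q > 0" by (simp add: q_def add_nonneg_pos)
        have "(minkowski v w)\<^sup>2 \<le> minkowski v v * q"
          using E.slope_bound[OF u, of w] w(2) by (simp add: q_def power_mult_distrib add.commute)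
        then have "(minkowski v w)\<^sup>2 / q \<le> minkowski v v" using q by (simp add: divide_le_eq)
        then have "sqrt ((minkowski v w)\<^sup>2 / q) \<le> sqrt (minkowski v v)" by (rule real_sqrt_le_mono)
        then show ?thesis using q by (simp add: D_def q_def real_sqrt_divide abs_divide)
      qed
      show "((\<lambda>t. b (\<gamma> t)) has_vector_derivative D (\<gamma> t) v) (at t within S)"
        if \<gamma>: "(\<gamma> has_vector_derivative v) (at t within S)" for \<gamma> v t S
      proof -
        have "((\<lambda>t. minkowski (\<gamma> t) w) has_real_derivative minkowski v w) (at t within S)"
          using E.g.has_vector_derivative[OF \<gamma> has_vector_derivative_const[of w]]
          by (simp add: has_real_derivative_iff_has_vector_derivative E.g_simps)
        from DERIV_cmult[OF this, of k]
        have "((\<lambda>t. arsinh (k * minkowski (\<gamma> t) w)) has_real_derivative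
           1 / sqrt ((k * minkowski (\<gamma> t) w)\<^sup>2 + 1) * (k * minkowski v w)) (at t within S)"
          by (rule DERIV_chain2[OF arsinh_real_has_field_derivative])
        from DERIV_cdivide[OF this, of k]
        show ?thesis using k by (simp add: b_def D_def has_real_derivative_iff_has_vector_derivative)
      qed
      show "\<exists>\<gamma>. \<gamma> C1_differentiable_on {0..1} \<and> \<gamma> ` {0..1} \<subseteq> E.M \<and> \<gamma> 0 = x \<and> \<gamma> 1 = y"
        by (rule E.ray_path[OF x wt w(2,3)]) (use w(4) in auto)
    qed
    moreover have "b y = t" "b x = 0"
      using w k by (simp_all add: b_def E.ray_def E.g_simps arsinh_sinh_real)
    ultimately have "t \<le> riem_dist E.M minkowski x y" by simp
    then show "\<exists>w. - k\<^sup>2 * minkowski x w = 0 \<and> minkowski w w = 1 \<and> y = E.ray x w (riem_dist E.M minkowski x y) \<and>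
        0 \<le> riem_dist E.M minkowski x y \<and> 0 \<le> sinh (k * riem_dist E.M minkowski x y) / k"
      using w(3) k by (intro E.dist_rayI[OF x wt w(2,3) _ w(4)]) auto
  qed
qed

lemma hyperbolic_theorem:
  fixes \<Omega> :: "('a::euclidean_space \<times> real) set"
  assumes dim: "DIM('a) \<ge> 2" and k: "k > 0" and dom: "compact_C2_domain (hyperbolic_space k) \<Omega>"
    and k0: "k0 > k" "normal_curvatures_ge (hyperbolic_space k) minkowski \<Omega> k0"
    and Q: "Q \<in> top_of_set (hyperbolic_space k) interior_of \<Omega>" and P: "P \<in> boundary_in (hyperbolic_space k) \<Omega>"
  defines "h \<equiv> dist_to_boundary (hyperbolic_space k) minkowski \<Omega> Q"
    and "R \<equiv> 1 / k * arcoth (k0 / k)"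
  shows "cos (boundary_angle (hyperbolic_space k) minkowski \<Omega> Q P)
      \<ge> sqrt (1 - (sinh (k * (R - h)))\<^sup>2 / (sinh (k * R))\<^sup>2)"
    "sqrt (1 - (sinh (k * (R - h)))\<^sup>2 / (sinh (k * R))\<^sup>2) \<ge> sinh (k * h) / sinh (k * R)"
proof -
  interpret E: ball_estimate "minkowski :: 'a \<times> real \<Rightarrow> 'a \<times> real \<Rightarrow> real" "- k\<^sup>2" future_cone \<Omega> k0
    "\<lambda>t. cosh (k * t)" "\<lambda>t. sinh (k * t) / k"
    by (rule ball_estimate_hyperbolic[OF dim k dom k0])
  have M: "E.M = hyperbolic_space k" unfolding E.M_def by (rule hyperbolic_M[OF k])
  have PQ: "P \<in> boundary_in E.M \<Omega>" "Q \<in> top_of_set E.M interior_of \<Omega>" using P Q unfolding M by auto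
  define d where "d = riem_dist E.M minkowski Q P"
  define C where "C = cos (boundary_angle E.M minkowski \<Omega> Q P)"
  have h: "h = dist_to_boundary E.M minkowski \<Omega> Q" unfolding h_def M ..
  define \<rho> where "\<rho> = k * R"
  have \<rho>_eq: "\<rho> = arcoth (k0 / k)" using k by (simp add: \<rho>_def R_def)
  have coth: "cosh \<rho> / sinh \<rho> = k0 / k" unfolding \<rho>_eq using k k0(1) by (intro coth_arcoth) simp
  then have "sinh \<rho> > 0" using k k0(1) cosh_real_pos[of \<rho>]
    by (smt (verit) divide_pos_pos zero_less_divide_iff)
  then have \<rho>: "\<rho> > 0" by simp
  define S where "S = sinh \<rho>"
  have S: "S > 0" "cosh \<rho> = S * k0 / k" using \<open>sinh \<rho> > 0\<close> coth k by (auto simp: S_def field_simps)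
  have S2: "(S * k0 / k)\<^sup>2 = S\<^sup>2 + 1" using cosh_square_eq[of \<rho>] S(2) by (simp add: S_def)
  define G where "G = k0 / (- k\<^sup>2) * cosh (k * d) + sinh (k * d) / k * C"
  note est = E.curved_estimate[OF PQ, folded d_def C_def h, folded G_def]
  \<comment> \<open>cosh of k times the distance from Q to the centre of the touching ball, which is
    (S / k) (k0 P - N).\<close>
  define a where "a = cosh \<rho> * cosh (k * d) - sinh \<rho> * sinh (k * d) * C"
  have a: "a = - k * S * G" using k by (simp add: a_def G_def S(2) S_def[symmetric] field_simps power2_eq_square)
  \<comment> \<open>The square of the part of k0 P - N tangent at Q; multiplied by S^2 it becomes
    sinh^2 of the scaled distance whose cosh is a.\<close>
  define F where "F = k0\<^sup>2 / (- k\<^sup>2) + 1 - (- k\<^sup>2) * G\<^sup>2"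
  have "S\<^sup>2 * F = S\<^sup>2 - (S * k0 / k)\<^sup>2 + a\<^sup>2"
    by (simp add: F_def a power_mult_distrib power_divide algebra_simps)
  then have SF: "S\<^sup>2 * F = a\<^sup>2 - 1" using S2 by simp
  have c: "- k\<^sup>2 \<noteq> 0" using k by simp
  have F: "F \<ge> 0" unfolding F_def by (rule est(1)[OF c order_refl]) simp
  then have a1: "a\<^sup>2 \<ge> 1" using SF S(1) by (smt (verit) mult_nonneg_nonneg zero_le_power2)
  have sqrtF: "S * sqrt F = sqrt (a\<^sup>2 - 1)"
    using SF S(1) by (simp add: real_sqrt_mult flip: SF)
  have est': "cosh \<tau> * a + sinh \<tau> * sqrt (a\<^sup>2 - 1) \<le> cosh \<rho>" if \<tau>: "0 \<le> \<tau>" "\<tau> = 0 \<or> \<tau> < k * h" for \<tau>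
  proof -
    have "k0 / (- k\<^sup>2) \<le> cosh (k * (\<tau> / k)) * G - sinh (k * (\<tau> / k)) / k * sqrt F"
      unfolding F_def by (rule est(2)[OF c]) (use \<tau> k in \<open>auto simp: field_simps\<close>)
    then have "(k * S) * (k0 / (- k\<^sup>2)) \<le> (k * S) * (cosh \<tau> * G - sinh \<tau> / k * sqrt F)"
      using k S(1) by (intro mult_left_mono) auto
    moreover have "(k * S) * (k0 / (- k\<^sup>2)) = - cosh \<rho>" using k by (simp add: S(2) power2_eq_square)
    moreover have "(k * S) * (cosh \<tau> * G - sinh \<tau> / k * sqrt F) = - (cosh \<tau> * a) - sinh \<tau> * (S * sqrt F)"
      using k by (simp add: a algebra_simps)
    ultimately show ?thesis unfolding sqrtF by linarith
  qed
  have C: "0 \<le> C" "C \<le> 1" using E.cos_phi_pos[OF PQ] by (simp_all add: C_def)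
  have d: "k * d \<ge> 0"
    using E.sn_dist_pos[OF PQ] k by (simp add: d_def zero_less_divide_iff zero_less_mult_iff)
  have kh: "0 \<le> k * h" using E.h_bounds(1)[OF PQ] k h by simp
  note concl = hyperbolic_conclusion[OF \<rho> kh C d, folded a_def, OF a1 est']
  have "k * (R - h) = \<rho> - k * h" by (simp add: \<rho>_def algebra_simps)
  then show "cos (boundary_angle (hyperbolic_space k) minkowski \<Omega> Q P)
      \<ge> sqrt (1 - (sinh (k * (R - h)))\<^sup>2 / (sinh (k * R))\<^sup>2)"
    "sqrt (1 - (sinh (k * (R - h)))\<^sup>2 / (sinh (k * R))\<^sup>2) \<ge> sinh (k * h) / sinh (k * R)"
    using concl unfolding C_def M \<rho>_def by simp_all
qed

section \<open>The sphere\<close>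

lemma space_form_exp_sphere:
  assumes "DIM('a::euclidean_space) \<ge> 2" and k: "k > 0"
  shows "space_form_exp (inner :: 'a \<times> real \<Rightarrow> 'a \<times> real \<Rightarrow> real) (k\<^sup>2) (- {0})
    (\<lambda>t. cos (k * t)) (\<lambda>t. sin (k * t) / k)"
proof (intro space_form_exp.intro space_form.intro space_form_axioms.intro space_form_exp_axioms.intro
    bounded_bilinear_inner)
  show "\<exists>n. \<forall>w. \<phi> w = inner n w" if "bounded_linear \<phi>" for \<phi> :: "'a \<times> real \<Rightarrow> real"
    using that by (rule inner_riesz)
  show "((\<lambda>t. cos (k * t)) has_real_derivative - (k\<^sup>2) * (sin (k * t) / k)) (at t)"
    "((\<lambda>t. sin (k * t) / k) has_real_derivative cos (k * t)) (at t)" for t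
    using k by (auto intro!: derivative_eq_intros simp: power2_eq_square)
  show "(if k\<^sup>2 = 0 then 2 else 3) \<le> DIM('a \<times> real)" using assms(1) by simp
qed (use k in \<open>auto simp: inner_commute\<close>)

lemma sphere_M:
  assumes "k > 0"
  shows "{z \<in> - {0}. k\<^sup>2 \<noteq> 0 \<longrightarrow> k\<^sup>2 * inner z z = 1} = (sphere_space k :: ('a::euclidean_space \<times> real) set)"
proof -
  have "z \<noteq> 0 \<and> k\<^sup>2 * inner z z = 1 \<longleftrightarrow> norm z = 1 / k" for z :: "'a \<times> real"
  proof
    assume "z \<noteq> 0 \<and> k\<^sup>2 * inner z z = 1"
    then have "(k * norm z)\<^sup>2 = 1" by (simp add: power_mult_distrib power2_norm_eq_inner)
    then have "k * norm z = 1" using assms by (simp add: power2_eq_1_iff) (smt (verit) mult_nonneg_nonneg norm_ge_zero)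
    then show "norm z = 1 / k" using assms by (simp add: field_simps)
  next
    assume z: "norm z = 1 / k"
    then have "z \<noteq> 0" using assms by auto
    moreover have "k\<^sup>2 * inner z z = 1"
      using assms z by (simp add: power2_norm_eq_inner[symmetric] power_divide)
    ultimately show "z \<noteq> 0 \<and> k\<^sup>2 * inner z z = 1" by simp
  qed
  then show ?thesis using assms by (simp add: sphere_space_def set_eq_iff)
qed

lemma ball_estimate_sphere:
  fixes \<Omega> :: "('a::euclidean_space \<times> real) set"
  assumes dim: "DIM('a) \<ge> 2" and k: "k > 0" and dom: "compact_C2_domain (sphere_space k) \<Omega>"
    and k0: "k0 \<ge> 0" "normal_curvatures_ge (sphere_space k) inner \<Omega> k0"
  shows "ball_estimate inner (k\<^sup>2) (- {0}) \<Omega> k0 (\<lambda>t. cos (k * t)) (\<lambda>t. sin (k * t) / k)"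
proof -
  interpret E: space_form_exp "inner :: 'a \<times> real \<Rightarrow> 'a \<times> real \<Rightarrow> real" "k\<^sup>2" "- {0}"
    "\<lambda>t. cos (k * t)" "\<lambda>t. sin (k * t) / k"
    by (rule space_form_exp_sphere[OF dim k])
  have M: "E.M = sphere_space k" unfolding E.M_def by (rule sphere_M[OF k])
  have c: "k\<^sup>2 \<noteq> 0" using k by simp
  show ?thesis
  proof (intro ball_estimate.intro curved_domain.intro domain_in_space_form.intro E.space_form_axioms
      E.space_form_exp_axioms domain_in_space_form_axioms.intro curved_domain_axioms.intro ball_estimate_axioms.intro)
    show "closed_domain E.M \<Omega>" "C2_hypersurface E.M (boundary_in E.M \<Omega>)"
      using dom unfolding M compact_C2_domain_def by auto
    show "0 \<le> k0" "normal_curvatures_ge E.M inner \<Omega> k0" using k0 unfolding M by auto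
    fix x y :: "'a \<times> real" assume x: "x \<in> E.M" and y: "y \<in> E.M"
    have xx: "inner x x = 1 / k\<^sup>2" and yy: "inner y y = 1 / k\<^sup>2"
      using E.M_norm'[OF x c] E.M_norm'[OF y c] by simp_all
    have xW: "x \<in> - {0}" using x E.M_subset_W by auto
    \<comment> \<open>This is cos (k d) for the distance d to be determined.\<close>
    define p where "p = k\<^sup>2 * inner x y"
    have xy: "inner x y = p / k\<^sup>2" "inner y x = p / k\<^sup>2" using k by (simp_all add: p_def inner_commute)
    define z where "z = y - p *\<^sub>R x"
    have xz: "inner x z = 0" using k by (simp add: z_def inner_diff_right xx xy)
    have "inner z z = 1 / k\<^sup>2 - p * p / k\<^sup>2"
      by (simp add: z_def inner_diff_right inner_diff_left xx xy yy)
    then have zz: "inner z z = (1 - p * p) / k\<^sup>2" by (simp add: diff_divide_distrib)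
    have "(1 - p * p) / k\<^sup>2 \<ge> 0" unfolding zz[symmetric] by (rule inner_ge_zero)
    moreover have "k\<^sup>2 > 0" using k by simp
    ultimately have "0 \<le> 1 - p * p" by (simp only: zero_le_divide_iff) linarith
    then have "p\<^sup>2 \<le> 1" by (simp add: power2_eq_square)
    then have p: "-1 \<le> p" "p \<le> 1" by (auto simp: abs_square_le_1 abs_le_iff)
    define t where "t = arccos p / k"
    have t: "0 \<le> t" "k * t = arccos p" using k p by (simp_all add: t_def arccos_lbound)
    have sin_t: "sin (k * t) = sqrt (1 - p\<^sup>2)" "cos (k * t) = p" using p by (simp_all add: t(2) sin_arccos)
    obtain w where w: "inner x w = 0" "inner w w = 1" "y = E.ray x w t"
    proof (cases "z = 0")
      case True
      obtain w where w: "k\<^sup>2 * inner x w = 0" "inner w w = 1" by (rule E.exists_unit_tangent[OF xW, of x]) blast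
      have "p * p = 1" using zz True k by simp
      then show ?thesis using that[of w] w True k by (simp add: E.ray_def sin_t z_def power2_eq_square)
    next
      case False
      then have "inner z z > 0" by simp
      then have "1 - p * p > 0" using zz k by (simp add: zero_less_divide_iff)
      define s where "s = sqrt (1 - p\<^sup>2)"
      have s: "s > 0" "s * s = 1 - p * p" using \<open>1 - p * p > 0\<close> by (auto simp: s_def power2_eq_square)
      have zz': "inner z z = s * s / k\<^sup>2" using zz s(2) by simp
      define w where "w = (k / s) *\<^sub>R z"
      have "inner x w = 0" using xz by (simp add: w_def)
      moreover have "inner w w = 1" using k s(1) by (simp add: w_def zz' power2_eq_square)
      moreover have "y = E.ray x w t" using k s(1) by (simp add: E.ray_def sin_t w_def z_def flip: s_def)
      ultimately show ?thesis by (rule that)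
    qed
    have wt: "k\<^sup>2 * inner x w = 0" using w(1) by simp
    \<comment> \<open>k times the distance from x is arccos (k^2 g(u, x)), but arccos is not
      differentiable at 1 and -1, that is, at x and its antipode. The factor \<mu> < 1 keeps the
      argument away from these values; \<mu> tends to 1 afterwards.\<close>
    have lower: "(arccos (\<mu> * p) - arccos \<mu>) / k \<le> riem_dist E.M inner x y" if \<mu>: "0 < \<mu>" "\<mu> < 1" for \<mu>
    proof -
      define b where "b u = arccos (\<mu> * k\<^sup>2 * inner u x) / k" for u
      define D where "D u v = - (\<mu> * k * inner v x) / sqrt (1 - (\<mu> * k\<^sup>2 * inner u x)\<^sup>2)" for u v
      have lt: "\<bar>\<mu> * k\<^sup>2 * inner u x\<bar> < 1" if u: "u \<in> E.M" for u
      proof -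
        have "inner u u = 1 / k\<^sup>2" using E.M_norm'[OF u c] .
        then have "(inner u x)\<^sup>2 \<le> (1 / k\<^sup>2)\<^sup>2"
          using Cauchy_Schwarz_ineq[of u x] xx by (simp add: power2_eq_square)
        then have "\<bar>inner u x\<bar> \<le> 1 / k\<^sup>2" using k by (simp add: abs_le_square_iff[symmetric])
        then have "k\<^sup>2 * \<bar>inner u x\<bar> \<le> 1" using k by (simp add: field_simps)
        then have "\<mu> * (k\<^sup>2 * \<bar>inner u x\<bar>) \<le> \<mu> * 1" using \<mu> by (intro mult_left_mono) auto
        then have "\<mu> * (k\<^sup>2 * \<bar>inner u x\<bar>) < 1" using \<mu>(2) by linarith
        then show ?thesis using \<mu>(1) by (simp add: abs_mult mult.assoc)
      qed
      have "b y - b x \<le> riem_dist E.M inner x y"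
      proof (rule E.riem_dist_lower[where D=D])
        show "\<bar>D u v\<bar> \<le> sqrt (inner v v)" if u: "u \<in> E.M" "k\<^sup>2 * inner u v = 0" for u v
        proof -
          define m where "m = inner u x"
          define q where "q = 1 - (\<mu> * k\<^sup>2 * m)\<^sup>2"
          have "(\<mu> * k\<^sup>2 * m)\<^sup>2 < 1" using lt[OF u(1)] by (simp add: abs_square_less_1 m_def)
          then have q: "q > 0" by (simp add: q_def)
          have "(inner v x)\<^sup>2 \<le> inner v v * (1 / k\<^sup>2 - k\<^sup>2 * m\<^sup>2)"
            using E.slope_bound[OF u, of x] xx by (simp add: m_def)
          then have "(\<mu> * k)\<^sup>2 * (inner v x)\<^sup>2 \<le> (\<mu> * k)\<^sup>2 * (inner v v * (1 / k\<^sup>2 - k\<^sup>2 * m\<^sup>2))"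
            by (intro mult_left_mono) auto
          also have "\<dots> = inner v v * (\<mu>\<^sup>2 - (\<mu> * k\<^sup>2 * m)\<^sup>2)"
            using k by (simp add: power2_eq_square field_simps)
          also have "\<dots> \<le> inner v v * q"
            using \<mu> by (intro mult_left_mono) (simp_all add: q_def power_le_one)
          finally have "(\<mu> * k * inner v x)\<^sup>2 / q \<le> inner v v"
            using q by (simp add: divide_le_eq power_mult_distrib)
          then have "sqrt ((\<mu> * k * inner v x)\<^sup>2 / q) \<le> sqrt (inner v v)" by (rule real_sqrt_le_mono)
          moreover have "sqrt ((\<mu> * k * inner v x)\<^sup>2 / q) = \<bar>D u v\<bar>"
            using q by (simp add: D_def q_def m_def real_sqrt_divide)
          ultimately show ?thesis by simp
        qed
        show "((\<lambda>t. b (\<gamma> t)) has_vector_derivative D (\<gamma> t) v) (at t within S)"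
          if \<gamma>: "(\<gamma> has_vector_derivative v) (at t within S)" "\<gamma> t \<in> E.M" for \<gamma> v t S
        proof -
          have "((\<lambda>t. inner (\<gamma> t) x) has_real_derivative inner v x) (at t within S)"
            using E.g.has_vector_derivative[OF \<gamma>(1) has_vector_derivative_const[of x]]
            by (simp add: has_real_derivative_iff_has_vector_derivative)
          from DERIV_cmult[OF this, of "\<mu> * k\<^sup>2"]
          have d: "((\<lambda>t. \<mu> * k\<^sup>2 * inner (\<gamma> t) x) has_real_derivative \<mu> * k\<^sup>2 * inner v x) (at t within S)" .
          have "((\<lambda>t. arccos (\<mu> * k\<^sup>2 * inner (\<gamma> t) x)) has_real_derivative
             inverse (- sqrt (1 - (\<mu> * k\<^sup>2 * inner (\<gamma> t) x)\<^sup>2)) * (\<mu> * k\<^sup>2 * inner v x)) (at t within S)"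
            by (rule DERIV_chain2[OF DERIV_arccos d]) (use lt[OF \<gamma>(2)] in \<open>auto simp: abs_less_iff\<close>)
          from DERIV_cdivide[OF this, of k]
          have "((\<lambda>t. b (\<gamma> t)) has_real_derivative
             inverse (- sqrt (1 - (\<mu> * k\<^sup>2 * inner (\<gamma> t) x)\<^sup>2)) * (\<mu> * k\<^sup>2 * inner v x) / k) (at t within S)"
            by (simp add: b_def)
          moreover have "inverse (- s) * (\<mu> * k\<^sup>2 * m) / k = - (\<mu> * k * m) / s" for s m
            using k by (cases "s = 0") (simp_all add: field_simps power2_eq_square)
          ultimately show ?thesis by (simp only: D_def has_real_derivative_iff_has_vector_derivative)
        qed
        show "\<exists>\<gamma>. \<gamma> C1_differentiable_on {0..1} \<and> \<gamma> ` {0..1} \<subseteq> E.M \<and> \<gamma> 0 = x \<and> \<gamma> 1 = y"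
          by (rule E.ray_path[OF x wt w(2) t(1)]) (use w(3) in auto)
      qed
      moreover have "b y = arccos (\<mu> * p) / k" "b x = arccos \<mu> / k"
        using k by (simp_all add: b_def xx xy)
      ultimately show ?thesis by (simp add: diff_divide_distrib)
    qed
    \<comment> \<open>Letting \<mu> tend to 1 turns the lower bounds into arccos p / k = t.\<close>
    have "((\<lambda>\<mu>. (arccos (\<mu> * p) - arccos \<mu>) / k) \<longlongrightarrow> (arccos (1 * p) - arccos 1) / k) (at_left 1)"
    proof -
      have "continuous_on {0..1} (\<lambda>\<mu>. (arccos (\<mu> * p) - arccos \<mu>) / k)"
      proof (intro continuous_intros)
        show "\<forall>\<mu>\<in>{0..1}. -1 \<le> \<mu> * p \<and> \<mu> * p \<le> 1"
        proof
          fix \<mu> :: real assume "\<mu> \<in> {0..1}"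
          then have "\<bar>\<mu> * p\<bar> \<le> 1" using p by (simp add: abs_mult mult_le_one abs_le_iff)
          then show "-1 \<le> \<mu> * p \<and> \<mu> * p \<le> 1" by (simp add: abs_le_iff)
        qed
      qed (use k in auto)
      then have "((\<lambda>\<mu>. (arccos (\<mu> * p) - arccos \<mu>) / k) \<longlongrightarrow> (arccos (1 * p) - arccos 1) / k) (at 1 within {0..1})"
        unfolding continuous_on_def by (rule bspec) simp
      then show ?thesis by (simp add: at_within_Icc_at_left)
    qed
    moreover have "\<forall>\<^sub>F \<mu> in at_left (1::real). (arccos (\<mu> * p) - arccos \<mu>) / k \<le> riem_dist E.M inner x y"
      using lower eventually_at_left[of 0 "1::real"] by (auto intro!: exI[of _ 0])
    ultimately have "(arccos (1 * p) - arccos 1) / k \<le> riem_dist E.M inner x y"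
      by (rule tendsto_upperbound) simp
    then have "t \<le> riem_dist E.M inner x y" by (simp add: t_def)
    then show "\<exists>w. k\<^sup>2 * inner x w = 0 \<and> inner w w = 1 \<and> y = E.ray x w (riem_dist E.M inner x y) \<and>
        0 \<le> riem_dist E.M inner x y \<and> 0 \<le> sin (k * riem_dist E.M inner x y) / k"
      using sin_t(1) k \<open>p\<^sup>2 \<le> 1\<close> by (intro E.dist_rayI[OF x wt w(2) t(1) _ w(3)]) auto
  qed
qed

lemma spherical_theorem:
  fixes \<Omega> :: "('a::euclidean_space \<times> real) set"
  assumes dim: "DIM('a) \<ge> 2" and k: "k > 0" and dom: "compact_C2_domain (sphere_space k) \<Omega>"
    and k0: "k0 \<ge> 0" "normal_curvatures_ge (sphere_space k) inner \<Omega> k0"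
    and Q: "Q \<in> top_of_set (sphere_space k) interior_of \<Omega>" and P: "P \<in> boundary_in (sphere_space k) \<Omega>"
  defines "h \<equiv> dist_to_boundary (sphere_space k) inner \<Omega> Q"
    and "R \<equiv> 1 / k * arccot (k0 / k)"
  shows "cos (boundary_angle (sphere_space k) inner \<Omega> Q P)
      \<ge> sqrt (1 - (sin (k * (R - h)))\<^sup>2 / (sin (k * R))\<^sup>2)"
    "sqrt (1 - (sin (k * (R - h)))\<^sup>2 / (sin (k * R))\<^sup>2) \<ge> sin (k * h) / sin (k * R)"
proof -
  interpret E: ball_estimate "inner :: 'a \<times> real \<Rightarrow> 'a \<times> real \<Rightarrow> real" "k\<^sup>2" "- {0}" \<Omega> k0
    "\<lambda>t. cos (k * t)" "\<lambda>t. sin (k * t) / k"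
    by (rule ball_estimate_sphere[OF dim k dom k0])
  have M: "E.M = sphere_space k" unfolding E.M_def by (rule sphere_M[OF k])
  have PQ: "P \<in> boundary_in E.M \<Omega>" "Q \<in> top_of_set E.M interior_of \<Omega>" using P Q unfolding M by auto
  define d where "d = riem_dist E.M inner Q P"
  define C where "C = cos (boundary_angle E.M inner \<Omega> Q P)"
  have h: "h = dist_to_boundary E.M inner \<Omega> Q" unfolding h_def M ..
  define \<rho> where "\<rho> = k * R"
  have \<rho>_eq: "\<rho> = arccot (k0 / k)" using k by (simp add: \<rho>_def R_def)
  have \<rho>: "0 < \<rho>" "\<rho> \<le> pi / 2" using arccot_bounds[of "k0 / k"] k k0(1) by (simp_all add: \<rho>_eq)
  define S where "S = sin \<rho>"
  have "S > 0" unfolding S_def using \<rho> pi_gt_zero by (intro sin_gt_zero) linarith+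
  moreover have "cos \<rho> / sin \<rho> = k0 / k" using cot_arccot[of "k0 / k"] by (simp add: \<rho>_eq cot_def)
  ultimately have S: "S > 0" "cos \<rho> = S * k0 / k" using k by (auto simp: S_def field_simps)
  have S2: "(S * k0 / k)\<^sup>2 = 1 - S\<^sup>2" using S(2) cos_squared_eq[of \<rho>] by (simp add: S_def)
  define G where "G = k0 / k\<^sup>2 * cos (k * d) + sin (k * d) / k * C"
  note est = E.curved_estimate[OF PQ, folded d_def C_def h, folded G_def]
  \<comment> \<open>cos of k times the distance from Q to the centre (S / k) (k0 P - N) of the
    touching ball.\<close>
  define a where "a = cos \<rho> * cos (k * d) + sin \<rho> * sin (k * d) * C"
  have a: "a = k * S * G" using k by (simp add: a_def G_def S(2) S_def[symmetric] field_simps power2_eq_square)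
  define F where "F = k0\<^sup>2 / k\<^sup>2 + 1 - k\<^sup>2 * G\<^sup>2"
  have "S\<^sup>2 * F = S\<^sup>2 + (S * k0 / k)\<^sup>2 - a\<^sup>2"
    by (simp add: F_def a power_mult_distrib power_divide algebra_simps)
  then have SF: "S\<^sup>2 * F = 1 - a\<^sup>2" using S2 by simp
  have c: "k\<^sup>2 \<noteq> 0" using k by simp
  have F: "F \<ge> 0" unfolding F_def by (rule est(1)[OF c order_refl]) simp
  then have a1: "a\<^sup>2 \<le> 1" using SF S(1) by (smt (verit) mult_nonneg_nonneg zero_le_power2)
  have sqrtF: "S * sqrt F = sqrt (1 - a\<^sup>2)"
    using SF S(1) by (simp add: real_sqrt_mult flip: SF)
  have est': "cos \<rho> \<le> cos \<tau> * a - sin \<tau> * sqrt (1 - a\<^sup>2)" if \<tau>: "0 \<le> \<tau>" "\<tau> = 0 \<or> \<tau> < k * h" for \<tau>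
  proof -
    have "k0 / k\<^sup>2 \<le> cos (k * (\<tau> / k)) * G - sin (k * (\<tau> / k)) / k * sqrt F"
      unfolding F_def by (rule est(2)[OF c]) (use \<tau> k in \<open>auto simp: field_simps\<close>)
    then have "(k * S) * (k0 / k\<^sup>2) \<le> (k * S) * (cos \<tau> * G - sin \<tau> / k * sqrt F)"
      using k S(1) by (intro mult_left_mono) auto
    moreover have "(k * S) * (k0 / k\<^sup>2) = cos \<rho>" using k by (simp add: S(2) power2_eq_square)
    moreover have "(k * S) * (cos \<tau> * G - sin \<tau> / k * sqrt F) = cos \<tau> * a - sin \<tau> * (S * sqrt F)"
      using k by (simp add: a algebra_simps)
    ultimately show ?thesis unfolding sqrtF by linarith
  qed
  have C: "0 \<le> C" using E.cos_phi_pos[OF PQ] by (simp add: C_def)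
  have kh: "0 \<le> k * h" using E.h_bounds(1)[OF PQ] k h by simp
  note concl = spherical_conclusion[OF \<rho> kh C, of "k * d", folded a_def, OF a1 est']
  have "k * (R - h) = \<rho> - k * h" by (simp add: \<rho>_def algebra_simps)
  then show "cos (boundary_angle (sphere_space k) inner \<Omega> Q P)
      \<ge> sqrt (1 - (sin (k * (R - h)))\<^sup>2 / (sin (k * R))\<^sup>2)"
    "sqrt (1 - (sin (k * (R - h)))\<^sup>2 / (sin (k * R))\<^sup>2) \<ge> sin (k * h) / sin (k * R)"
    using concl unfolding C_def M \<rho>_def by simp_all
qed

theorem theorem1:
  fixes n :: nat
  assumes "n \<ge> 1" and "DIM('a::euclidean_space) = n + 1"
  shows
    "(\<forall>(\<Omega> :: 'a set) Q k0.
        compact_C2_domain UNIV \<Omega> \<and> Q \<in> top_of_set UNIV interior_of \<Omega> \<and>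
        k0 > 0 \<and> normal_curvatures_ge UNIV inner \<Omega> k0 \<longrightarrow>
        (let h = dist_to_boundary UNIV inner \<Omega> Q in
         \<forall>P\<in>boundary_in UNIV \<Omega>.
           cos (boundary_angle UNIV inner \<Omega> Q P) \<ge> sqrt (2 * h * k0 - h\<^sup>2 * k0\<^sup>2) \<and>
           sqrt (2 * h * k0 - h\<^sup>2 * k0\<^sup>2) \<ge> h * k0))
     \<and>
     (\<forall>k1 (\<Omega> :: ('a \<times> real) set) Q k0.
        k1 > 0 \<and>
        compact_C2_domain (hyperbolic_space k1) \<Omega> \<and>
        Q \<in> top_of_set (hyperbolic_space k1) interior_of \<Omega> \<and>
        k0 > k1 \<and> normal_curvatures_ge (hyperbolic_space k1) minkowski \<Omega> k0 \<longrightarrow>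
        (let h = dist_to_boundary (hyperbolic_space k1) minkowski \<Omega> Q;
             R = 1 / k1 * arcoth (k0 / k1) in
         \<forall>P\<in>boundary_in (hyperbolic_space k1) \<Omega>.
           cos (boundary_angle (hyperbolic_space k1) minkowski \<Omega> Q P)
             \<ge> sqrt (1 - (sinh (k1 * (R - h)))\<^sup>2 / (sinh (k1 * R))\<^sup>2) \<and>
           sqrt (1 - (sinh (k1 * (R - h)))\<^sup>2 / (sinh (k1 * R))\<^sup>2)
             \<ge> sinh (k1 * h) / sinh (k1 * R)))
     \<and>
     (\<forall>k1 (\<Omega> :: ('a \<times> real) set) Q k0.
        k1 > 0 \<and>
        compact_C2_domain (sphere_space k1) \<Omega> \<and>
        Q \<in> top_of_set (sphere_space k1) interior_of \<Omega> \<and>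
        k0 \<ge> 0 \<and> normal_curvatures_ge (sphere_space k1) inner \<Omega> k0 \<longrightarrow>
        (let h = dist_to_boundary (sphere_space k1) inner \<Omega> Q;
             R = 1 / k1 * arccot (k0 / k1) in
         \<forall>P\<in>boundary_in (sphere_space k1) \<Omega>.
           cos (boundary_angle (sphere_space k1) inner \<Omega> Q P)
             \<ge> sqrt (1 - (sin (k1 * (R - h)))\<^sup>2 / (sin (k1 * R))\<^sup>2) \<and>
           sqrt (1 - (sin (k1 * (R - h)))\<^sup>2 / (sin (k1 * R))\<^sup>2)
             \<ge> sin (k1 * h) / sin (k1 * R)))"
proof (intro conjI allI impI)
  have dim: "DIM('a) \<ge> 2" using assms by simp
  show "let h = dist_to_boundary UNIV inner \<Omega> Q in
         \<forall>P\<in>boundary_in UNIV \<Omega>.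
           cos (boundary_angle UNIV inner \<Omega> Q P) \<ge> sqrt (2 * h * k0 - h\<^sup>2 * k0\<^sup>2) \<and>
           sqrt (2 * h * k0 - h\<^sup>2 * k0\<^sup>2) \<ge> h * k0"
    if "compact_C2_domain UNIV \<Omega> \<and> Q \<in> top_of_set UNIV interior_of \<Omega> \<and>
        k0 > 0 \<and> normal_curvatures_ge UNIV inner \<Omega> k0" for \<Omega> :: "'a set" and Q k0
    using that euclidean_theorem[OF dim, of \<Omega> k0 Q] unfolding Let_def by blast
  show "let h = dist_to_boundary (hyperbolic_space k1) minkowski \<Omega> Q;
             R = 1 / k1 * arcoth (k0 / k1) in
         \<forall>P\<in>boundary_in (hyperbolic_space k1) \<Omega>.
           cos (boundary_angle (hyperbolic_space k1) minkowski \<Omega> Q P)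
             \<ge> sqrt (1 - (sinh (k1 * (R - h)))\<^sup>2 / (sinh (k1 * R))\<^sup>2) \<and>
           sqrt (1 - (sinh (k1 * (R - h)))\<^sup>2 / (sinh (k1 * R))\<^sup>2)
             \<ge> sinh (k1 * h) / sinh (k1 * R)"
    if "k1 > 0 \<and> compact_C2_domain (hyperbolic_space k1) \<Omega> \<and>
        Q \<in> top_of_set (hyperbolic_space k1) interior_of \<Omega> \<and>
        k0 > k1 \<and> normal_curvatures_ge (hyperbolic_space k1) minkowski \<Omega> k0"
    for k1 and \<Omega> :: "('a \<times> real) set" and Q k0
    using that hyperbolic_theorem[OF dim, of k1 \<Omega> k0 Q] unfolding Let_def by blast
  show "let h = dist_to_boundary (sphere_space k1) inner \<Omega> Q;
             R = 1 / k1 * arccot (k0 / k1) in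
         \<forall>P\<in>boundary_in (sphere_space k1) \<Omega>.
           cos (boundary_angle (sphere_space k1) inner \<Omega> Q P)
             \<ge> sqrt (1 - (sin (k1 * (R - h)))\<^sup>2 / (sin (k1 * R))\<^sup>2) \<and>
           sqrt (1 - (sin (k1 * (R - h)))\<^sup>2 / (sin (k1 * R))\<^sup>2)
             \<ge> sin (k1 * h) / sin (k1 * R)"
    if "k1 > 0 \<and> compact_C2_domain (sphere_space k1) \<Omega> \<and>
        Q \<in> top_of_set (sphere_space k1) interior_of \<Omega> \<and>
        k0 \<ge> 0 \<and> normal_curvatures_ge (sphere_space k1) inner \<Omega> k0"
    for k1 and \<Omega> :: "('a \<times> real) set" and Q k0
    using that spherical_theorem[OF dim, of k1 \<Omega> k0 Q] unfolding Let_def by blast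
qed

end
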